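(* Let $\Theta$ be a non-constant inner function. Let $f\in L^2$. Let $g=g_1+\overline{g_2}$, where $g_1,g_2\in K_\Theta$ and $g_1(0)=0$. Then $$H^\Theta_f A^\Theta_g=0$$ if and only if one of the following holds: 1. $g=0$. 2. $f$ is a constant. 3. $f\in K_\Theta+\mathbb{C}\Theta$, and $\overline{g},\ \overline{fg}\in H^2$. 4. There exist $\alpha,\beta\in\mathbb{C}$ such that (a) $g=g_1+\alpha\overline{\Theta}g_1+\beta\,(1-\Theta(0)\overline{\Theta})$; (b) $f(g_1+\beta),\ f(\alpha-\Theta)\in K_\Theta+\mathbb{C}\Theta$; (c) $\overline{\beta}\,\overline{f}+\overline{\alpha}\,\Theta\,\overline{g_1}\in H^2$.
   Context: $\mathbb{D}$ is the open unit disk; $L^2$ is the Lebesgue space of square integrable functions on the unit circle $\partial\mathbb{D}$; $H^2$ is the Hardy space, identified with the subspace of $L^2$ of functions whose negative Fourier coefficients vanish; $H^\infty$ is the space of bounded analytic functions on $\mathbb{D}$. $P$ is the orthogonal projection from $L^2$ onto $H^2$. An inner function is an analytic function $\Theta$ on $\mathbb{D}$ with $|\Theta|=1$ a.e. on $\partial\mathbb{D}$. For a non-constant inner function $\Theta$, the model space is $K_\Theta=H^2\ominus\Theta H^2$, and $P_\Theta$ is the orthogonal projection from $L^2$ onto $K_\Theta$, $P_\Theta h=Ph-\Theta P(\overline{\Theta}h)$. $K_\Theta+\mathbb{C}\Theta=\{h_1+c\Theta: h_1\in K_\Theta,\ c\in\mathbb{C}\}=\{h\in H^2:\Theta\overline{h}\in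 H^2\}$. For $\varphi\in L^2$, the truncated Toeplitz operator $A^\Theta_\varphi$ and the truncated Hankel operator $H^\Theta_\varphi$ are defined by $A^\Theta_\varphi u=P_\Theta(\varphi u)$ and $H^\Theta_\varphi u=(I-P_\Theta)(\varphi u)$ on the dense subset $K_\Theta\cap H^\infty$ of $K_\Theta$. $H^\Theta_fA^\Theta_g$ denotes the product (composition) of the two operators.
   Formalization: In 4(c), $\overline{g_1}$ is corrected to $\overline{fg_1}$ (as printed the claim fails for $\Theta=z^3$, $g_1=z$, $g_2=8z^2-2$, $f=1/(z-2)$); $H_fA_g=0$ means: defined at all reproducing kernels and zero on all bounded $u\in K_\Theta$ with $fA_gu\in L^2$. *)

theory Defs
  imports "HOL-Analysis.Analysis"
begin

text \<open>
  Functions on the unit circle are total functions on the complex plane, considered up to equality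
  almost everywhere for the following measure (concentrated on the circle): normalised arc length.
  It is completed, so that measurability also depends only on the almost-everywhere class.
\<close>

definition circ :: "complex measure" where
  "circ = completion (distr (uniform_measure lborel {0..2*pi}) borel cis)"

definition L2 :: "(complex \<Rightarrow> complex) set" where
  "L2 = {h. h \<in> borel_measurable circ \<and> integrable circ (\<lambda>z. (norm (h z))\<^sup>2)}"

definition ip :: "(complex \<Rightarrow> complex) \<Rightarrow> (complex \<Rightarrow> complex) \<Rightarrow> complex" where
  "ip h k = (LINT z|circ. h z * cnj (k z))"

definition fcoeff :: "(complex \<Rightarrow> complex) \<Rightarrow> int \<Rightarrow> complex" where
  "fcoeff h n = ip h (\<lambda>z. z powi n)"

definition H2 :: "(complex \<Rightarrow> complex) set" where
  "H2 = {h \<in> L2. \<forall>n<0. fcoeff h n = 0}"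

text \<open>Value at a point of the disk of the analytic function identified with \<open>h \<in> H2\<close>.\<close>

definition disk_value :: "(complex \<Rightarrow> complex) \<Rightarrow> complex \<Rightarrow> complex" where
  "disk_value h w = (\<Sum>n. fcoeff h (int n) * w ^ n)"

text \<open>
  Orthogonal projection of \<open>L2\<close> onto a closed subspace \<open>S\<close>.  The result is determined only almost
  everywhere; \<open>SOME\<close> picks a representative.
\<close>

definition oproj :: "(complex \<Rightarrow> complex) set \<Rightarrow> (complex \<Rightarrow> complex) \<Rightarrow> complex \<Rightarrow> complex" where
  "oproj S h = (SOME p. p \<in> S \<and> (\<forall>s\<in>S. ip (\<lambda>z. h z - p z) s = 0))"

definition radial_lim :: "(complex \<Rightarrow> complex) \<Rightarrow> complex \<Rightarrow> complex" where
  "radial_lim F z = Lim (at_left 1) (\<lambda>r. F (complex_of_real r * z))"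

definition has_boundary_values :: "(complex \<Rightarrow> complex) \<Rightarrow> (complex \<Rightarrow> complex) \<Rightarrow> bool" where
  "has_boundary_values F h \<longleftrightarrow>
     (AE z in circ. ((\<lambda>r. F (complex_of_real r * z)) \<longlongrightarrow> h z) (at_left 1))"

definition Hinf :: "(complex \<Rightarrow> complex) set" where
  "Hinf = {h. h \<in> borel_measurable circ \<and>
     (\<exists>F. F holomorphic_on ball 0 1 \<and> bounded (F ` ball 0 1) \<and> has_boundary_values F h)}"

text \<open>
  Boundedness on the disk is part of the notion of an inner function: the condition on the boundary
  values alone would admit functions such as \<open>exp ((1 + z) / (1 - z))\<close>.
\<close>

definition inner_function :: "(complex \<Rightarrow> complex) \<Rightarrow> bool" where
  "inner_function \<Theta> \<longleftrightarrow> \<Theta> holomorphic_on ball 0 1 \<and> bounded (\<Theta> ` ball 0 1) \<and>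
     has_boundary_values \<Theta> (radial_lim \<Theta>) \<and> (AE z in circ. norm (radial_lim \<Theta> z) = 1)"

text \<open>
  Below, \<open>\<Theta>\<close> is always the function on the disk and \<open>radial_lim \<Theta>\<close> the function on the circle
  with which it is identified.
\<close>

definition model_space :: "(complex \<Rightarrow> complex) \<Rightarrow> (complex \<Rightarrow> complex) set" where
  "model_space \<Theta> = {h \<in> H2. \<forall>k\<in>H2. ip h (\<lambda>z. radial_lim \<Theta> z * k z) = 0}"

definition model_space_plus :: "(complex \<Rightarrow> complex) \<Rightarrow> (complex \<Rightarrow> complex) set" where
  "model_space_plus \<Theta> =
     {h. \<exists>h1\<in>model_space \<Theta>. \<exists>c. AE z in circ. h z = h1 z + c * radial_lim \<Theta> z}"

definition trunc_toeplitz ::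
    "(complex \<Rightarrow> complex) \<Rightarrow> (complex \<Rightarrow> complex) \<Rightarrow> (complex \<Rightarrow> complex) \<Rightarrow> complex \<Rightarrow> complex" where
  "trunc_toeplitz \<Theta> \<phi> u = oproj (model_space \<Theta>) (\<lambda>z. \<phi> z * u z)"

definition trunc_hankel ::
    "(complex \<Rightarrow> complex) \<Rightarrow> (complex \<Rightarrow> complex) \<Rightarrow> (complex \<Rightarrow> complex) \<Rightarrow> complex \<Rightarrow> complex" where
  "trunc_hankel \<Theta> \<phi> u = (\<lambda>z. \<phi> z * u z - oproj (model_space \<Theta>) (\<lambda>z. \<phi> z * u z) z)"

text \<open>Reproducing kernel of the model space at the point \<open>w\<close> of the disk.\<close>

definition model_kernel :: "(complex \<Rightarrow> complex) \<Rightarrow> complex \<Rightarrow> complex \<Rightarrow> complex" where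
  "model_kernel \<Theta> w = (\<lambda>z. (1 - cnj (\<Theta> w) * radial_lim \<Theta> z) / (1 - cnj w * z))"

text \<open>
  The Toeplitz factor maps bounded functions of the model space to functions of the model space that
  need not be bounded.  The Hankel factor is applied to such a function \<open>v\<close> whenever \<open>f v\<close> is
  still in \<open>L2\<close>, where its defining formula makes sense; this gives the product its maximal domain
  inside the bounded functions of the model space.
\<close>

definition hankel_toeplitz_dom ::
    "(complex \<Rightarrow> complex) \<Rightarrow> (complex \<Rightarrow> complex) \<Rightarrow> (complex \<Rightarrow> complex) \<Rightarrow> (complex \<Rightarrow> complex) set" where
  "hankel_toeplitz_dom \<Theta> f g =
     {u \<in> model_space \<Theta> \<inter> Hinf. (\<lambda>z. f z * trunc_toeplitz \<Theta> g u z) \<in> L2}"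

text \<open>
  The product is zero if it is defined at all reproducing kernels (whose span is dense in the model
  space) and vanishes on its whole domain.  Without the first requirement the product could be zero
  merely for lack of elements in its domain.
\<close>

definition hankel_toeplitz_zero ::
    "(complex \<Rightarrow> complex) \<Rightarrow> (complex \<Rightarrow> complex) \<Rightarrow> (complex \<Rightarrow> complex) \<Rightarrow> bool" where
  "hankel_toeplitz_zero \<Theta> f g \<longleftrightarrow>
     (\<forall>w\<in>ball 0 1. model_kernel \<Theta> w \<in> hankel_toeplitz_dom \<Theta> f g) \<and>
     (\<forall>u\<in>hankel_toeplitz_dom \<Theta> f g.
        AE z in circ. trunc_hankel \<Theta> f (trunc_toeplitz \<Theta> g u) z = 0)"

end

theory Submission
  imports Defs "HOL-Complex_Analysis.Complex_Analysis"
begin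

text \<open>
  Write \<open>\<theta>\<close> for the boundary function of \<open>\<Theta>\<close> and \<open>G\<^sub>i = \<theta> * cnj g\<^sub>i\<close>.  On reproducing kernels the
  Toeplitz factor is explicit: \<open>(1 - cnj w * z) * A\<^sub>g k\<^sub>w\<close> equals
  \<open>g\<^sub>1 + cnj (g\<^sub>2 w) - cnj (G\<^sub>1 w) * \<theta> - cnj (\<Theta> w) * G\<^sub>2\<close>, so \<open>H\<^sub>f A\<^sub>g = 0\<close> forces \<open>f\<close> times this
  function into \<open>K\<^sub>\<Theta> + \<complex>\<Theta>\<close> for every \<open>w\<close>.  As \<open>w\<close> varies, the coefficients \<open>1, g\<^sub>2 w, G\<^sub>1 w, \<Theta> w\<close>
  separate the four terms as far as they are linearly independent.  If they are independent, then \<open>f\<close>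
  and \<open>f * \<theta>\<close> lie in \<open>K\<^sub>\<Theta> + \<complex>\<Theta>\<close>, so \<open>f\<close> is constant; \<open>g\<^sub>1 = 0\<close> leads to the first or the third
  condition; and a relation \<open>g\<^sub>2 = cnj \<beta> + cnj \<alpha> * G\<^sub>1 + d * \<Theta>\<close> leads to the fourth, where
  \<open>d = - cnj \<beta> * cnj (\<Theta> 0)\<close> because \<open>g\<^sub>2\<close> is orthogonal to \<open>\<Theta>\<close>.  Conversely, each condition lets one
  write \<open>A\<^sub>g u\<close> and \<open>f * A\<^sub>g u\<close>, together with their images under \<open>h \<mapsto> \<theta> * cnj z * cnj h\<close>, as sums of
  products of two functions in \<open>H2\<close>; such products have no negative Fourier coefficients.
\<close>

text \<open>Two obstacles shape the proof. The functions \<open>f\<close> and \<open>A_g u\<close>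
  may both be unbounded, so a product of two functions in \<open>H2\<close> is known only to lie in
  \<open>H1\<close>; square integrability has to come from the domain of the operator product, and
  \<open>H2\<close> is then recovered as the intersection of \<open>L2\<close> and
  \<open>H1\<close>. Secondly, \<open>oproj\<close> is a choice that cannot be computed with: every
  projection is recognised from a decomposition \<open>v + \<theta> * a + cnj (z * b)\<close> with
  \<open>v\<close> in the model space and \<open>a\<close>, \<open>b\<close> in \<open>H2\<close>.
  Clearing the denominator \<open>1 - cnj w * z\<close> costs one factor \<open>z\<close>, which is
  the passage from the model space to its sum with the multiples of \<theta>. In the dependent case
  the relation for g2 leaves three functions, \<open>g1 + \<beta>\<close>,
  \<open>\<alpha> - \<theta>\<close> and \<open>\<beta> * \<theta> + \<alpha> * g1\<close>, with
  independent coefficients. The first two give (b); \<theta> times the conjugate of \<open>f\<close>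
  times the third gives (c). The normalisation g1(0) = 0 acts twice: it makes 1, G1 and \<theta>
  independent as soon as g1 is nonzero and \<Theta> is non-constant, and it removes G1 from the
  equation that determines d.\<close>

section \<open>Arc length measure\<close>

lemma emeasure_distr_cis_UNIV:
  "emeasure (distr (uniform_measure lborel {0..2*pi}) borel cis) UNIV = 1"
proof -
  have m: "cis \<in> borel_measurable (uniform_measure lborel {0..2*pi})"
    by (subst measurable_cong_sets[of _ borel]) (auto intro!: borel_measurable_continuous_onI continuous_intros)
  have "emeasure lborel {0..2*pi} = ennreal (2*pi)" by simp
  then have "emeasure (uniform_measure lborel {0..2*pi}) UNIV = 1"
    using pi_gt_zero by (simp add: ennreal_divide_self)
  then show ?thesis using m by (simp add: emeasure_distr)
qed

lemma space_circ [simp]: "space circ = UNIV"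
  by (simp add: circ_def)

lemma finite_measure_circ: "finite_measure circ"
proof
  have "emeasure circ UNIV = 1"
    unfolding circ_def using emeasure_distr_cis_UNIV by simp
  then show "emeasure circ (space circ) \<noteq> \<infinity>" by simp
qed

interpretation circ: finite_measure circ
  by (rule finite_measure_circ)

interpretation circ: complete_measure circ
  unfolding circ_def by (rule completion.complete_measure_axioms)

lemma measure_circ_UNIV [simp]: "measure circ UNIV = 1"
  unfolding circ_def measure_def using emeasure_distr_cis_UNIV by simp

lemma borel_measurable_circ:
  fixes f :: "complex \<Rightarrow> 'a::topological_space"
  assumes "f \<in> borel_measurable borel"
  shows "f \<in> borel_measurable circ"
  unfolding circ_def using assms by (intro measurable_completion) simp

lemma sets_circ_borel: "A \<in> sets borel \<Longrightarrow> A \<in> sets circ"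
  unfolding circ_def by (rule sets_completionI_sets) simp

lemma AE_circ_norm: "AE z in circ. norm z = 1"
proof -
  have m: "cis \<in> uniform_measure lborel {0..2*pi} \<rightarrow>\<^sub>M borel"
    by (subst measurable_cong_sets[of _ borel]) (auto intro!: borel_measurable_continuous_onI continuous_intros)
  show ?thesis
    unfolding circ_def by (intro AE_completion) (subst AE_distr_iff[OF m], auto)
qed

text \<open>Completeness is what makes this true: the preimages of a set under the two functions
  differ by a null set. It lets representatives be exchanged freely below.\<close>

lemma borel_measurable_circ_cong_AE:
  fixes f g :: "complex \<Rightarrow> 'a::topological_space"
  assumes f: "f \<in> borel_measurable circ" and ae: "AE z in circ. f z = g z"
  shows "g \<in> borel_measurable circ"
proof (rule measurableI)
  fix A :: "'a set" assume A: "A \<in> sets borel"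
  have "AE z in circ. z \<in> f -` A \<inter> space circ \<longleftrightarrow> z \<in> g -` A \<inter> space circ"
    using ae by eventually_elim auto
  then show "g -` A \<inter> space circ \<in> sets circ"
    by (rule circ.in_sets_AE) (use measurable_sets[OF f A] in auto)
qed auto

lemma borel_measurable_power_int [measurable (raw)]:
  fixes f :: "'a \<Rightarrow> complex"
  assumes [measurable]: "f \<in> borel_measurable M"
  shows "(\<lambda>x. f x powi n) \<in> borel_measurable M"
  unfolding power_int_def by measurable

lemma id_measurable_circ [measurable]: "(\<lambda>z. z) \<in> borel_measurable circ"
  by (rule borel_measurable_circ) simp

lemma integral_circ_borel:
  fixes f :: "complex \<Rightarrow> complex"
  assumes [measurable]: "f \<in> borel_measurable borel"
  shows "(LINT z|circ. f z) = (LINT t|lborel. (indicator {0..2*pi} t / (2*pi)) *\<^sub>R f (cis t))"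
proof -
  have cis [measurable]: "cis \<in> borel_measurable borel"
    by (intro borel_measurable_continuous_onI continuous_intros)
  have u: "uniform_measure lborel {0..2*pi} = density lborel (\<lambda>t. ennreal (indicator {0..2*pi} t / (2*pi)))"
    unfolding uniform_measure_def
    by (intro arg_cong2[where f=density] ext refl)
       (auto simp: indicator_def divide_ennreal[symmetric] ennreal_numeral)
  have "(LINT z|circ. f z) = (LINT z|distr (uniform_measure lborel {0..2*pi}) borel cis. f z)"
    unfolding circ_def by (rule integral_completion) simp
  also have "\<dots> = (LINT t|uniform_measure lborel {0..2*pi}. f (cis t))"
    by (rule integral_distr) (auto simp: measurable_cong_sets[of "uniform_measure lborel {0..2*pi}" borel])
  also have "\<dots> = (LINT t|lborel. (indicator {0..2*pi} t / (2*pi)) *\<^sub>R f (cis t))"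
    unfolding u by (rule integral_density) auto
  finally show ?thesis .
qed

lemma integral_circ_powi: "(LINT z|circ. z powi n) = (if n = 0 then 1 else 0)"
proof (cases "n = 0")
  case True
  then show ?thesis by simp
next
  case False
  have "(LINT z|circ. z powi n) = (LINT t|lborel. (indicator {0..2*pi} t / (2*pi)) *\<^sub>R (cis t powi n))"
    by (rule integral_circ_borel) measurable
  also have "\<dots> = (LINT t|lborel. indicator {0..2*pi} t *\<^sub>R (cis (of_int n * t) / (2*pi)))"
    by (intro Bochner_Integration.integral_cong) (auto simp: cis_power_int indicator_def scaleR_conv_of_real)
  also have "\<dots> = cis (of_int n * (2*pi)) / (2*pi*\<i>* of_int n) - cis (of_int n * 0) / (2*pi*\<i>* of_int n)"
  proof (rule integral_FTC_Icc)
    show "((\<lambda>t. cis (of_int n * t) / (2*pi*\<i>* of_int n)) has_vector_derivative cis (of_int n * x) / (2*pi))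
       (at x within {0..2*pi})" for x
    proof -
      have "((\<lambda>t. cis (of_int n * t)) has_vector_derivative (of_int n *\<^sub>R (\<i> * cis (of_int n * x)))) (at x within {0..2*pi})"
        unfolding has_vector_derivative_def
        by (rule has_derivative_cis[THEN has_derivative_eq_rhs]) (auto intro!: derivative_eq_intros simp: fun_eq_iff scaleR_conv_of_real)
      from has_vector_derivative_divide[OF this, of "2*pi*\<i>* of_int n"] show ?thesis
        using False by (simp add: scaleR_conv_of_real field_simps)
    qed
    show "continuous_on {0..2*pi} (\<lambda>t. cis (of_int n * t) / (2*pi))"
      by (intro continuous_intros) auto
  qed auto
  also have "cis (of_int n * (2*pi)) = 1"
    using cis_multiple_2pi[of "real_of_int n"] by (simp add: mult_ac)
  finally show ?thesis using False by simp
qed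

section \<open>Square integrable functions and Fourier coefficients\<close>

lemma borel_measurable_cnj [measurable (raw)]:
  "f \<in> borel_measurable M \<Longrightarrow> (\<lambda>x. cnj (f x)) \<in> borel_measurable M"
  by (rule measurable_compose[of f M borel cnj borel]) (auto intro!: borel_measurable_continuous_onI continuous_intros)

lemma fcoeff_cong_AE:
  assumes "h \<in> borel_measurable circ" "AE z in circ. h z = k z"
  shows "fcoeff h n = fcoeff k n"
  unfolding fcoeff_def ip_def
proof (rule integral_cong_AE)
  have [measurable]: "h \<in> borel_measurable circ" "k \<in> borel_measurable circ"
    using assms borel_measurable_circ_cong_AE[OF assms] by auto
  show "(\<lambda>z. h z * cnj (z powi n)) \<in> borel_measurable circ" by measurable
  show "(\<lambda>z. k z * cnj (z powi n)) \<in> borel_measurable circ" by measurable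
  show "AE z in circ. h z * cnj (z powi n) = k z * cnj (z powi n)"
    using assms(2) by eventually_elim simp
qed

lemma L2_cong_AE:
  assumes "h \<in> L2" "AE z in circ. h z = k z"
  shows "k \<in> L2"
proof -
  have [measurable]: "h \<in> borel_measurable circ" and i: "integrable circ (\<lambda>z. (norm (h z))\<^sup>2)"
    using assms by (auto simp: L2_def)
  have [measurable]: "k \<in> borel_measurable circ"
    by (rule borel_measurable_circ_cong_AE[OF _ assms(2)]) measurable
  have "integrable circ (\<lambda>z. (norm (k z))\<^sup>2)"
    by (rule integrable_cong_AE_imp[OF i]) (use assms in auto)
  then show ?thesis by (simp add: L2_def)
qed

lemma L2_measurable [measurable_dest]: "h \<in> L2 \<Longrightarrow> h \<in> borel_measurable circ"
  by (simp add: L2_def)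

lemma L2_integrable_sq: "h \<in> L2 \<Longrightarrow> integrable circ (\<lambda>z. (norm (h z))\<^sup>2)"
  by (simp add: L2_def)

lemma L2_bounded_mult:
  assumes h: "h \<in> L2" and [measurable]: "k \<in> borel_measurable circ" and b: "AE z in circ. norm (k z) \<le> B"
  shows "(\<lambda>z. k z * h z) \<in> L2"
proof -
  have [measurable]: "h \<in> borel_measurable circ" using h by measurable
  have "integrable circ (\<lambda>z. (norm (k z * h z))\<^sup>2)"
  proof (rule Bochner_Integration.integrable_bound)
    show "integrable circ (\<lambda>z. B\<^sup>2 * (norm (h z))\<^sup>2)" using L2_integrable_sq[OF h] by simp
    show "AE z in circ. norm ((norm (k z * h z))\<^sup>2) \<le> norm (B\<^sup>2 * (norm (h z))\<^sup>2)"
      using b by eventually_elim (auto simp: norm_mult power_mult_distrib intro!: mult_right_mono power_mono)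
  qed measurable
  then show ?thesis by (simp add: L2_def)
qed

lemma L2_cmult: "h \<in> L2 \<Longrightarrow> (\<lambda>z. c * h z) \<in> L2"
  by (rule L2_bounded_mult[where B = "norm c"]) auto

lemma L2_add:
  assumes "h \<in> L2" "k \<in> L2"
  shows "(\<lambda>z. h z + k z) \<in> L2"
proof -
  have [measurable]: "h \<in> borel_measurable circ" "k \<in> borel_measurable circ" using assms by measurable
  have "integrable circ (\<lambda>z. (norm (h z + k z))\<^sup>2)"
  proof (rule Bochner_Integration.integrable_bound)
    show "integrable circ (\<lambda>z. 2 * (norm (h z))\<^sup>2 + 2 * (norm (k z))\<^sup>2)"
      using assms by (simp add: L2_def)
    have "(norm (a + b))\<^sup>2 \<le> 2 * (norm a)\<^sup>2 + 2 * (norm b)\<^sup>2" for a b :: complex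
    proof -
      have "(norm (a + b))\<^sup>2 \<le> (norm a + norm b)\<^sup>2" by (intro power_mono norm_triangle_ineq) auto
      also have "\<dots> \<le> 2 * (norm a)\<^sup>2 + 2 * (norm b)\<^sup>2"
        using sum_squares_bound[of "norm a" "norm b"] by (simp add: power2_sum)
      finally show ?thesis .
    qed
    then show "AE z in circ. norm ((norm (h z + k z))\<^sup>2) \<le> norm (2 * (norm (h z))\<^sup>2 + 2 * (norm (k z))\<^sup>2)"
      by auto
  qed measurable
  then show ?thesis by (simp add: L2_def)
qed

lemma L2_uminus: "h \<in> L2 \<Longrightarrow> (\<lambda>z. - h z) \<in> L2"
  using L2_cmult[of h "-1"] by simp

lemma L2_diff: "h \<in> L2 \<Longrightarrow> k \<in> L2 \<Longrightarrow> (\<lambda>z. h z - k z) \<in> L2"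
  using L2_add[OF _ L2_uminus, of h k] by simp

lemma L2_const: "(\<lambda>z. c) \<in> L2"
  by (simp add: L2_def)

lemma L2_cnj: "h \<in> L2 \<Longrightarrow> (\<lambda>z. cnj (h z)) \<in> L2"
  by (auto simp: L2_def)

lemma L2_sum: "(\<And>i. i \<in> I \<Longrightarrow> h i \<in> L2) \<Longrightarrow> (\<lambda>z. \<Sum>i\<in>I. h i z) \<in> L2"
  by (induction I rule: infinite_finite_induct) (auto intro: L2_const L2_add)

lemma L2_mult_integrable:
  assumes "h \<in> L2" "k \<in> L2"
  shows "integrable circ (\<lambda>z. h z * k z)"
proof (rule Bochner_Integration.integrable_bound)
  show "integrable circ (\<lambda>z. (norm (h z))\<^sup>2 + (norm (k z))\<^sup>2)"
    using assms by (simp add: L2_def)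
  have "norm (a * b) \<le> (norm a)\<^sup>2 + (norm b)\<^sup>2" for a b :: complex
    using sum_squares_bound[of "norm a" "norm b"] mult_nonneg_nonneg[OF norm_ge_zero[of a] norm_ge_zero[of b]]
    unfolding norm_mult by linarith
  then show "AE z in circ. norm (h z * k z) \<le> norm ((norm (h z))\<^sup>2 + (norm (k z))\<^sup>2)"
    by auto
  show "(\<lambda>z. h z * k z) \<in> borel_measurable circ"
    using assms by measurable
qed

lemma L2_integrable: "h \<in> L2 \<Longrightarrow> integrable circ h"
  using L2_mult_integrable[OF _ L2_const[of 1]] by simp

text \<open>Cauchy-Schwarz for nonnegative extended integrals; square integrability makes all three
  integrals finite, so the inequality descends to the reals.\<close>

lemma integral_mult_sq_le:
  assumes "h \<in> L2" "k \<in> L2"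
  shows "(LINT z|circ. norm (h z * k z))\<^sup>2 \<le> (LINT z|circ. (norm (h z))\<^sup>2) * (LINT z|circ. (norm (k z))\<^sup>2)"
proof -
  have [measurable]: "h \<in> borel_measurable circ" "k \<in> borel_measurable circ" using assms by measurable
  have 1: "(\<integral>\<^sup>+z. ennreal (norm (h z)) * ennreal (norm (k z)) \<partial>circ) = ennreal (LINT z|circ. norm (h z * k z))"
    using integrable_norm[OF L2_mult_integrable[OF assms]]
    by (subst nn_integral_eq_integral[symmetric]) (auto simp: norm_mult ennreal_mult)
  have 2: "(\<integral>\<^sup>+z. (ennreal (norm (u z)))\<^sup>2 \<partial>circ) = ennreal (LINT z|circ. (norm (u z))\<^sup>2)" if "u \<in> L2" for u
    using L2_integrable_sq[OF that]
    by (subst nn_integral_eq_integral[symmetric]) (auto simp: ennreal_power)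
  have "(\<integral>\<^sup>+z. ennreal (norm (h z)) * ennreal (norm (k z)) \<partial>circ)\<^sup>2
      \<le> (\<integral>\<^sup>+z. (ennreal (norm (h z)))\<^sup>2 \<partial>circ) * (\<integral>\<^sup>+z. (ennreal (norm (k z)))\<^sup>2 \<partial>circ)"
    by (rule Cauchy_Schwarz_nn_integral) measurable
  then show ?thesis
    unfolding 1 2[OF assms(1)] 2[OF assms(2)]
    by (simp add: ennreal_power ennreal_mult[symmetric])
qed

lemma cnj_powi_circle: "norm z = 1 \<Longrightarrow> cnj (z powi n) = z powi (- n)"
  using rcis_cmod_Arg[of z] by (metis cis_cnj cis_power_int mult_minus_left of_int_minus rcis_def mult_1 of_real_1)

lemma fcoeff_eq:
  assumes [measurable]: "h \<in> borel_measurable circ"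
  shows "fcoeff h n = (LINT z|circ. z powi (- n) * h z)"
  unfolding fcoeff_def ip_def
proof (rule integral_cong_AE)
  show "AE z in circ. h z * cnj (z powi n) = z powi (- n) * h z"
    using AE_circ_norm by eventually_elim (metis cnj_powi_circle mult.commute)
qed measurable

lemma integrable_bounded_mult:
  fixes h k :: "complex \<Rightarrow> complex"
  assumes h: "integrable circ h" and [measurable]: "k \<in> borel_measurable circ" and b: "AE z in circ. norm (k z) \<le> B"
  shows "integrable circ (\<lambda>z. k z * h z)"
proof (rule Bochner_Integration.integrable_bound)
  show "integrable circ (\<lambda>z. of_real B * h z)" using h by simp
  show "AE z in circ. norm (k z * h z) \<le> norm (of_real B * h z)"
    using b by eventually_elim (auto simp: norm_mult intro!: mult_right_mono)
  show "(\<lambda>z. k z * h z) \<in> borel_measurable circ" using h by measurable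
qed

lemma AE_norm_powi_le: "AE z in circ. norm (z powi n) \<le> 1"
  using AE_circ_norm by eventually_elim (simp add: norm_power_int)

lemma integrable_powi_mult: "integrable circ h \<Longrightarrow> integrable circ (\<lambda>z. z powi n * h z)" for h :: "complex \<Rightarrow> complex"
  by (rule integrable_bounded_mult[OF _ _ AE_norm_powi_le]) measurable

lemma L2_powi_mult: "h \<in> L2 \<Longrightarrow> (\<lambda>z. z powi n * h z) \<in> L2"
  by (rule L2_bounded_mult[OF _ _ AE_norm_powi_le]) measurable

lemma fcoeff_shift:
  assumes "h \<in> borel_measurable circ"
  shows "fcoeff (\<lambda>z. z powi m * h z) n = fcoeff h (n - m)"
proof -
  have "(LINT z|circ. z powi (- n) * (z powi m * h z)) = (LINT z|circ. z powi (- (n - m)) * h z)"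
  proof (rule integral_cong_AE)
    show "AE z in circ. z powi (- n) * (z powi m * h z) = z powi (- (n - m)) * h z"
      using AE_circ_norm
    proof eventually_elim
      case (elim z)
      then have "z powi (- n) * z powi m = z powi (- (n - m))"
        by (subst power_int_add[symmetric]) (auto simp: algebra_simps)
      then show ?case by (metis mult.assoc)
    qed
  qed (use assms in measurable)
  then show ?thesis using assms by (simp add: fcoeff_eq)
qed

lemma fcoeff_cnj: "fcoeff (\<lambda>z. cnj (h z)) n = cnj (fcoeff h (- n))" if [measurable]: "h \<in> borel_measurable circ"
proof -
  have "fcoeff (\<lambda>z. cnj (h z)) n = (LINT z|circ. cnj (h z * cnj (z powi (- n))))"
    unfolding fcoeff_def ip_def
  proof (rule integral_cong_AE)
    show "AE z in circ. cnj (h z) * cnj (z powi n) = cnj (h z * cnj (z powi (- n)))"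
      using AE_circ_norm by eventually_elim (metis cnj_powi_circle complex_cnj_mult minus_minus)
  qed measurable
  then show ?thesis unfolding fcoeff_def ip_def by (simp only: Bochner_Integration.integral_cnj)
qed

lemma fcoeff_add:
  assumes "integrable circ h" "integrable circ k"
  shows "fcoeff (\<lambda>z. h z + k z) n = fcoeff h n + fcoeff k n"
  using assms integrable_powi_mult[of h "-n"] integrable_powi_mult[of k "-n"]
  by (simp add: fcoeff_eq distrib_left)

lemma fcoeff_cmult:
  "fcoeff (\<lambda>z. c * h z) n = c * fcoeff h n"
  by (simp add: fcoeff_def ip_def mult.assoc)

lemma fcoeff_diff:
  assumes "integrable circ h" "integrable circ k"
  shows "fcoeff (\<lambda>z. h z - k z) n = fcoeff h n - fcoeff k n"
  using assms integrable_powi_mult[of h "-n"] integrable_powi_mult[of k "-n"]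
  by (simp add: fcoeff_eq right_diff_distrib)

lemma fcoeff_powi: "fcoeff (\<lambda>z. z powi m) n = (if n = m then 1 else 0)"
proof -
  have "fcoeff (\<lambda>z. z powi m) n = fcoeff (\<lambda>z. z powi m * 1) n" by simp
  also have "\<dots> = fcoeff (\<lambda>z. 1) (n - m)" by (rule fcoeff_shift) simp
  also have "\<dots> = (LINT z|circ. z powi (m - n))" by (subst fcoeff_eq) auto
  finally show ?thesis by (simp add: integral_circ_powi)
qed

lemma fcoeff_const: "fcoeff (\<lambda>z. c) n = (if n = 0 then c else 0)"
  using fcoeff_cmult[of c "\<lambda>z. z powi 0" n] fcoeff_powi[of 0 n] by simp

lemma fcoeff_sum:
  "(\<And>i. i \<in> I \<Longrightarrow> integrable circ (h i)) \<Longrightarrow> fcoeff (\<lambda>z. \<Sum>i\<in>I. h i z) n = (\<Sum>i\<in>I. fcoeff (h i) n)"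
proof (induction I rule: infinite_finite_induct)
  case (insert i I)
  then show ?case by (simp add: fcoeff_add)
qed (simp_all add: fcoeff_const)

lemma norm_fcoeff_le:
  assumes "integrable circ h"
  shows "norm (fcoeff h n) \<le> (LINT z|circ. norm (h z))"
proof -
  have [measurable]: "h \<in> borel_measurable circ" using assms by measurable
  have "norm (fcoeff h n) \<le> (LINT z|circ. norm (z powi (- n) * h z))"
    unfolding fcoeff_eq[OF \<open>h \<in> borel_measurable circ\<close>] by (rule integral_norm_bound)
  also have "\<dots> = (LINT z|circ. norm (h z))"
  proof (rule integral_cong_AE)
    show "AE z in circ. norm (z powi (- n) * h z) = norm (h z)"
      using AE_circ_norm by eventually_elim (simp add: norm_mult norm_power_int)
  qed measurable
  finally show ?thesis .
qed

section \<open>Uniqueness of Fourier coefficients\<close>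

text \<open>On the circle a real-linear functional is a combination of \<open>z\<close> and
  \<open>z powi (-1)\<close>, so multiplying by it only shifts and combines coefficients.
  Integrability is carried along and \<open>h\<close> stays arbitrary because the product case
  applies one induction hypothesis to the function produced by the other.\<close>

lemma real_polynomial_mult_fcoeff_zero:
  assumes "real_polynomial_function p" "integrable circ h" "\<And>n. fcoeff h n = 0"
  shows "integrable circ (\<lambda>z. of_real (p z) * h z) \<and> (\<forall>n. fcoeff (\<lambda>z. of_real (p z) * h z) n = 0)"
  using assms
proof (induction arbitrary: h rule: real_polynomial_function.induct)
  case (linear f)
  note lin = linear
  interpret bounded_linear f by (rule lin)
  \<comment> \<open>From \<open>Re z = (z + cnj z) / 2\<close> and
    \<open>Im z = (z - cnj z) / (2 * \<i>)\<close>, so that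
    \<open>f z = c * z + d * cnj z\<close>.\<close>
  define c d where "c = Complex (f 1) (- f \<i>) / 2" and "d = Complex (f 1) (f \<i>) / 2"
  define k where "k = (\<lambda>z. c * (z powi 1 * h z) + d * (z powi (-1) * h z))"
  have [measurable]: "h \<in> borel_measurable circ" using lin(2) by simp
  have int: "integrable circ (\<lambda>z. c * (z powi 1 * h z))" "integrable circ (\<lambda>z. d * (z powi (-1) * h z))"
    using integrable_powi_mult[OF lin(2), of 1] integrable_powi_mult[OF lin(2), of "-1"] by simp_all
  have ik: "integrable circ k" using int unfolding k_def by simp
  have zk: "fcoeff k n = 0" for n
    unfolding k_def using int lin(3) by (simp add: fcoeff_add fcoeff_cmult fcoeff_shift del: power_int_1_right power_int_minus1_right)
  have eq: "AE z in circ. k z = of_real (f z) * h z"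
    using AE_circ_norm
  proof eventually_elim
    case (elim z)
    have "f z = f (Re z *\<^sub>R 1 + Im z *\<^sub>R \<i>)"
      by (rule arg_cong[where f=f]) (simp add: complex_eq_iff)
    also have "\<dots> = Re z * f 1 + Im z * f \<i>" by (simp only: add scaleR) simp
    finally have "complex_of_real (f z) = c * z + d * cnj z"
      by (simp add: c_def d_def complex_eq_iff algebra_simps diff_divide_distrib)
    moreover have "z powi (-1) = cnj z"
      using cnj_powi_circle[OF elim, of 1] by simp
    ultimately show ?case by (simp add: k_def algebra_simps)
  qed
  have "integrable circ (\<lambda>z. of_real (f z) * h z)"
    by (rule integrable_cong_AE_imp[OF ik _ ]) (use eq borel_measurable_circ_cong_AE[OF _ eq] ik in auto)
  moreover have "fcoeff (\<lambda>z. of_real (f z) * h z) n = 0" for n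
    using fcoeff_cong_AE[OF borel_measurable_integrable[OF ik] eq, of n] zk by simp
  ultimately show ?case by blast
next
  case (const c)
  then show ?case by (simp add: fcoeff_cmult)
next
  case (add f g)
  from add(3)[OF add(5,6)] add(4)[OF add(5,6)] show ?case
    by (simp add: distrib_right fcoeff_add)
next
  case (mult f g)
  have "integrable circ (\<lambda>z. of_real (f z) * (of_real (g z) * h z))
     \<and> (\<forall>n. fcoeff (\<lambda>z. of_real (f z) * (of_real (g z) * h z)) n = 0)"
    using mult(4)[OF mult(5,6)] by (intro mult(3)) auto
  then show ?case by (simp add: mult.assoc)
qed

text \<open>By Stone-Weierstrass on the circle, \<phi> is within \<open>e\<close> of a polynomial
  \<open>p\<close>. The integral of \<open>p * h\<close> is a zeroth Fourier coefficient, hence 0,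
  and the error is at most \<open>e\<close> times the L1 norm of \<open>h\<close>.\<close>

lemma continuous_mult_integral_zero:
  fixes \<phi> :: "complex \<Rightarrow> real"
  assumes h: "integrable circ h" "\<And>n. fcoeff h n = 0" and \<phi>: "continuous_on UNIV \<phi>"
  shows "integrable circ (\<lambda>z. of_real (\<phi> z) * h z)" and "(LINT z|circ. of_real (\<phi> z) * h z) = 0"
proof -
  have [measurable]: "\<phi> \<in> borel_measurable circ"
    by (rule borel_measurable_circ) (rule borel_measurable_continuous_onI[OF \<phi>])
  have "compact (\<phi> ` sphere 0 1)"
    using \<phi> by (intro compact_continuous_image continuous_on_subset[OF \<phi>]) auto
  then have "bounded (\<phi> ` sphere 0 1)" by (rule compact_imp_bounded)
  then obtain B where B: "\<And>z. z \<in> sphere 0 1 \<Longrightarrow> \<bar>\<phi> z\<bar> \<le> B"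
    unfolding bounded_iff by force
  show int: "integrable circ (\<lambda>z. of_real (\<phi> z) * h z)"
  proof (rule integrable_bounded_mult[OF h(1)])
    show "AE z in circ. norm (complex_of_real (\<phi> z)) \<le> B"
      using AE_circ_norm by eventually_elim (use B in auto)
  qed measurable
  have *: "norm (LINT z|circ. of_real (\<phi> z) * h z) \<le> e * (LINT z|circ. norm (h z))" if e: "e > 0" for e
  proof -
    have "continuous_on (sphere 0 1) \<phi>" using \<phi> by (rule continuous_on_subset) auto
    then obtain p where p: "real_polynomial_function p" "\<And>z. z \<in> sphere 0 1 \<Longrightarrow> \<bar>\<phi> z - p z\<bar> < e"
      using Stone_Weierstrass_real_polynomial_function[OF compact_sphere _ e] by blast
    note q = real_polynomial_mult_fcoeff_zero[OF p(1) h]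
    have "(LINT z|circ. of_real (p z) * h z) = fcoeff (\<lambda>z. of_real (p z) * h z) 0"
      by (simp add: fcoeff_def ip_def)
    then have "(LINT z|circ. of_real (\<phi> z) * h z) = (LINT z|circ. of_real (\<phi> z) * h z - of_real (p z) * h z)"
      using q int by simp
    also have "norm \<dots> \<le> (LINT z|circ. norm (of_real (\<phi> z) * h z - of_real (p z) * h z))"
      by (rule integral_norm_bound)
    also have "\<dots> \<le> (LINT z|circ. e * norm (h z))"
    proof (rule integral_mono_AE)
      show "AE z in circ. norm (of_real (\<phi> z) * h z - of_real (p z) * h z) \<le> e * norm (h z)"
        using AE_circ_norm
      proof eventually_elim
        case (elim z)
        have "norm (of_real (\<phi> z) * h z - of_real (p z) * h z) = \<bar>\<phi> z - p z\<bar> * norm (h z)"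
          by (simp only: left_diff_distrib[symmetric] norm_mult norm_of_real of_real_diff[symmetric])
        then show ?case using p(2)[of z] elim by (auto intro!: mult_right_mono)
      qed
    qed (use q int h in auto)
    finally show ?thesis using h by simp
  qed
  have "((\<lambda>e. e * (LINT z|circ. norm (h z))) \<longlongrightarrow> 0 * (LINT z|circ. norm (h z))) (at_right 0)"
    by (intro tendsto_intros)
  with * have "norm (LINT z|circ. of_real (\<phi> z) * h z) \<le> 0 * (LINT z|circ. norm (h z))"
    by (intro tendsto_lowerbound[where F = "at_right (0::real)"]) (auto simp: eventually_at_right_less intro: eventually_at_rightI[of 0 1])
  then show "(LINT z|circ. of_real (\<phi> z) * h z) = 0" by simp
qed

text \<open>The indicator of a nonempty closed set is the pointwise limit of the continuous
  functions \<open>max 0 (1 - k * infdist z C)\<close>, and \<open>norm (h z)\<close>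
  dominates.\<close>

lemma closed_integral_zero:
  assumes h: "integrable circ h" "\<And>n. fcoeff h n = 0" and C: "closed C"
  shows "(LINT z|circ. indicator C z *\<^sub>R h z) = 0"
\<comment> \<open>The distance to the empty set is 0 by convention, so the functions below would
  tend to 1 instead of 0.\<close>
proof (cases "C = {}")
  case False
  define \<phi> where "\<phi> = (\<lambda>k z. max 0 (1 - real k * infdist z C))"
  have [measurable]: "h \<in> borel_measurable circ" using h by simp
  have c: "continuous_on UNIV (\<phi> k)" for k
    unfolding \<phi>_def by (intro continuous_intros)
  have [measurable]: "C \<in> sets circ" using C by (intro sets_circ_borel borel_closed)
  have "(\<lambda>k. LINT z|circ. of_real (\<phi> k z) * h z) \<longlonglongrightarrow> (LINT z|circ. indicator C z *\<^sub>R h z)"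
  proof (rule integral_dominated_convergence[where w = "\<lambda>z. norm (h z)"])
    show "(\<lambda>z. complex_of_real (\<phi> k z) * h z) \<in> borel_measurable circ" for k
      using continuous_mult_integral_zero(1)[OF h c] by simp
    show "AE z in circ. norm (complex_of_real (\<phi> k z) * h z) \<le> norm (h z)" for k
      by (rule AE_I2) (auto simp: norm_mult \<phi>_def infdist_nonneg intro!: mult_left_le_one_le)
    have "(\<lambda>k. \<phi> k z) \<longlonglongrightarrow> indicator C z" for z
    proof (cases "z \<in> C")
      case True
      then show ?thesis by (simp add: \<phi>_def)
    next
      case z: False
      then have d: "infdist z C > 0"
        using C False infdist_pos_not_in_closed by blast
      obtain K :: nat where K: "1 / infdist z C < real K" using reals_Archimedean2 by blast
      have "\<phi> k z = 0" if "k \<ge> K" for k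
      proof -
        have "1 / infdist z C \<le> real k" using K that by linarith
        then show ?thesis using d by (simp add: \<phi>_def field_simps)
      qed
      then have "\<forall>\<^sub>F k in sequentially. \<phi> k z = 0" by (auto simp: eventually_sequentially)
      then show ?thesis using z by (simp add: tendsto_eventually)
    qed
    then have "(\<lambda>k. complex_of_real (\<phi> k z) * h z) \<longlonglongrightarrow> of_real (indicator C z) * h z" for z
      by (intro tendsto_intros)
    then show "AE z in circ. (\<lambda>k. complex_of_real (\<phi> k z) * h z) \<longlonglongrightarrow> indicator C z *\<^sub>R h z"
      by (simp add: scaleR_conv_of_real)
  qed (use h in auto)
  then show ?thesis
    using continuous_mult_integral_zero(2)[OF h c] by (simp add: LIMSEQ_const_iff)
qed simp

text \<open>Closed sets form an intersection-stable generator of the Borel sets, so the vanishing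
  integrals spread to all Borel sets by a Dynkin argument. A set of the completed algebra differs
  from its \<open>main_part\<close> by a null set, and a function with integral 0 over every
  measurable set vanishes a.e.\<close>

lemma fcoeff_zero_imp_AE_zero:
  assumes h: "integrable circ h" "\<And>n. fcoeff h n = 0"
  shows "AE z in circ. h z = 0"
proof -
  have [measurable]: "h \<in> borel_measurable circ" using h by simp
  have int: "integrable circ (\<lambda>z. indicator A z *\<^sub>R h z)" if "A \<in> sets circ" for A
    using integrable_mult_indicator[OF that h(1)] .
  have borel: "(LINT z|circ. indicator A z *\<^sub>R h z) = 0" if "A \<in> sigma_sets UNIV (Collect closed)" for A
  proof -
    have "Int_stable (Collect closed :: complex set set)" by (auto simp: Int_stable_def)
    moreover have "Collect closed \<subseteq> Pow (UNIV :: complex set)" by simp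
    ultimately show ?thesis using that
    proof (induction rule: sigma_sets_induct_disjoint)
      case (basic A)
      then show ?case using closed_integral_zero[OF h] by simp
    next
      case empty
      then show ?case by simp
    next
      case (compl A)
      then have A: "A \<in> sets circ"
        using borel_eq_closed by (intro sets_circ_borel) (simp add: borel_eq_closed)
      have "(LINT z|circ. indicator (UNIV - A) z *\<^sub>R h z) = (LINT z|circ. indicator UNIV z *\<^sub>R h z - indicator A z *\<^sub>R h z)"
        by (intro Bochner_Integration.integral_cong) (auto simp: indicator_def)
      also have "\<dots> = (LINT z|circ. indicator UNIV z *\<^sub>R h z) - (LINT z|circ. indicator A z *\<^sub>R h z)"
        using h(1) int[OF A] by (intro Bochner_Integration.integral_diff) auto
      finally show ?case using compl closed_integral_zero[OF h, of UNIV] by simp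
    next
      case (union A)
      then have A: "A i \<in> sets circ" for i
        using borel_eq_closed by (intro sets_circ_borel) (auto simp: borel_eq_closed)
      have "(LINT z:(\<Union>i. A i)|circ. h z) = (\<Sum>i. (LINT z:(A i)|circ. h z))"
        using A union int by (intro lebesgue_integral_countable_add)
          (auto simp: disjoint_family_on_def set_integrable_def)
      then show ?case using union by (simp add: set_lebesgue_integral_def)
    qed
  qed
  show ?thesis
  proof (rule circ.density_zero[OF h(1)])
    fix A assume A: "A \<in> sets circ"
    define B where "B = distr (uniform_measure lborel {0..2*pi}) borel cis"
    from A have A': "A \<in> sets (completion B)" by (simp add: circ_def B_def)
    then have "main_part B A \<in> sets B" by (rule main_part_sets)
    then have M: "main_part B A \<in> sigma_sets UNIV (Collect closed)"
      by (simp add: B_def) (subst (asm) borel_eq_closed, simp)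
    have "AE z in circ. z \<in> main_part B A \<longleftrightarrow> z \<in> A"
      unfolding circ_def B_def[symmetric] by (intro AE_completion AE_in_main_part A')
    then have "(LINT z|circ. indicator A z *\<^sub>R h z) = (LINT z|circ. indicator (main_part B A) z *\<^sub>R h z)"
    proof (intro integral_cong_AE)
      have [measurable]: "main_part B A \<in> sets circ"
        using \<open>main_part B A \<in> sets B\<close> by (intro sets_circ_borel) (simp add: B_def)
      show "(\<lambda>z. indicator (main_part B A) z *\<^sub>R h z) \<in> borel_measurable circ" by measurable
    qed (use A in \<open>auto simp: indicator_def elim: eventually_mono\<close>)
    then show "(LINT z:A|circ. h z) = 0"
      using borel[OF M] by (simp add: set_lebesgue_integral_def)
  qed
qed

section \<open>The Riesz-Fischer theorem\<close>

definition psum :: "(nat \<Rightarrow> complex) \<Rightarrow> nat \<Rightarrow> complex \<Rightarrow> complex" where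
  "psum c N z = (\<Sum>n<N. c n * z powi int n)"

lemma L2_powi: "(\<lambda>z. c * z powi n) \<in> L2"
  using L2_cmult[OF L2_powi_mult[OF L2_const[of 1]]] by simp

lemma psum_L2: "psum c N \<in> L2"
  unfolding psum_def by (intro L2_sum L2_powi)

lemma fcoeff_psum: "fcoeff (psum c N) n = (if 0 \<le> n \<and> n < int N then c (nat n) else 0)"
proof -
  have "fcoeff (psum c N) n = (\<Sum>m<N. c m * (if n = int m then 1 else 0))"
    unfolding psum_def
    by (subst fcoeff_sum) (auto intro!: L2_integrable L2_powi simp: fcoeff_cmult fcoeff_powi simp del: power_int_of_nat)
  also have "\<dots> = (if 0 \<le> n \<and> n < int N then c (nat n) else 0)"
  proof (cases "0 \<le> n \<and> n < int N")
    case True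
    then have "(\<Sum>m<N. c m * (if n = int m then 1 else 0)) = (\<Sum>m<N. if m = nat n then c m else 0)"
      by (intro sum.cong) auto
    also have "\<dots> = c (nat n)" using True by (subst sum.delta) auto
    finally show ?thesis using True by simp
  next
    case False
    then show ?thesis by (auto intro!: sum.neutral)
  qed
  finally show ?thesis .
qed

lemma norm_sq_sub_powi:
  assumes u: "u \<in> L2"
  shows "(LINT z|circ. (norm (u z - c * z powi n))\<^sup>2)
    = (LINT z|circ. (norm (u z))\<^sup>2) - 2 * Re (cnj c * fcoeff u n) + (norm c)\<^sup>2"
proof -
  have [measurable]: "u \<in> borel_measurable circ" using u by (rule L2_measurable)
  have i: "integrable circ (\<lambda>z. cnj c * (u z * cnj (z powi n)))"
    using L2_mult_integrable[OF u L2_cnj[OF L2_powi[of 1 n]]] by simp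
  have "(LINT z|circ. (norm (u z - c * z powi n))\<^sup>2)
    = (LINT z|circ. (norm (u z))\<^sup>2 - 2 * Re (cnj c * (u z * cnj (z powi n))) + (norm c)\<^sup>2)"
  proof (rule integral_cong_AE)
    show "AE z in circ. (norm (u z - c * z powi n))\<^sup>2
        = (norm (u z))\<^sup>2 - 2 * Re (cnj c * (u z * cnj (z powi n))) + (norm c)\<^sup>2"
      using AE_circ_norm
    proof eventually_elim
      case (elim z)
      have *: "(norm (a - b))\<^sup>2 = (norm a)\<^sup>2 - 2 * Re (a * cnj b) + (norm b)\<^sup>2" for a b :: complex
        by (simp only: cmod_power2) (simp add: power2_eq_square algebra_simps)
      show ?case using elim by (simp add: * norm_mult norm_power_int ac_simps)
    qed
  qed measurable
  also have "\<dots> = (LINT z|circ. (norm (u z))\<^sup>2) - 2 * (LINT z|circ. Re (cnj c * (u z * cnj (z powi n)))) + (norm c)\<^sup>2"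
    using L2_integrable_sq[OF u] integrable_Re[OF i] by (simp del: Re_complex_of_real times_complex.sel)
  also have "(LINT z|circ. Re (cnj c * (u z * cnj (z powi n)))) = Re (cnj c * fcoeff u n)"
    using i by (subst integral_Re) (auto simp: fcoeff_def ip_def)
  finally show ?thesis .
qed

text \<open>Bessel's identity. Subtracting the first \<open>N\<close> terms leaves coefficient
  \<open>N\<close> untouched, so removing the next monomial lowers the squared norm by exactly the
  squared modulus of that coefficient.\<close>

lemma norm_sq_sub_psum:
  assumes u: "u \<in> L2"
  shows "(LINT z|circ. (norm (u z - psum (\<lambda>n. fcoeff u (int n)) N z))\<^sup>2)
    = (LINT z|circ. (norm (u z))\<^sup>2) - (\<Sum>n<N. (norm (fcoeff u (int n)))\<^sup>2)"
proof (induction N)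
  case 0
  then show ?case by (simp add: psum_def)
next
  case (Suc N)
  let ?c = "\<lambda>n. fcoeff u (int n)"
  let ?v = "\<lambda>z. u z - psum ?c N z"
  have v: "?v \<in> L2" by (intro L2_diff u psum_L2)
  have fv: "fcoeff ?v (int N) = ?c N"
    by (subst fcoeff_diff) (auto intro: L2_integrable u psum_L2 simp: fcoeff_psum)
  have eq: "u z - psum ?c (Suc N) z = ?v z - ?c N * z powi int N" for z
    by (simp add: psum_def)
  have re: "Re (cnj a * a) = (norm a)\<^sup>2" for a
    unfolding cmod_power2 by (simp add: power2_eq_square)
  have "(LINT z|circ. (norm (u z - psum ?c (Suc N) z))\<^sup>2) = (LINT z|circ. (norm (?v z))\<^sup>2) - (norm (?c N))\<^sup>2"
    unfolding eq norm_sq_sub_powi[OF v, of "?c N" "int N"] fv re by simp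
  then show ?case using Suc by simp
qed

text \<open>Parseval for polynomials is Bessel's identity with remainder zero.\<close>

lemma norm_sq_psum_diff:
  assumes "M \<le> N"
  shows "(LINT z|circ. (norm (psum c N z - psum c M z))\<^sup>2) = (\<Sum>n\<in>{M..<N}. (norm (c n))\<^sup>2)"
proof -
  have P: "(LINT z|circ. (norm (psum d N z))\<^sup>2) = (\<Sum>n<N. (norm (d n))\<^sup>2)" for d N
  proof -
    have "psum (\<lambda>n. fcoeff (psum d N) (int n)) N = psum d N"
    proof
      show "psum (\<lambda>n. fcoeff (psum d N) (int n)) N z = psum d N z" for z
        by (subst (1 2) psum_def) (simp add: fcoeff_psum)
    qed
    moreover have "(\<Sum>n<N. (norm (fcoeff (psum d N) (int n)))\<^sup>2) = (\<Sum>n<N. (norm (d n))\<^sup>2)"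
      by (intro sum.cong) (auto simp: fcoeff_psum)
    ultimately show ?thesis using norm_sq_sub_psum[OF psum_L2, of d N N] by simp
  qed
  \<comment> \<open>Truncating the sequence below \<open>M\<close> turns the difference into a
    single partial sum.\<close>
  define d where "d = (\<lambda>n. if n < M then 0 else c n)"
  have "psum c N z - psum c M z = psum d N z" for z
  proof -
    have "psum c N z = (\<Sum>n<M. c n * z powi int n) + (\<Sum>n\<in>{M..<N}. c n * z powi int n)"
      unfolding psum_def using assms by (subst sum.union_disjoint[symmetric]) (auto intro!: sum.cong)
    moreover have "psum d N z = (\<Sum>n<M. d n * z powi int n) + (\<Sum>n\<in>{M..<N}. d n * z powi int n)"
      unfolding psum_def using assms by (subst sum.union_disjoint[symmetric]) (auto intro!: sum.cong)
    ultimately show ?thesis by (simp add: psum_def d_def)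
  qed
  then have "(LINT z|circ. (norm (psum c N z - psum c M z))\<^sup>2) = (\<Sum>n<N. (norm (d n))\<^sup>2)"
    by (simp add: P)
  also have "\<dots> = (\<Sum>n<M. (norm (d n))\<^sup>2) + (\<Sum>n\<in>{M..<N}. (norm (d n))\<^sup>2)"
    using assms by (subst sum.union_disjoint[symmetric]) (auto intro!: sum.cong)
  also have "\<dots> = (\<Sum>n\<in>{M..<N}. (norm (c n))\<^sup>2)" by (simp add: d_def)
  finally show ?thesis .
qed

text \<open>Cauchy-Schwarz against the constant 1; \<open>circ\<close> has total mass 1.\<close>

lemma integral_norm_le_sqrt:
  assumes "h \<in> L2" "(LINT z|circ. (norm (h z))\<^sup>2) \<le> B\<^sup>2" "0 \<le> B"
  shows "(LINT z|circ. norm (h z)) \<le> B"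
  using integral_mult_sq_le[OF assms(1) L2_const[of 1]] assms(2,3)
  by simp (meson order_trans power2_le_imp_le)

text \<open>Along a sparse subsequence the increments of the partial sums have L1 norm at most
  \<open>(1/2)^k\<close>, which gives convergence a.e.; Fatou's lemma then gives the rate in L2. The
  rate belongs to the conclusion because \<open>H2_mult_H1\<close> rests on this polynomial
  approximation.\<close>

lemma riesz_fischer:
  assumes "summable (\<lambda>n. (norm (c n))\<^sup>2)"
  obtains F M where "F \<in> L2" "\<And>n. fcoeff F n = (if n \<ge> 0 then c (nat n) else 0)"
    "\<And>k. (LINT z|circ. (norm (F z - psum c (M k) z))\<^sup>2) \<le> ((1/2)^k)\<^sup>2"
proof -
  have "\<exists>N. \<forall>m\<ge>N. \<forall>n. norm (\<Sum>i\<in>{m..<n}. (norm (c i))\<^sup>2) < ((1/2)^k)\<^sup>2" for k :: nat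
    using assms unfolding summable_Cauchy by (meson zero_less_power half_gt_zero zero_less_one)
  then obtain N where N: "\<And>k m n. m \<ge> N k \<Longrightarrow> norm (\<Sum>i\<in>{m..<n}. (norm (c i))\<^sup>2) < ((1/2)^k)\<^sup>2"
    by metis
  \<comment> \<open>Summing the \<open>N j\<close> makes \<open>M\<close> monotone and at least
    \<open>N\<close>. The added ones give \<open>M k > k\<close>, so every fixed coefficient is
    eventually included.\<close>
  define M where "M = (\<lambda>k. \<Sum>j\<le>k. N j + 1)"
  have M_mono: "M j \<le> M k" if "j \<le> k" for j k
    unfolding M_def using that by (intro sum_mono2) auto
  have MN: "M k \<ge> N k" for k
    unfolding M_def using member_le_sum[of k "{..k}" "\<lambda>j. N j + 1"] by simp
  have Mk: "M k > k" for k
    unfolding M_def by (induction k) auto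
  define T where "T = (\<lambda>k. psum c (M k))"
  have TL2: "T k \<in> L2" for k unfolding T_def by (rule psum_L2)
  have [measurable]: "T k \<in> borel_measurable circ" for k using TL2 by (rule L2_measurable)
  have T: "(LINT z|circ. (norm (T j z - T k z))\<^sup>2) \<le> ((1/2)^k)\<^sup>2" if "k \<le> j" for j k
    using norm_sq_psum_diff[OF M_mono[OF that], of c] N[OF MN, of k "M j"] unfolding T_def by simp
  define D where "D = (\<lambda>k z. T (Suc k) z - T k z)"
  have D: "(LINT z|circ. norm (D k z)) \<le> (1/2)^k" for k
    unfolding D_def by (rule integral_norm_le_sqrt) (use T[of k "Suc k"] in \<open>auto intro: L2_diff TL2\<close>)
  have iD: "integrable circ (\<lambda>z. norm (D k z))" for k
    unfolding D_def by (intro integrable_norm L2_integrable L2_diff TL2)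
  have [measurable]: "D k \<in> borel_measurable circ" for k unfolding D_def by measurable
  have AE_conv: "AE z in circ. convergent (\<lambda>k. T k z)"
  proof -
    have "(\<integral>\<^sup>+z. (\<Sum>k. ennreal (norm (D k z))) \<partial>circ) = (\<Sum>k. \<integral>\<^sup>+z. ennreal (norm (D k z)) \<partial>circ)"
      by (rule nn_integral_suminf) measurable
    also have "\<dots> \<le> (\<Sum>k. ennreal ((1/2)^k))"
      by (intro suminf_le) (auto simp: nn_integral_eq_integral[OF iD] D intro!: ennreal_leI)
    also have "\<dots> < \<infinity>"
      by (subst suminf_ennreal2) (auto intro!: summable_geometric)
    finally have "AE z in circ. (\<Sum>k. ennreal (norm (D k z))) \<noteq> \<infinity>"
      by (intro nn_integral_PInf_AE) auto
    then show ?thesis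
    proof eventually_elim
      case (elim z)
      then have "summable (\<lambda>k. norm (D k z))"
        by (intro summable_suminf_not_top) auto
      then have "summable (\<lambda>k. D k z)" by (rule summable_norm_cancel)
      then have "convergent (\<lambda>n. \<Sum>k<n. D k z)" by (simp add: summable_iff_convergent)
      moreover have "(\<Sum>k<n. D k z) = T n z - T 0 z" for n
        unfolding D_def by (rule sum_lessThan_telescope)
      ultimately have "convergent (\<lambda>n. (T n z - T 0 z) + T 0 z)"
        by (intro convergent_add convergent_const) simp
      then show ?case by simp
    qed
  qed
  define F where "F = (\<lambda>z. lim (\<lambda>k. T k z))"
  have lim: "AE z in circ. (\<lambda>k. T k z) \<longlonglongrightarrow> F z"
    using AE_conv by eventually_elim (simp add: F_def convergent_LIMSEQ_iff)
  have [measurable]: "F \<in> borel_measurable circ" unfolding F_def by measurable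
  \<comment> \<open>Fatou in \<open>j\<close>: the bound on \<open>T j - T k\<close> is uniform in
    \<open>j \<ge> k\<close> and survives the limit.\<close>
  have est: "(\<integral>\<^sup>+z. ennreal ((norm (F z - T k z))\<^sup>2) \<partial>circ) \<le> ennreal (((1/2)^k)\<^sup>2)" for k
  proof -
    have "(\<integral>\<^sup>+z. ennreal ((norm (F z - T k z))\<^sup>2) \<partial>circ)
      = (\<integral>\<^sup>+z. liminf (\<lambda>j. ennreal ((norm (T j z - T k z))\<^sup>2)) \<partial>circ)"
    proof (rule nn_integral_cong_AE)
      show "AE z in circ. ennreal ((norm (F z - T k z))\<^sup>2) = liminf (\<lambda>j. ennreal ((norm (T j z - T k z))\<^sup>2))"
        using lim
      proof eventually_elim
        case (elim z)
        then have "(\<lambda>j. ennreal ((norm (T j z - T k z))\<^sup>2)) \<longlonglongrightarrow> ennreal ((norm (F z - T k z))\<^sup>2)"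
          by (intro tendsto_intros)
        then show ?case by (intro lim_imp_Liminf[symmetric]) auto
      qed
    qed
    also have "\<dots> \<le> liminf (\<lambda>j. \<integral>\<^sup>+z. ennreal ((norm (T j z - T k z))\<^sup>2) \<partial>circ)"
      by (rule nn_integral_liminf) measurable
    also have "\<dots> \<le> liminf (\<lambda>j. ennreal (((1/2)^k)\<^sup>2))"
    proof (rule Liminf_mono)
      show "\<forall>\<^sub>F j in sequentially. (\<integral>\<^sup>+z. ennreal ((norm (T j z - T k z))\<^sup>2) \<partial>circ) \<le> ennreal (((1/2)^k)\<^sup>2)"
        using eventually_ge_at_top[of k]
      proof eventually_elim
        case (elim j)
        then show ?case
          using T[OF elim] L2_integrable_sq[OF L2_diff[OF TL2 TL2]]
          by (subst nn_integral_eq_integral) (auto intro: ennreal_leI)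
      qed
    qed
    finally show ?thesis by (simp add: Liminf_const)
  qed
  have FT: "(\<lambda>z. F z - T k z) \<in> L2" for k
    unfolding L2_def using order_le_less_trans[OF est ennreal_less_top]
    by (auto intro!: integrableI_bounded)
  have F: "F \<in> L2" using L2_add[OF FT TL2, of 0 0] by simp
  have sq: "(LINT z|circ. (norm (F z - T k z))\<^sup>2) \<le> ((1/2)^k)\<^sup>2" for k
    using est[of k] L2_integrable_sq[OF FT] by (subst (asm) nn_integral_eq_integral) auto
  have "fcoeff F n = (if n \<ge> 0 then c (nat n) else 0)" for n
  proof -
    have "(\<lambda>k. fcoeff F n - fcoeff (T k) n) \<longlonglongrightarrow> 0"
    proof (rule Lim_null_comparison)
      show "\<forall>\<^sub>F k in sequentially. norm (fcoeff F n - fcoeff (T k) n) \<le> (1/2)^k"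
        using integral_norm_le_sqrt[OF FT sq] norm_fcoeff_le[where n = n, OF L2_integrable[OF FT]]
        by (auto simp: fcoeff_diff[OF L2_integrable[OF F] L2_integrable[OF TL2]] intro!: always_eventually intro: order_trans)
      show "(\<lambda>k. (1/2::real)^k) \<longlonglongrightarrow> 0" by (rule LIMSEQ_realpow_zero) auto
    qed
    moreover have "\<forall>\<^sub>F k in sequentially. fcoeff F n - fcoeff (T k) n = fcoeff F n - (if n \<ge> 0 then c (nat n) else 0)"
      using eventually_ge_at_top[of "nat n"]
    proof eventually_elim
      case (elim k)
      then have "n < int (M k)" using Mk[of k] by linarith
      then show ?case by (simp add: T_def fcoeff_psum)
    qed
    ultimately have "(\<lambda>k. fcoeff F n - (if n \<ge> 0 then c (nat n) else 0)) \<longlonglongrightarrow> 0"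
      by (rule Lim_transform_eventually)
    then show ?thesis by (simp add: LIMSEQ_const_iff)
  qed
  with F sq show ?thesis using that unfolding T_def by blast
qed

section \<open>Hardy spaces\<close>

text \<open>Products of two functions in \<open>H2\<close> land here. By \<open>H2_iff\<close>,
  square integrability is all that separates this space from \<open>H2\<close>.\<close>

definition H1 :: "(complex \<Rightarrow> complex) set" where
  "H1 = {h. integrable circ h \<and> (\<forall>n<0. fcoeff h n = 0)}"

lemma H2_iff: "h \<in> H2 \<longleftrightarrow> h \<in> L2 \<and> h \<in> H1"
  by (auto simp: H2_def H1_def L2_integrable)

lemma H2_imp_L2: "h \<in> H2 \<Longrightarrow> h \<in> L2" by (simp add: H2_iff)

lemma H2_fcoeff: "h \<in> H2 \<Longrightarrow> n < 0 \<Longrightarrow> fcoeff h n = 0"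
  by (simp add: H2_def)

lemma H2_measurable [measurable_dest]: "h \<in> H2 \<Longrightarrow> h \<in> borel_measurable circ"
  by (rule L2_measurable) (rule H2_imp_L2)

lemma H2_integrable: "h \<in> H2 \<Longrightarrow> integrable circ h"
  by (rule L2_integrable) (rule H2_imp_L2)

lemma H1_cong_AE:
  assumes "h \<in> H1" "AE z in circ. h z = k z"
  shows "k \<in> H1"
proof -
  have [measurable]: "h \<in> borel_measurable circ" and i: "integrable circ h" using assms(1) by (auto simp: H1_def)
  have "k \<in> borel_measurable circ" by (rule borel_measurable_circ_cong_AE[OF _ assms(2)]) measurable
  then have "integrable circ k" by (rule integrable_cong_AE_imp[OF i]) (use assms(2) in eventually_elim, simp)
  moreover have "fcoeff h n = fcoeff k n" for n by (rule fcoeff_cong_AE[OF _ assms(2)]) measurable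
  ultimately show ?thesis using assms(1) by (simp add: H1_def)
qed

lemma H2_cong_AE: "h \<in> H2 \<Longrightarrow> AE z in circ. h z = k z \<Longrightarrow> k \<in> H2"
  using L2_cong_AE H1_cong_AE by (auto simp: H2_iff)

lemma H1_add: "h \<in> H1 \<Longrightarrow> k \<in> H1 \<Longrightarrow> (\<lambda>z. h z + k z) \<in> H1"
  by (auto simp: H1_def fcoeff_add)

lemma H1_cmult: "h \<in> H1 \<Longrightarrow> (\<lambda>z. c * h z) \<in> H1"
  by (auto simp: H1_def fcoeff_cmult)

lemma H1_diff: "h \<in> H1 \<Longrightarrow> k \<in> H1 \<Longrightarrow> (\<lambda>z. h z - k z) \<in> H1"
  by (auto simp: H1_def fcoeff_diff)

lemma H2_add: "h \<in> H2 \<Longrightarrow> k \<in> H2 \<Longrightarrow> (\<lambda>z. h z + k z) \<in> H2"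
  by (simp add: H2_iff L2_add H1_add)

lemma H2_cmult: "h \<in> H2 \<Longrightarrow> (\<lambda>z. c * h z) \<in> H2"
  by (simp add: H2_iff L2_cmult H1_cmult)

lemma H2_diff: "h \<in> H2 \<Longrightarrow> k \<in> H2 \<Longrightarrow> (\<lambda>z. h z - k z) \<in> H2"
  by (simp add: H2_iff L2_diff H1_diff)

lemma H2_powi: "n \<ge> 0 \<Longrightarrow> (\<lambda>z. z powi n) \<in> H2"
  using L2_powi[of 1 n] by (auto simp: H2_def fcoeff_powi)

lemma H2_const: "(\<lambda>z. c) \<in> H2"
  by (simp add: H2_def L2_const fcoeff_const)

lemma H2_powi_mult: "h \<in> H2 \<Longrightarrow> n \<ge> 0 \<Longrightarrow> (\<lambda>z. z powi n * h z) \<in> H2"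
  by (simp add: H2_def L2_powi_mult fcoeff_shift[OF L2_measurable])

lemma H2_z_mult: "h \<in> H2 \<Longrightarrow> (\<lambda>z. z * h z) \<in> H2"
  using H2_powi_mult[of h 1] by simp

lemma summable_fcoeff_sq:
  assumes "h \<in> L2"
  shows "summable (\<lambda>n. (norm (fcoeff h (int n)))\<^sup>2)"
proof (rule bounded_imp_summable)
  fix n
  have "0 \<le> (LINT z|circ. (norm (h z - psum (\<lambda>n. fcoeff h (int n)) (Suc n) z))\<^sup>2)" by simp
  then show "(\<Sum>k\<le>n. (norm (fcoeff h (int k)))\<^sup>2) \<le> (LINT z|circ. (norm (h z))\<^sup>2)"
    unfolding norm_sq_sub_psum[OF assms] lessThan_Suc_atMost by simp
qed simp

text \<open>The function built by \<open>riesz_fischer\<close> from the coefficients of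
  \<open>h\<close> has the same coefficients as \<open>h\<close>, negative ones included, and
  therefore equals \<open>h\<close> a.e.\<close>

lemma H2_approx:
  assumes h: "h \<in> H2"
  obtains M where "\<And>k. (LINT z|circ. (norm (h z - psum (\<lambda>n. fcoeff h (int n)) (M k) z))\<^sup>2) \<le> ((1/2)^k)\<^sup>2"
proof -
  obtain F M where F: "F \<in> L2" "\<And>n. fcoeff F n = (if n \<ge> 0 then fcoeff h (int (nat n)) else 0)"
    "\<And>k. (LINT z|circ. (norm (F z - psum (\<lambda>n. fcoeff h (int n)) (M k) z))\<^sup>2) \<le> ((1/2)^k)\<^sup>2"
    by (rule riesz_fischer[OF summable_fcoeff_sq[OF H2_imp_L2[OF h]]]) (rule that)
  have "AE z in circ. h z - F z = 0"
  proof (rule fcoeff_zero_imp_AE_zero)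
    show "integrable circ (\<lambda>z. h z - F z)"
      using H2_integrable[OF h] L2_integrable[OF F(1)] by simp
    show "fcoeff (\<lambda>z. h z - F z) n = 0" for n
      using H2_fcoeff[OF h, of n] F(2)[of n]
      by (simp add: fcoeff_diff[OF H2_integrable[OF h] L2_integrable[OF F(1)]])
  qed
  then have ae: "AE z in circ. F z = h z" by eventually_elim simp
  have [measurable]: "F \<in> borel_measurable circ" "h \<in> borel_measurable circ"
    using F(1) h by (auto intro: L2_measurable H2_measurable)
  have [measurable]: "psum c N \<in> borel_measurable circ" for c N by (rule L2_measurable) (rule psum_L2)
  have "(LINT z|circ. (norm (h z - psum (\<lambda>n. fcoeff h (int n)) (M k) z))\<^sup>2)
     = (LINT z|circ. (norm (F z - psum (\<lambda>n. fcoeff h (int n)) (M k) z))\<^sup>2)" for k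
  proof (rule integral_cong_AE)
    show "AE z in circ. (norm (h z - psum (\<lambda>n. fcoeff h (int n)) (M k) z))\<^sup>2
        = (norm (F z - psum (\<lambda>n. fcoeff h (int n)) (M k) z))\<^sup>2"
      using ae by eventually_elim simp
  qed measurable
  then show ?thesis using that[of M] F(3) by simp
qed

text \<open>For a polynomial in place of \<open>h\<close>, the product is a sum of shifts of
  \<open>k\<close> to the right. Cauchy-Schwarz makes each coefficient of the product continuous in
  \<open>h\<close> for the L2 norm, so polynomial approximation finishes the argument.\<close>

lemma H2_mult_H1:
  assumes h: "h \<in> H2" and k: "k \<in> H2"
  shows "(\<lambda>z. h z * k z) \<in> H1"
proof -
  obtain M where M: "\<And>j. (LINT z|circ. (norm (h z - psum (\<lambda>n. fcoeff h (int n)) (M j) z))\<^sup>2) \<le> ((1/2)^j)\<^sup>2"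
    using H2_approx[OF h] by blast
  define T where "T = (\<lambda>j. psum (\<lambda>n. fcoeff h (int n)) (M j))"
  note L = H2_imp_L2[OF h] H2_imp_L2[OF k]
  have hT: "(\<lambda>z. h z - T j z) \<in> L2" for j unfolding T_def by (intro L2_diff L psum_L2)
  have "fcoeff (\<lambda>z. h z * k z) n = 0" if n: "n < 0" for n
  proof -
    have "(norm (fcoeff (\<lambda>z. h z * k z) n))\<^sup>2 \<le> ((1/2)^j)\<^sup>2 * (LINT z|circ. (norm (k z))\<^sup>2)" for j
    proof -
      have "fcoeff (\<lambda>z. T j z * k z) n = (\<Sum>m<M j. fcoeff (\<lambda>z. fcoeff h (int m) * (z powi int m * k z)) n)"
        unfolding T_def psum_def sum_distrib_right mult.assoc
        by (rule fcoeff_sum) (intro L2_integrable L2_cmult L2_powi_mult L)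
      also have "\<dots> = 0"
        using n by (intro sum.neutral)
          (auto simp: fcoeff_cmult fcoeff_shift[OF L2_measurable[OF L(2)]] H2_fcoeff[OF k] simp del: power_int_of_nat)
      finally have "fcoeff (\<lambda>z. T j z * k z) n = 0" .
      moreover have "fcoeff (\<lambda>z. h z * k z) n = fcoeff (\<lambda>z. T j z * k z + (h z - T j z) * k z) n"
        by (simp add: algebra_simps)
      moreover have "\<dots> = fcoeff (\<lambda>z. T j z * k z) n + fcoeff (\<lambda>z. (h z - T j z) * k z) n"
        using hT L psum_L2 by (intro fcoeff_add L2_mult_integrable) (auto simp: T_def)
      ultimately have "norm (fcoeff (\<lambda>z. h z * k z) n) \<le> (LINT z|circ. norm ((h z - T j z) * k z))"
        using norm_fcoeff_le[OF L2_mult_integrable[OF hT L(2)]] by simp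
      then have "(norm (fcoeff (\<lambda>z. h z * k z) n))\<^sup>2 \<le> (LINT z|circ. norm ((h z - T j z) * k z))\<^sup>2"
        by (intro power_mono) auto
      also have "\<dots> \<le> (LINT z|circ. (norm (h z - T j z))\<^sup>2) * (LINT z|circ. (norm (k z))\<^sup>2)"
        by (rule integral_mult_sq_le[OF hT L(2)])
      also have "\<dots> \<le> ((1/2)^j)\<^sup>2 * (LINT z|circ. (norm (k z))\<^sup>2)"
        using M[of j] by (intro mult_right_mono) (auto simp: T_def)
      finally show ?thesis .
    qed
    moreover have "(\<lambda>j. ((1/2)^j)\<^sup>2 * (LINT z|circ. (norm (k z))\<^sup>2)) \<longlonglongrightarrow> 0\<^sup>2 * (LINT z|circ. (norm (k z))\<^sup>2)"
      by (intro tendsto_intros LIMSEQ_realpow_zero) auto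
    ultimately have "(norm (fcoeff (\<lambda>z. h z * k z) n))\<^sup>2 \<le> 0\<^sup>2 * (LINT z|circ. (norm (k z))\<^sup>2)"
      by (intro LIMSEQ_le_const) auto
    then show ?thesis by simp
  qed
  then show ?thesis using L2_mult_integrable[OF L] by (simp add: H1_def)
qed

lemma H2_bounded_mult:
  assumes "k \<in> H2" "AE z in circ. norm (k z) \<le> B" "h \<in> H2"
  shows "(\<lambda>z. k z * h z) \<in> H2"
  unfolding H2_iff
  using L2_bounded_mult[OF H2_imp_L2[OF assms(3)] H2_measurable[OF assms(1)] assms(2)] H2_mult_H1[OF assms(1,3)] by simp

text \<open>The orthogonal splitting of \<open>L2\<close> into nonnegative and negative frequencies.
  Both summands are expressed through functions in \<open>H2\<close>, the form in which
  \<open>oproj_model_space\<close> consumes them.\<close>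

lemma L2_split:
  assumes h: "h \<in> L2"
  obtains p q where "p \<in> H2" "q \<in> H2" "AE z in circ. h z = p z + cnj (z * q z)"
proof -
  obtain p M where p: "p \<in> L2" "\<And>n. fcoeff p n = (if n \<ge> 0 then fcoeff h (int (nat n)) else 0)"
    "\<And>k. (LINT z|circ. (norm (p z - psum (\<lambda>n. fcoeff h (int n)) (M k) z))\<^sup>2) \<le> ((1/2)^k)\<^sup>2"
    by (rule riesz_fischer[OF summable_fcoeff_sq[OF h]]) (rule that)
  define r where "r = (\<lambda>z. h z - p z)"
  \<comment> \<open>Conjugation makes the negative frequencies of \<open>r\<close> positive, and the
    factor \<open>z powi (-1)\<close>, which is \<open>cnj z\<close> on the circle, lets them start
    at 0.\<close>
  define q where "q = (\<lambda>z. z powi (-1) * cnj (r z))"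
  have r: "r \<in> L2" unfolding r_def by (intro L2_diff h p)
  have "p \<in> H2" using p by (simp add: H2_def)
  moreover have "q \<in> H2"
  proof -
    have [measurable]: "r \<in> borel_measurable circ" using r by (rule L2_measurable)
    have "fcoeff q n = 0" if "n < 0" for n
    proof -
      have "fcoeff q n = fcoeff (\<lambda>z. cnj (r z)) (n - (-1))"
        unfolding q_def by (rule fcoeff_shift) measurable
      also have "\<dots> = cnj (fcoeff r (- (n - (-1))))"
        by (rule fcoeff_cnj) measurable
      also have "fcoeff r (- (n - (-1))) = 0"
        unfolding r_def using that
        by (simp add: fcoeff_diff[OF L2_integrable[OF h] L2_integrable[OF p(1)]] p(2))
      finally show ?thesis by simp
    qed
    then show ?thesis
      using L2_powi_mult[OF L2_cnj[OF r], of "-1"] by (simp add: H2_def q_def)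
  qed
  moreover have "AE z in circ. h z = p z + cnj (z * q z)"
    using AE_circ_norm
  proof eventually_elim
    case (elim z)
    then have "z \<noteq> 0" by auto
    then show ?case by (simp add: q_def r_def field_simps)
  qed
  ultimately show ?thesis using that by blast
qed

lemma H2_AE_eq_const:
  assumes "h \<in> H2" "(\<lambda>z. cnj (h z)) \<in> H2"
  shows "AE z in circ. h z = fcoeff h 0"
proof -
  have "AE z in circ. h z - fcoeff h 0 = 0"
  proof (rule fcoeff_zero_imp_AE_zero)
    show "integrable circ (\<lambda>z. h z - fcoeff h 0)" by (intro H2_integrable H2_diff assms H2_const)
    show "fcoeff (\<lambda>z. h z - fcoeff h 0) n = 0" for n
      using H2_fcoeff[OF assms(1), of n] H2_fcoeff[OF assms(2), of "-n"] fcoeff_cnj[OF H2_measurable[OF assms(1)], of "-n"]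
      by (cases n "0::int" rule: linorder_cases)
         (auto simp: fcoeff_diff[OF H2_integrable[OF assms(1)] H2_integrable[OF H2_const]] fcoeff_const)
  qed
  then show ?thesis by eventually_elim simp
qed

section \<open>Cauchy kernels, difference quotients and values in the disk\<close>

lemma norm_circle_diff_ge:
  fixes z w :: complex
  assumes "norm z = 1"
  shows "1 - norm w \<le> norm (z - w)" "1 - norm w \<le> norm (1 - cnj w * z)"
  using norm_triangle_ineq2[of z w] norm_triangle_ineq2[of 1 "cnj w * z"] assms
  by (auto simp: norm_mult)

lemma AE_norm_inverse_le:
  assumes "norm w < 1"
  shows "AE z in circ. norm (1 / (z - w)) \<le> 1 / (1 - norm w)"
    and "AE z in circ. norm (1 / (1 - cnj w * z)) \<le> 1 / (1 - norm w)"
proof -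
  have *: "norm (1 / x) \<le> 1 / (1 - norm w)" if "1 - norm w \<le> norm x" for x :: complex
    unfolding norm_divide norm_one using that assms by (intro frac_le) auto
  show "AE z in circ. norm (1 / (z - w)) \<le> 1 / (1 - norm w)"
    using AE_circ_norm by eventually_elim (intro * norm_circle_diff_ge(1))
  show "AE z in circ. norm (1 / (1 - cnj w * z)) \<le> 1 / (1 - norm w)"
    using AE_circ_norm by eventually_elim (intro * norm_circle_diff_ge(2))
qed

text \<open>Used for Fourier coefficients, which are bounded: a recursion with a ratio inside the
  disk, followed towards minus infinity, forces them to vanish.\<close>

lemma geometric_bounded_zero:
  fixes a :: "nat \<Rightarrow> complex"
  assumes "\<And>k. norm (a k) \<le> B" "norm w < 1" "\<And>k. x = w ^ k * a k"
  shows "x = 0"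
proof -
  have "(\<lambda>k. norm w ^ k * B) \<longlonglongrightarrow> 0 * B"
    using assms(2) by (intro tendsto_intros LIMSEQ_realpow_zero) auto
  moreover have "norm x \<le> norm w ^ k * B" for k
    unfolding assms(3)[of k] norm_mult norm_power using assms(1) by (intro mult_left_mono) auto
  ultimately have "norm x \<le> 0 * B" by (intro LIMSEQ_le_const) auto
  then show ?thesis by simp
qed

text \<open>The quotient \<open>R\<close> satisfies
  \<open>fcoeff R n = cnj w * fcoeff R (n - 1)\<close> for n < 0. Iterating downwards keeps the
  coefficients bounded while the powers of \<open>cnj w\<close> tend to 0.\<close>

lemma H2_divide_kernel:
  assumes F: "F \<in> H2" and w: "norm w < 1"
  shows "(\<lambda>z. F z / (1 - cnj w * z)) \<in> H2"
proof -
  have [measurable]: "F \<in> borel_measurable circ" using F by (rule H2_measurable)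
  define R where "R = (\<lambda>z. F z / (1 - cnj w * z))"
  have R: "R \<in> L2"
    using L2_bounded_mult[OF H2_imp_L2[OF F] _ AE_norm_inverse_le(2)[OF w]] by (simp add: R_def)
  then have [measurable]: "R \<in> borel_measurable circ" by (rule L2_measurable)
  have rec: "fcoeff F n = fcoeff R n - cnj w * fcoeff R (n - 1)" for n
  proof -
    have "fcoeff F n = fcoeff (\<lambda>z. R z - cnj w * (z powi 1 * R z)) n"
    proof (rule fcoeff_cong_AE)
      show "AE z in circ. F z = R z - cnj w * (z powi 1 * R z)"
        using AE_circ_norm
      proof eventually_elim
        case (elim z)
        then have "1 - cnj w * z \<noteq> 0" using norm_circle_diff_ge(2)[of z w] w by auto
        then have "F z = (1 - cnj w * z) * R z" by (simp add: R_def)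
        then show ?case by (simp add: algebra_simps)
      qed
    qed measurable
    also have "\<dots> = fcoeff R n - fcoeff (\<lambda>z. cnj w * (z powi 1 * R z)) n"
      by (intro fcoeff_diff L2_integrable L2_cmult L2_powi_mult R)
    finally show ?thesis by (simp add: fcoeff_cmult fcoeff_shift[of R 1, simplified])
  qed
  have "fcoeff R n = 0" if "n < 0" for n
  proof (rule geometric_bounded_zero)
    show "norm (fcoeff R (n - int k)) \<le> (LINT z|circ. norm (R z))" for k
      by (intro norm_fcoeff_le L2_integrable R)
    show "norm (cnj w) < 1" using w by simp
    show "fcoeff R n = cnj w ^ k * fcoeff R (n - int k)" for k
    proof (induction k)
      case (Suc k)
      have "fcoeff R (n - int k) = cnj w * fcoeff R (n - int k - 1)"
        using rec[of "n - int k"] H2_fcoeff[OF F, of "n - int k"] that by simp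
      then show ?case using Suc by (simp add: algebra_simps)
    qed simp
  qed
  then show ?thesis using R by (simp add: H2_def R_def)
qed

lemma disk_value_sums:
  assumes "F \<in> H2" "norm w < 1"
  shows "(\<lambda>n. fcoeff F (int n) * w ^ n) sums disk_value F w"
proof -
  have "summable (\<lambda>n. fcoeff F (int n) * w ^ n)"
  proof (rule summable_comparison_test')
    show "summable (\<lambda>n. (LINT z|circ. norm (F z)) * norm w ^ n)"
      using assms(2) by (intro summable_mult summable_geometric) simp
    show "norm (fcoeff F (int n) * w ^ n) \<le> (LINT z|circ. norm (F z)) * norm w ^ n" for n
      unfolding norm_mult norm_power
      by (intro mult_right_mono norm_fcoeff_le H2_integrable assms) auto
  qed
  then show ?thesis by (simp add: disk_value_def summable_sums)
qed

text \<open>Below index 0 the coefficients of the quotient \<open>Q\<close> obey a one-step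
  recursion, so everything depends on the coefficient of index -1. The value subtracted from
  \<open>F\<close> is precisely the one that makes it vanish.\<close>

lemma H2_difference_quotient:
  assumes F: "F \<in> H2" and w: "norm w < 1"
  shows "(\<lambda>z. (F z - disk_value F w) / (z - w)) \<in> H2"
proof -
  have [measurable]: "F \<in> borel_measurable circ" using F by (rule H2_measurable)
  define a where "a = disk_value F w"
  define Q where "Q = (\<lambda>z. (F z - a) / (z - w))"
  have Q: "Q \<in> L2"
    using L2_bounded_mult[OF H2_imp_L2[OF H2_diff[OF F H2_const]] _ AE_norm_inverse_le(1)[OF w]] by (simp add: Q_def)
  then have [measurable]: "Q \<in> borel_measurable circ" by (rule L2_measurable)
  have rec: "fcoeff F n - (if n = 0 then a else 0) = fcoeff Q (n - 1) - w * fcoeff Q n" for n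
  proof -
    have "fcoeff F n - (if n = 0 then a else 0) = fcoeff (\<lambda>z. F z - a) n"
      by (simp add: fcoeff_diff[OF H2_integrable[OF F] H2_integrable[OF H2_const]] fcoeff_const)
    also have "\<dots> = fcoeff (\<lambda>z. z powi 1 * Q z - w * Q z) n"
    proof (rule fcoeff_cong_AE)
      show "AE z in circ. F z - a = z powi 1 * Q z - w * Q z"
        using AE_circ_norm
      proof eventually_elim
        case (elim z)
        then have "z - w \<noteq> 0" using w by auto
        then have "F z - a = (z - w) * Q z" by (simp add: Q_def)
        then show ?case by (simp add: algebra_simps)
      qed
    qed measurable
    also have "\<dots> = fcoeff (\<lambda>z. z powi 1 * Q z) n - fcoeff (\<lambda>z. w * Q z) n"
      by (intro fcoeff_diff L2_integrable L2_cmult L2_powi_mult Q)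
    finally show ?thesis by (simp add: fcoeff_cmult fcoeff_shift[of Q 1, simplified])
  qed
  \<comment> \<open>Multiplying \<open>rec\<close> by the powers of \<open>w\<close> and adding
    telescopes. As \<open>m\<close> grows, the sum tends to \<open>a\<close> and the last term to 0,
    which leaves \<open>fcoeff Q (-1) = 0\<close>.\<close>
  have part: "(\<Sum>k<Suc m. fcoeff F (int k) * w ^ k) - a = fcoeff Q (-1) - w ^ Suc m * fcoeff Q (int m)" for m
  proof (induction m)
    case 0
    then show ?case using rec[of 0] by (simp add: algebra_simps)
  next
    case (Suc m)
    have "fcoeff F (int (Suc m)) = fcoeff Q (int m) - w * fcoeff Q (int (Suc m))"
      using rec[of "int (Suc m)"] by simp
    then have "(\<Sum>k<Suc (Suc m). fcoeff F (int k) * w ^ k)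
        = (\<Sum>k<Suc m. fcoeff F (int k) * w ^ k) + (fcoeff Q (int m) - w * fcoeff Q (int (Suc m))) * w ^ Suc m"
      by (simp del: of_nat_Suc)
    moreover have "(\<Sum>k<Suc m. fcoeff F (int k) * w ^ k) = fcoeff Q (-1) - w ^ Suc m * fcoeff Q (int m) + a"
      using Suc by (simp add: diff_eq_eq)
    ultimately show ?case by (simp only:) (simp add: algebra_simps)
  qed
  have "(\<lambda>m. (\<Sum>k<Suc m. fcoeff F (int k) * w ^ k) - a + w ^ Suc m * fcoeff Q (int m)) \<longlonglongrightarrow> a - a + 0"
  proof (intro tendsto_add tendsto_diff tendsto_const)
    show "(\<lambda>m. \<Sum>k<Suc m. fcoeff F (int k) * w ^ k) \<longlonglongrightarrow> a"
      using disk_value_sums[OF F w] unfolding sums_def a_def by (rule LIMSEQ_Suc)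
    show "(\<lambda>m. w ^ Suc m * fcoeff Q (int m)) \<longlonglongrightarrow> 0"
    proof (rule Lim_null_comparison)
      show "\<forall>\<^sub>F m in sequentially. norm (w ^ Suc m * fcoeff Q (int m)) \<le> norm w ^ Suc m * (LINT z|circ. norm (Q z))"
        unfolding norm_mult norm_power
        by (intro always_eventually allI mult_left_mono norm_fcoeff_le L2_integrable Q) auto
      have "(\<lambda>m. norm w ^ Suc m * (LINT z|circ. norm (Q z))) \<longlonglongrightarrow> 0 * (LINT z|circ. norm (Q z))"
        using w by (intro tendsto_intros LIMSEQ_Suc[OF LIMSEQ_realpow_zero]) auto
      then show "(\<lambda>m. norm w ^ Suc m * (LINT z|circ. norm (Q z))) \<longlonglongrightarrow> 0" by simp
    qed
  qed
  then have Q1: "fcoeff Q (-1) = 0"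
    unfolding part by (simp add: LIMSEQ_const_iff)
  \<comment> \<open>For negative indices \<open>rec\<close> reads
    \<open>fcoeff Q (n - 1) = w * fcoeff Q n\<close>, so zeros propagate downwards.\<close>
  have "fcoeff Q (-1 - int m) = 0" for m
  proof (induction m)
    case 0
    then show ?case using Q1 by simp
  next
    case (Suc m)
    then show ?case using rec[of "-1 - int m"] H2_fcoeff[OF F, of "-1 - int m"] by (simp add: algebra_simps)
  qed
  then have "fcoeff Q (-1 - int (nat (-1 - n))) = 0" for n .
  then have "fcoeff Q n = 0" if "n < 0" for n
  proof -
    have "-1 - int (nat (-1 - n)) = n" using that by simp
    with \<open>fcoeff Q (-1 - int (nat (-1 - n))) = 0\<close> show ?thesis by metis
  qed
  then show ?thesis using Q by (simp add: H2_def Q_def a_def)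
qed

lemma disk_value_lincomb:
  assumes "h \<in> H2" "k \<in> H2" "norm w < 1"
  shows "disk_value (\<lambda>z. a * h z + b * k z) w = a * disk_value h w + b * disk_value k w"
proof -
  have "(\<lambda>n. fcoeff (\<lambda>z. a * h z + b * k z) (int n) * w ^ n) sums (a * disk_value h w + b * disk_value k w)"
    using sums_add[OF sums_mult[OF disk_value_sums[OF assms(1,3)], of a] sums_mult[OF disk_value_sums[OF assms(2,3)], of b]]
    by (simp add: fcoeff_add[OF H2_integrable[OF H2_cmult[OF assms(1)]] H2_integrable[OF H2_cmult[OF assms(2)]]] fcoeff_cmult algebra_simps)
  moreover have "(\<lambda>z. a * h z + b * k z) \<in> H2" by (intro H2_add H2_cmult assms)
  ultimately show ?thesis using disk_value_sums[OF _ assms(3)] sums_unique2 by blast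
qed

lemma disk_value_const: "disk_value (\<lambda>z. c) w = c"
proof -
  have "(\<lambda>n. fcoeff (\<lambda>z. c) (int n) * w ^ n) = (\<lambda>n. if n = 0 then c else 0)"
    by (auto simp: fcoeff_const)
  then show ?thesis unfolding disk_value_def using sums_unique[OF sums_single[of 0 "\<lambda>_. c"]] by simp
qed

lemma disk_value_cong_AE:
  assumes "h \<in> H2" "AE z in circ. h z = k z"
  shows "disk_value h w = disk_value k w"
  unfolding disk_value_def using fcoeff_cong_AE[OF H2_measurable[OF assms(1)] assms(2)] by simp

text \<open>A power series with a nonzero coefficient of positive index that vanishes at 0 has an
  isolated zero there. Hence all coefficients vanish, and uniqueness of Fourier coefficients
  applies.\<close>

lemma disk_value_zero_imp_AE:
  assumes F: "F \<in> H2" and z: "\<And>w. norm w < 1 \<Longrightarrow> disk_value F w = 0"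
  shows "AE z in circ. F z = 0"
proof (rule fcoeff_zero_imp_AE_zero[OF H2_integrable[OF F]])
  have sums: "(\<lambda>n. fcoeff F (int n) * (w - 0) ^ n) sums 0" if "norm (w - 0) < 1" for w
    using disk_value_sums[OF F, of w] z[of w] that by simp
  have "fcoeff F (int n) = 0" for n
  proof (cases "n = 0")
    case True
    then show ?thesis using sums[of 0] by simp
  next
    case False
    show ?thesis
    proof (rule ccontr)
      assume "fcoeff F (int n) \<noteq> 0"
      show False
      proof (rule powser_0_nonzero[of 1 "0::complex" "\<lambda>n. fcoeff F (int n)" "\<lambda>_. 0" n])
        fix s :: real
        assume s: "0 < s" "\<And>z :: complex. z \<in> cball 0 s - {0} \<Longrightarrow> (0::complex) \<noteq> 0"
        then show False using s(2)[of "of_real s"] by auto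
      qed (use sums False \<open>fcoeff F (int n) \<noteq> 0\<close> in auto)
    qed
  qed
  then show "fcoeff F n = 0" for n
    using H2_fcoeff[OF F] by (metis nonneg_int_cases not_le)
qed

lemma ip_zero_imp_AE:
  assumes "h \<in> L2" "ip h h = 0"
  shows "AE z in circ. h z = 0"
proof -
  have "complex_of_real (LINT z|circ. (norm (h z))\<^sup>2) = ip h h"
    unfolding ip_def by (simp add: complex_norm_square[symmetric] flip: of_real_power)
  then have "(LINT z|circ. (norm (h z))\<^sup>2) = 0" using assms(2) by simp
  then have "AE z in circ. (norm (h z))\<^sup>2 = 0"
    using integral_nonneg_eq_0_iff_AE[OF L2_integrable_sq[OF assms(1)]] by simp
  then show ?thesis by eventually_elim simp
qed

lemma ip_diff_left:
  assumes "h \<in> L2" "k \<in> L2" "s \<in> L2"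
  shows "ip (\<lambda>z. h z - k z) s = ip h s - ip k s"
  unfolding ip_def using L2_mult_integrable[OF assms(1) L2_cnj[OF assms(3)]] L2_mult_integrable[OF assms(2) L2_cnj[OF assms(3)]]
  by (simp add: left_diff_distrib)

section \<open>Bounded analytic functions\<close>

text \<open>For \<open>r < 1\<close> the power series converges absolutely and uniformly on the
  circle of radius \<open>r\<close>, so it can be integrated term by term.\<close>

lemma fcoeff_dilation:
  assumes F: "\<And>w. norm w < 1 \<Longrightarrow> (\<lambda>m. a m * w ^ m) sums F w" and r: "0 \<le> r" "r < 1"
  shows "fcoeff (\<lambda>z. indicator (cball 0 1) z *\<^sub>R F (of_real r * z)) n
    = (if n \<ge> 0 then a (nat n) * of_real r ^ nat n else 0)"
proof -
  let ?s = "\<lambda>z. indicator (cball 0 1) z *\<^sub>R F (of_real r * z)"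
  have int: "integrable circ (\<lambda>z. a m * of_real r ^ m * (z powi int m * cnj (z powi n)))" for m
    using L2_mult_integrable[OF L2_powi[of 1 "int m"] L2_cnj[OF L2_powi[of 1 n]]] by simp
  have sr: "summable (\<lambda>m. norm (a m * of_real r ^ m))"
  proof (rule powser_insidea)
    \<comment> \<open>The midpoint of \<open>r\<close> and 1 is inside the disk, and convergence
      there forces absolute convergence at \<open>r\<close>.\<close>
    show "summable (\<lambda>m. a m * of_real ((r + 1) / 2) ^ m)"
      using F[of "of_real ((r + 1) / 2)"] r by (intro sums_summable) (simp del: of_real_divide of_real_add)
    show "norm (of_real r :: complex) < norm (of_real ((r + 1) / 2) :: complex)"
      using r by (simp del: of_real_divide of_real_add)
  qed
  have nrm: "AE z in circ. norm (a m * of_real r ^ m * (z powi int m * cnj (z powi n))) = norm (a m * of_real r ^ m)" for m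
    using AE_circ_norm by eventually_elim (simp add: norm_mult norm_power norm_power_int)
  have nrm_int: "(LINT z|circ. norm (a m * of_real r ^ m * (z powi int m * cnj (z powi n)))) = norm (a m * of_real r ^ m)" for m
    using integral_cong_AE[OF _ _ nrm] int by simp
  have "fcoeff ?s n = (LINT z|circ. (\<Sum>m. a m * of_real r ^ m * (z powi int m * cnj (z powi n))))"
    unfolding fcoeff_def ip_def
  proof (rule integral_cong_AE)
    have eq: "AE z in circ. (\<Sum>m. a m * of_real r ^ m * (z powi int m * cnj (z powi n))) = ?s z * cnj (z powi n)"
      using AE_circ_norm
    proof eventually_elim
      case (elim z)
      have "(\<lambda>m. a m * (of_real r * z) ^ m) sums F (of_real r * z)"
        using elim r by (intro F) (simp add: norm_mult)
      from sums_mult2[OF this, of "cnj (z powi n)"]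
      have "(\<lambda>m. a m * of_real r ^ m * (z powi int m * cnj (z powi n))) sums (?s z * cnj (z powi n))"
        using elim by (simp add: power_mult_distrib mult.assoc)
      then show ?case by (rule sums_unique[symmetric])
    qed
    have m: "(\<lambda>z. \<Sum>m. a m * of_real r ^ m * (z powi int m * cnj (z powi n))) \<in> borel_measurable circ"
      by measurable
    show "(\<lambda>z. \<Sum>m. a m * of_real r ^ m * (z powi int m * cnj (z powi n))) \<in> borel_measurable circ" by (rule m)
    show "(\<lambda>z. ?s z * cnj (z powi n)) \<in> borel_measurable circ" by (rule borel_measurable_circ_cong_AE[OF m eq])
    show "AE z in circ. ?s z * cnj (z powi n) = (\<Sum>m. a m * of_real r ^ m * (z powi int m * cnj (z powi n)))"
      using eq by eventually_elim simp
  qed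
  also have "\<dots> = (\<Sum>m. LINT z|circ. a m * of_real r ^ m * (z powi int m * cnj (z powi n)))"
  proof (rule integral_suminf[OF int])
    have "AE z in circ. \<forall>m. norm (a m * of_real r ^ m * (z powi int m * cnj (z powi n))) = norm (a m * of_real r ^ m)"
      unfolding AE_all_countable using nrm by blast
    then show "AE z in circ. summable (\<lambda>m. norm (a m * of_real r ^ m * (z powi int m * cnj (z powi n))))"
      by eventually_elim (use sr in simp)
    show "summable (\<lambda>m. LINT z|circ. norm (a m * of_real r ^ m * (z powi int m * cnj (z powi n))))"
      unfolding nrm_int by (rule sr)
  qed
  also have "\<dots> = (\<Sum>m. if int m = n then a m * of_real r ^ m else 0)"
  proof -
    have "(LINT z|circ. a m * of_real r ^ m * (z powi int m * cnj (z powi n))) = a m * of_real r ^ m * fcoeff (\<lambda>z. z powi int m) n" for m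
      by (simp add: fcoeff_def ip_def del: power_int_of_nat)
    then have "(LINT z|circ. a m * of_real r ^ m * (z powi int m * cnj (z powi n))) = (if int m = n then a m * of_real r ^ m else 0)" for m
      by (simp only: fcoeff_powi) auto
    then show ?thesis by (simp only:)
  qed
  also have "\<dots> = (if n \<ge> 0 then a (nat n) * of_real r ^ nat n else 0)"
  proof (cases "n \<ge> 0")
    case True
    then have "int m = n \<longleftrightarrow> m = nat n" for m by auto
    then have "(\<lambda>m. if int m = n then a m * of_real r ^ m else 0) = (\<lambda>m. if m = nat n then a m * of_real r ^ m else 0)"
      by simp
    then show ?thesis using True sums_unique[OF sums_single[of "nat n" "\<lambda>m. a m * of_real r ^ m"]] by simp
  next
    case False
    then have "(\<lambda>m. if int m = n then a m * of_real r ^ m else 0) = (\<lambda>m. 0)" by auto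
    then show ?thesis using False by simp
  qed
  finally show ?thesis .
qed

text \<open>The dilated functions have coefficients \<open>a n * r ^ n\<close>. Boundedness permits
  dominated convergence as \<open>r\<close> tends to 1, so the boundary function has the Taylor
  coefficients of \<open>F\<close>. This identifies \<open>disk_value\<close> with the given
  analytic function, both for \<Theta> and for elements of \<open>Hinf\<close>.\<close>

lemma bounded_holomorphic_boundary_H2:
  assumes hol: "F holomorphic_on ball 0 1" and bd: "bounded (F ` ball 0 1)" and bv: "has_boundary_values F h"
  obtains B where "h \<in> H2" "AE z in circ. norm (h z) \<le> B" "\<And>w. norm w < 1 \<Longrightarrow> disk_value h w = F w"
proof -
  obtain B where B: "\<And>w. norm w < 1 \<Longrightarrow> norm (F w) \<le> B"
    using bd unfolding bounded_iff by (metis image_eqI mem_ball_0)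
  have B0: "B \<ge> 0" using B[of 0] norm_ge_zero[of "F 0"] by (simp del: norm_ge_zero)
  define a where "a = (\<lambda>m. (deriv ^^ m) F 0 / fact m)"
  have ser: "(\<lambda>m. a m * w ^ m) sums F w" if "norm w < 1" for w
    using holomorphic_power_series[OF hol, of w] that by (simp add: a_def)
  \<comment> \<open>A sequence of radii replaces the one-sided limit: measurability of the limit and
    dominated convergence are statements about sequences.\<close>
  define r where "r = (\<lambda>k. 1 - inverse (real (Suc k)))"
  have r: "0 \<le> r k" "r k < 1" for k by (auto simp: r_def field_simps)
  have rlim: "r \<longlonglongrightarrow> 1"
    unfolding r_def using tendsto_diff[OF tendsto_const LIMSEQ_inverse_real_of_nat, of 1] by simp
  have rleft: "filterlim r (at_left 1) sequentially"
  proof -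
    have "r k \<in> {..<1} \<and> r k \<noteq> 1" for k using r(2)[of k] by simp
    then show ?thesis using rlim unfolding filterlim_at by (auto intro!: always_eventually)
  qed
  \<comment> \<open>Nothing is known about \<open>F\<close> outside the disk. The cut-off makes
    \<open>s k\<close> a Borel function and does not change it on the circle.\<close>
  define s where "s = (\<lambda>k z. indicator (cball 0 1) z *\<^sub>R F (of_real (r k) * z))"
  have rz: "of_real (r k) * z \<in> ball 0 1" if "z \<in> cball 0 1" for k and z :: complex
  proof -
    have "norm (of_real (r k) * z) \<le> r k * 1"
      unfolding norm_mult using that r[of k] by (intro mult_mono) auto
    then show ?thesis using r(2)[of k] by simp
  qed
  have [measurable]: "s k \<in> borel_measurable circ" for k
  proof -
    have "continuous_on (cball 0 1) (\<lambda>z. F (of_real (r k) * z))"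
      by (rule continuous_on_compose2[OF holomorphic_on_imp_continuous_on[OF hol]])
         (use rz in \<open>auto intro!: continuous_intros\<close>)
    then show ?thesis
      unfolding s_def by (intro borel_measurable_circ borel_measurable_continuous_on_indicator) auto
  qed
  have slim: "AE z in circ. (\<lambda>k. s k z) \<longlonglongrightarrow> h z"
    using bv[unfolded has_boundary_values_def] AE_circ_norm
  proof eventually_elim
    case (elim z)
    have "(\<lambda>k. F (of_real (r k) * z)) \<longlonglongrightarrow> h z"
      using filterlim_compose[OF elim(1) rleft] .
    then show ?case using elim(2) by (simp add: s_def)
  qed
  have sB: "norm (s k z) \<le> B" for k z
    using B[of "of_real (r k) * z"] rz[of z k] B0 by (auto simp: s_def indicator_def)
  have "(\<lambda>z. lim (\<lambda>k. s k z)) \<in> borel_measurable circ" by measurable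
  moreover have "AE z in circ. lim (\<lambda>k. s k z) = h z"
    using slim by eventually_elim (rule limI)
  ultimately have hm [measurable]: "h \<in> borel_measurable circ" by (rule borel_measurable_circ_cong_AE)
  have hB: "AE z in circ. norm (h z) \<le> B"
    using slim
  proof eventually_elim
    case (elim z)
    then show ?case using sB by (intro LIMSEQ_le_const2[OF tendsto_norm]) auto
  qed
  have L2: "h \<in> L2"
    using L2_bounded_mult[OF L2_const[of 1] hm hB] by simp
  have coeff: "fcoeff h n = (if n \<ge> 0 then a (nat n) else 0)" for n
  proof -
    have "(\<lambda>k. LINT z|circ. s k z * cnj (z powi n)) \<longlonglongrightarrow> (LINT z|circ. h z * cnj (z powi n))"
    proof (rule integral_dominated_convergence[where w = "\<lambda>_. B"])
      show "AE z in circ. (\<lambda>k. s k z * cnj (z powi n)) \<longlonglongrightarrow> h z * cnj (z powi n)"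
        using slim by eventually_elim (intro tendsto_intros)
      show "AE z in circ. norm (s k z * cnj (z powi n)) \<le> B" for k
        using AE_circ_norm by eventually_elim (use sB in \<open>simp add: norm_mult norm_power_int\<close>)
    qed (simp_all, measurable)
    moreover have "(LINT z|circ. s k z * cnj (z powi n)) = (if n \<ge> 0 then a (nat n) * of_real (r k) ^ nat n else 0)" for k
      using fcoeff_dilation[OF ser r, of k n] by (simp add: fcoeff_def ip_def s_def)
    ultimately have "(\<lambda>k. if n \<ge> 0 then a (nat n) * of_real (r k) ^ nat n else 0) \<longlonglongrightarrow> fcoeff h n"
      by (simp add: fcoeff_def ip_def)
    moreover have "(\<lambda>k. if n \<ge> 0 then a (nat n) * of_real (r k) ^ nat n else 0) \<longlonglongrightarrow> (if n \<ge> 0 then a (nat n) * of_real 1 ^ nat n else 0)"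
      by (cases "n \<ge> 0") (simp_all only: if_True if_False, (intro tendsto_intros rlim)+)
    ultimately show ?thesis using LIMSEQ_unique by fastforce
  qed
  show ?thesis
  proof (rule that[OF _ hB])
    show "h \<in> H2" using L2 by (simp add: H2_def coeff)
    show "disk_value h w = F w" if "norm w < 1" for w
      unfolding disk_value_def using ser[OF that] by (simp add: coeff sums_unique[symmetric])
  qed
qed

lemma disk_value_0: "disk_value h 0 = fcoeff h 0"
  unfolding disk_value_def using powser_sums_zero[of "\<lambda>n. fcoeff h (int n)"] sums_unique by fastforce

lemma H2_divide_z:
  assumes "h \<in> H2" "fcoeff h 0 = 0"
  shows "(\<lambda>z. h z / z) \<in> H2"
  using H2_difference_quotient[OF assms(1), of 0] assms(2) by (simp add: disk_value_0)

text \<open>The integral is the coefficient of index -1 of \<open>h * k\<close>. In other words,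
  \<open>H2\<close> is orthogonal to the conjugates of \<open>z * H2\<close>.\<close>

lemma integral_H2_z_mult:
  assumes "h \<in> H2" "k \<in> H2"
  shows "(LINT z|circ. z * (h z * k z)) = 0"
proof -
  have "fcoeff (\<lambda>z. h z * k z) (-1) = 0" and [measurable]: "(\<lambda>z. h z * k z) \<in> borel_measurable circ"
    using H2_mult_H1[OF assms] by (auto simp: H1_def)
  then show ?thesis by (simp add: fcoeff_eq)
qed

lemma AE_circ_unit: "AE z in circ. z * cnj z = 1"
  using AE_circ_norm by eventually_elim (simp add: complex_norm_square[symmetric])

text \<open>On the circle \<open>z * cnj (1 - cnj w * z) = z - w\<close>. Thus conjugation turns
  quotients by the Cauchy kernel denominator into difference quotients.\<close>

lemma unit_circle_divide:
  assumes "z * cnj z = 1" "z \<noteq> w"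
  shows "cnj z / cnj (1 - cnj w * z) = 1 / (z - w)"
proof -
  have "z * cnj (1 - cnj w * z) = z - w * (z * cnj z)" by (simp add: algebra_simps)
  then have *: "z * cnj (1 - cnj w * z) = z - w" using assms by simp
  then have "cnj (1 - cnj w * z) \<noteq> 0" using assms by auto
  then have "cnj z / cnj (1 - cnj w * z) = (z * cnj z) / (z * cnj (1 - cnj w * z))"
    using assms by (metis mult_divide_mult_cancel_left mult_zero_left zero_neq_one)
  then show ?thesis unfolding * assms(1) .
qed

lemma AE_circ_neq: "norm w < 1 \<Longrightarrow> AE z in circ. z \<noteq> w"
  using AE_circ_norm by eventually_elim auto

section \<open>Separating linearly independent coefficients\<close>

text \<open>Gaussian elimination with points \<open>w\<close> as equations: a point
  \<open>w0\<close> where one coefficient is nonzero removes that term from all the other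
  combinations, and the remaining coefficients are still independent. The removed vector is
  recovered from the combination at \<open>w0\<close>.\<close>

lemma independent_combination:
  fixes \<phi> :: "'i \<Rightarrow> 'w \<Rightarrow> complex" and e :: "'i \<Rightarrow> complex \<Rightarrow> complex"
  assumes "finite I"
    and V: "\<And>h k c. h \<in> V \<Longrightarrow> k \<in> V \<Longrightarrow> (\<lambda>z. h z + c * k z) \<in> V" "(\<lambda>z. 0) \<in> V"
    and mem: "\<And>w. w \<in> W \<Longrightarrow> (\<lambda>z. \<Sum>i\<in>I. \<phi> i w * e i z) \<in> V"
    and indep: "\<And>c. (\<And>w. w \<in> W \<Longrightarrow> (\<Sum>i\<in>I. c i * \<phi> i w) = 0) \<Longrightarrow> \<forall>i\<in>I. c i = 0"
    and i: "i \<in> I"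
  shows "e i \<in> V"
  using assms(1) mem indep i
proof (induction I arbitrary: \<phi> i rule: finite_induct)
  case (insert j I)
  have "\<exists>w0\<in>W. \<phi> j w0 \<noteq> 0"
  proof (rule ccontr)
    assume "\<not> ?thesis"
    then have z: "\<phi> j w = 0" if "w \<in> W" for w using that by blast
    have "\<forall>i\<in>insert j I. (if i = j then 1 else 0 :: complex) = 0"
    proof (rule insert.prems(2))
      fix w assume "w \<in> W"
      have "(\<Sum>i\<in>I. (if i = j then 1 else 0) * \<phi> i w) = 0"
        using insert.hyps by (intro sum.neutral) auto
      then show "(\<Sum>i\<in>insert j I. (if i = j then 1 else 0) * \<phi> i w) = 0"
        using insert.hyps z[OF \<open>w \<in> W\<close>] by simp
    qed
    then show False by simp
  qed
  then obtain w0 where w0: "w0 \<in> W" "\<phi> j w0 \<noteq> 0" by blast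
  \<comment> \<open>Coefficients after a multiple of the combination at \<open>w0\<close> has been
    subtracted; the one belonging to \<open>j\<close> becomes 0.\<close>
  define \<psi> where "\<psi> = (\<lambda>i w. \<phi> i w - \<phi> j w / \<phi> j w0 * \<phi> i w0)"
  have eI: "e i \<in> V" if "i \<in> I" for i
  proof (rule insert.IH[of \<psi>, OF _ _ that])
    fix w assume w: "w \<in> W"
    have "(\<lambda>z. (\<Sum>i\<in>insert j I. \<phi> i w * e i z) + (- (\<phi> j w / \<phi> j w0)) * (\<Sum>i\<in>insert j I. \<phi> i w0 * e i z)) \<in> V"
      by (intro V insert.prems w w0)
    moreover have "(\<Sum>i\<in>insert j I. \<phi> i w * e i z) + (- (\<phi> j w / \<phi> j w0)) * (\<Sum>i\<in>insert j I. \<phi> i w0 * e i z)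
        = (\<Sum>i\<in>I. \<psi> i w * e i z)" for z
      using insert.hyps w0 by (simp add: \<psi>_def algebra_simps sum_subtractf sum_distrib_left sum_negf)
    ultimately show "(\<lambda>z. \<Sum>i\<in>I. \<psi> i w * e i z) \<in> V" by simp
  next
    fix c assume c: "\<And>w. w \<in> W \<Longrightarrow> (\<Sum>i\<in>I. c i * \<psi> i w) = 0"
    \<comment> \<open>The entry at \<open>j\<close> is chosen so that the relation \<open>c\<close>
      among the \<psi> becomes a relation among the \<phi>.\<close>
    define d where "d = (\<lambda>i. if i = j then - (\<Sum>i\<in>I. c i * \<phi> i w0) / \<phi> j w0 else c i)"
    have "\<forall>i\<in>insert j I. d i = 0"
    proof (rule insert.prems(2))
      fix w assume w: "w \<in> W"
      have "(\<Sum>i\<in>insert j I. d i * \<phi> i w) = d j * \<phi> j w + (\<Sum>i\<in>I. d i * \<phi> i w)"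
        using insert.hyps by simp
      also have "(\<Sum>i\<in>I. d i * \<phi> i w) = (\<Sum>i\<in>I. c i * \<phi> i w)"
        using insert.hyps by (intro sum.cong) (auto simp: d_def)
      also have "d j * \<phi> j w + (\<Sum>i\<in>I. c i * \<phi> i w) = (\<Sum>i\<in>I. c i * \<psi> i w)"
        by (simp add: d_def \<psi>_def algebra_simps sum_subtractf sum_distrib_left sum_divide_distrib)
      finally show "(\<Sum>i\<in>insert j I. d i * \<phi> i w) = 0" using c[OF w] by simp
    qed
    then show "\<forall>i\<in>I. c i = 0"
      using insert.hyps by (metis d_def insertI2)
  qed
  have ej: "e j \<in> V"
  proof -
    have sum: "(\<lambda>z. \<Sum>i\<in>J. \<phi> i w0 * e i z) \<in> V" if "finite J" "J \<subseteq> I" for J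
      using that
    proof (induction J rule: finite_induct)
      case (insert k J)
      then have "(\<lambda>z. (\<Sum>i\<in>J. \<phi> i w0 * e i z) + \<phi> k w0 * e k z) \<in> V"
        by (intro V eI) auto
      then show ?case using insert.hyps by (simp add: add.commute)
    qed (simp add: V)
    have "(\<lambda>z. (\<Sum>i\<in>insert j I. \<phi> i w0 * e i z) + (-1) * (\<Sum>i\<in>I. \<phi> i w0 * e i z)) \<in> V"
      by (intro V insert.prems w0 sum insert.hyps) auto
    then have "(\<lambda>z. \<phi> j w0 * e j z) \<in> V" using insert.hyps by simp
    from V(1)[OF V(2) this, of "1 / \<phi> j w0"] show ?thesis using w0 by simp
  qed
  show ?case using insert.prems(3) eI ej by blast
qed simp

section \<open>Model spaces\<close>

locale inner =
  fixes \<Theta> :: "complex \<Rightarrow> complex"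
  assumes inner: "inner_function \<Theta>"
begin

abbreviation \<theta> :: "complex \<Rightarrow> complex" where "\<theta> \<equiv> radial_lim \<Theta>"
abbreviation K :: "(complex \<Rightarrow> complex) set" where "K \<equiv> model_space \<Theta>"

lemma theta_H2: "\<theta> \<in> H2" and disk_value_theta: "norm w < 1 \<Longrightarrow> disk_value \<theta> w = \<Theta> w"
proof -
  obtain B where B: "\<theta> \<in> H2" "AE z in circ. norm (\<theta> z) \<le> B" "\<And>w. norm w < 1 \<Longrightarrow> disk_value \<theta> w = \<Theta> w"
    by (rule bounded_holomorphic_boundary_H2[of \<Theta> \<theta>]) (use inner in \<open>auto simp: inner_function_def\<close>)
  show "\<theta> \<in> H2" "norm w < 1 \<Longrightarrow> disk_value \<theta> w = \<Theta> w" using B(1,3) by auto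
qed

lemma theta_measurable [measurable]: "\<theta> \<in> borel_measurable circ"
  by (rule H2_measurable[OF theta_H2])

lemma AE_theta_norm: "AE z in circ. norm (\<theta> z) = 1"
  using inner by (simp add: inner_function_def)

lemma AE_theta_norm_le: "AE z in circ. norm (\<theta> z) \<le> 1"
  using AE_theta_norm by eventually_elim simp

lemma AE_unit: "AE z in circ. z * cnj z = 1 \<and> \<theta> z * cnj (\<theta> z) = 1"
  using AE_circ_unit AE_theta_norm by eventually_elim (simp add: complex_norm_square[symmetric])

lemma theta_mult_H2: "h \<in> H2 \<Longrightarrow> (\<lambda>z. \<theta> z * h z) \<in> H2"
  by (rule H2_bounded_mult[OF theta_H2 AE_theta_norm_le])

lemma theta_mult_L2: "h \<in> L2 \<Longrightarrow> (\<lambda>z. \<theta> z * h z) \<in> L2"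
  by (rule L2_bounded_mult[OF _ _ AE_theta_norm_le]) measurable

lemma cnj_theta_mult_L2: "h \<in> L2 \<Longrightarrow> (\<lambda>z. cnj (\<theta> z) * h z) \<in> L2"
  by (rule L2_bounded_mult[where B = 1]) (use AE_theta_norm_le in auto)

text \<open>The map sending \<open>h\<close> to \<open>\<theta> * cnj z * cnj h\<close> is the
  natural conjugation of the model space. Its coefficient of index n < 0 is the conjugate of the
  inner product of \<open>h\<close> with \<theta> times the monomial of degree -n - 1, so
  orthogonality to \<open>\<theta> * H2\<close> becomes analyticity. Below, this image is called the
  flip of \<open>h\<close>.\<close>

lemma model_space_iff: "h \<in> K \<longleftrightarrow> h \<in> H2 \<and> (\<lambda>z. \<theta> z * cnj z * cnj (h z)) \<in> H2"
proof (cases "h \<in> H2")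
  case h: True
  define c where "c = (\<lambda>z. \<theta> z * cnj z * cnj (h z))"
  have [measurable]: "h \<in> borel_measurable circ" using h by (rule H2_measurable)
  have "(\<lambda>z. \<theta> z * (z powi (-1) * cnj (h z))) \<in> L2"
    by (intro theta_mult_L2 L2_powi_mult L2_cnj H2_imp_L2 h)
  moreover have "AE z in circ. \<theta> z * (z powi (-1) * cnj (h z)) = c z"
    using AE_circ_unit by eventually_elim (simp add: c_def inverse_unique)
  ultimately have cL2: "c \<in> L2" by (rule L2_cong_AE)
  then have [measurable]: "c \<in> borel_measurable circ" by (rule L2_measurable)
  have "c \<in> H2" if orth: "\<forall>k\<in>H2. ip h (\<lambda>z. \<theta> z * k z) = 0"
  proof -
    have "fcoeff c n = 0" if n: "n < 0" for n
    proof -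
      have "fcoeff c n = (LINT z|circ. cnj (h z * cnj (\<theta> z * z powi (- n - 1))))"
        unfolding fcoeff_eq[OF \<open>c \<in> borel_measurable circ\<close>]
      proof (rule integral_cong_AE)
        show "AE z in circ. z powi (- n) * c z = cnj (h z * cnj (\<theta> z * z powi (- n - 1)))"
          using AE_circ_unit
        proof eventually_elim
          case (elim z)
          then have "z \<noteq> 0" by auto
          then have "z powi (- n) = z powi (- n - 1) * z"
            using power_int_add_1[of z "- n - 1"] by simp
          then show ?case using elim by (simp add: c_def algebra_simps)
        qed
      qed measurable
      also have "\<dots> = cnj (ip h (\<lambda>z. \<theta> z * z powi (- n - 1)))"
        unfolding ip_def by (rule Bochner_Integration.integral_cnj)
      also have "\<dots> = 0"
      proof -
        have "(\<lambda>z. z powi (- n - 1)) \<in> H2" using n by (intro H2_powi) simp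
        from orth[rule_format, OF this] show ?thesis by (simp only: complex_cnj_zero)
      qed
      finally show ?thesis .
    qed
    then show ?thesis using cL2 by (simp add: H2_def)
  qed
  moreover have "ip h (\<lambda>z. \<theta> z * k z) = 0" if "c \<in> H2" "k \<in> H2" for k
  proof -
    have [measurable]: "k \<in> borel_measurable circ" using that by (auto intro: H2_measurable)
    have "ip h (\<lambda>z. \<theta> z * k z) = (LINT z|circ. cnj (z * (c z * k z)))"
      unfolding ip_def
    proof (rule integral_cong_AE)
      show "AE z in circ. h z * cnj (\<theta> z * k z) = cnj (z * (c z * k z))"
        using AE_circ_unit
      proof eventually_elim
        case (elim z)
        have "cnj (z * (c z * k z)) = (z * cnj z) * (h z * cnj (\<theta> z * k z))" by (simp add: c_def)
        then show ?case unfolding elim mult_1 by (rule sym)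
      qed
    qed measurable
    also have "\<dots> = cnj (LINT z|circ. z * (c z * k z))" by (rule Bochner_Integration.integral_cnj)
    finally show ?thesis by (simp only: integral_H2_z_mult[OF that]) simp
  qed
  ultimately show ?thesis using h by (auto simp: model_space_def c_def)
qed (simp add: model_space_def)

lemma model_space_H2: "h \<in> K \<Longrightarrow> h \<in> H2" by (simp add: model_space_iff)

lemma model_space_cong_AE:
  assumes "h \<in> K" "AE z in circ. h z = k z"
  shows "k \<in> K"
  unfolding model_space_iff
proof
  show "k \<in> H2" using assms model_space_H2 H2_cong_AE by blast
  have "AE z in circ. \<theta> z * cnj z * cnj (h z) = \<theta> z * cnj z * cnj (k z)"
    using assms(2) by eventually_elim simp
  then show "(\<lambda>z. \<theta> z * cnj z * cnj (k z)) \<in> H2"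
    using assms(1) H2_cong_AE by (auto simp: model_space_iff)
qed

text \<open>Compared with \<open>model_space_iff\<close>, the flip has lost the factor
  \<open>cnj z\<close>. This admits one more dimension: the conjugate of \<theta> times \<theta> is
  the constant 1.\<close>

lemma model_space_plus_iff:
  "h \<in> model_space_plus \<Theta> \<longleftrightarrow> h \<in> H2 \<and> (\<lambda>z. \<theta> z * cnj (h z)) \<in> H2"
proof
  assume "h \<in> model_space_plus \<Theta>"
  then obtain h1 c where h1: "h1 \<in> K" and ae: "AE z in circ. h z = h1 z + c * \<theta> z"
    unfolding model_space_plus_def by blast
  show "h \<in> H2 \<and> (\<lambda>z. \<theta> z * cnj (h z)) \<in> H2"
  proof
    show "h \<in> H2"
    proof (rule H2_cong_AE)
      show "(\<lambda>z. h1 z + c * \<theta> z) \<in> H2" using h1 by (intro H2_add H2_cmult theta_H2 model_space_H2)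
      show "AE z in circ. h1 z + c * \<theta> z = h z" using ae by eventually_elim simp
    qed
    show "(\<lambda>z. \<theta> z * cnj (h z)) \<in> H2"
    proof (rule H2_cong_AE)
      show "(\<lambda>z. z * (\<theta> z * cnj z * cnj (h1 z)) + cnj c) \<in> H2"
        using h1 by (intro H2_add H2_z_mult H2_const) (simp add: model_space_iff)
      show "AE z in circ. z * (\<theta> z * cnj z * cnj (h1 z)) + cnj c = \<theta> z * cnj (h z)"
        using ae AE_unit
      proof eventually_elim
        case (elim z)
        have "z * (\<theta> z * cnj z * cnj (h1 z)) + cnj c = (z * cnj z) * (\<theta> z * cnj (h1 z)) + cnj c" by simp
        also have "\<dots> = \<theta> z * cnj (h1 z) + cnj c * (\<theta> z * cnj (\<theta> z))" using elim(2) by simp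
        finally show ?case using elim(1) by (simp add: algebra_simps)
      qed
    qed
  qed
next
  assume h: "h \<in> H2 \<and> (\<lambda>z. \<theta> z * cnj (h z)) \<in> H2"
  \<comment> \<open>Removing the constant term \<open>d\<close> makes
    \<open>\<theta> * cnj h - d\<close> divisible by \<open>z\<close>; in \<open>h\<close> this
    means subtracting \<open>cnj d * \<theta>\<close>.\<close>
  define d where "d = fcoeff (\<lambda>z. \<theta> z * cnj (h z)) 0"
  define h1 where "h1 = (\<lambda>z. h z - cnj d * \<theta> z)"
  have "h1 \<in> K"
    unfolding model_space_iff
  proof
    show "h1 \<in> H2" unfolding h1_def using h by (intro H2_diff H2_cmult theta_H2) auto
    show "(\<lambda>z. \<theta> z * cnj z * cnj (h1 z)) \<in> H2"
    proof (rule H2_cong_AE)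
      show "(\<lambda>z. (\<theta> z * cnj (h z) - d) / z) \<in> H2"
      proof (rule H2_divide_z)
        show "(\<lambda>z. \<theta> z * cnj (h z) - d) \<in> H2" using h by (intro H2_diff H2_const) auto
        show "fcoeff (\<lambda>z. \<theta> z * cnj (h z) - d) 0 = 0"
          using h by (subst fcoeff_diff) (auto intro: H2_integrable H2_const simp: fcoeff_const d_def)
      qed
      show "AE z in circ. (\<theta> z * cnj (h z) - d) / z = \<theta> z * cnj z * cnj (h1 z)"
        using AE_unit
      proof eventually_elim
        case (elim z)
        have "1 / z = cnj z" using elim by (metis inverse_unique inverse_eq_divide)
        then have "(\<theta> z * cnj (h z) - d) / z = (\<theta> z * cnj (h z) - d * (\<theta> z * cnj (\<theta> z))) * cnj z"
          using elim by (metis divide_inverse inverse_eq_divide mult.right_neutral)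
        then show ?case by (simp add: h1_def algebra_simps)
      qed
    qed
  qed
  moreover have "AE z in circ. h z = h1 z + cnj d * \<theta> z" by (simp add: h1_def)
  ultimately show "h \<in> model_space_plus \<Theta>" unfolding model_space_plus_def by blast
qed

lemma model_space_imp_plus: "h \<in> K \<Longrightarrow> h \<in> model_space_plus \<Theta>"
  unfolding model_space_plus_def by (auto intro!: bexI[of _ h] exI[of _ 0])

text \<open>\<open>L2\<close> is the orthogonal sum of the model space, \<open>\<theta> * H2\<close>
  and the conjugates of \<open>z * H2\<close>. Exhibiting a decomposition therefore identifies the
  projection, whichever representative \<open>SOME\<close> picks.\<close>

lemma oproj_model_space:
  assumes v: "v \<in> K" and a: "a \<in> H2" and b: "b \<in> H2"
    and h: "AE z in circ. h z = v z + \<theta> z * a z + cnj (z * b z)"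
  shows "AE z in circ. oproj K h z = v z" and "oproj K h \<in> K"
proof -
  have ta: "(\<lambda>z. \<theta> z * a z) \<in> L2" and zb: "(\<lambda>z. cnj (z * b z)) \<in> L2"
    by (intro H2_imp_L2 theta_mult_H2 a, intro L2_cnj H2_imp_L2 H2_z_mult b)
  have vL2: "v \<in> L2" using v by (intro H2_imp_L2 model_space_H2)
  have hL2: "h \<in> L2"
  proof (rule L2_cong_AE)
    show "(\<lambda>z. v z + \<theta> z * a z + cnj (z * b z)) \<in> L2" by (intro L2_add vL2 ta zb)
    show "AE z in circ. v z + \<theta> z * a z + cnj (z * b z) = h z" using h by eventually_elim simp
  qed
  have [measurable]: "h \<in> borel_measurable circ" "v \<in> borel_measurable circ" "a \<in> borel_measurable circ" "b \<in> borel_measurable circ"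
    using hL2 vL2 a b by (auto intro: L2_measurable H2_measurable)
  have orth: "ip (\<lambda>z. h z - v z) s = 0" if s: "s \<in> K" for s
  proof -
    have sL2: "s \<in> L2" using s by (intro H2_imp_L2 model_space_H2)
    have [measurable]: "s \<in> borel_measurable circ" using sL2 by (rule L2_measurable)
    have "ip (\<lambda>z. h z - v z) s = (LINT z|circ. cnj (s z * cnj (\<theta> z * a z)) + cnj (z * (b z * s z)))"
      unfolding ip_def
    proof (rule integral_cong_AE)
      show "AE z in circ. (h z - v z) * cnj (s z) = cnj (s z * cnj (\<theta> z * a z)) + cnj (z * (b z * s z))"
        using h by eventually_elim (simp add: algebra_simps)
    qed measurable
    also have "\<dots> = (LINT z|circ. cnj (s z * cnj (\<theta> z * a z))) + (LINT z|circ. cnj (z * (b z * s z)))"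
    proof (rule Bochner_Integration.integral_add)
      show "integrable circ (\<lambda>z. cnj (s z * cnj (\<theta> z * a z)))"
        by (intro integrable_cnj L2_mult_integrable L2_cnj sL2 ta)
      show "integrable circ (\<lambda>z. cnj (z * (b z * s z)))"
        using integrable_cnj[OF L2_mult_integrable[OF H2_imp_L2[OF H2_z_mult[OF b]] sL2]] by (simp add: mult.assoc)
    qed
    also have "(LINT z|circ. cnj (s z * cnj (\<theta> z * a z))) = cnj (ip s (\<lambda>z. \<theta> z * a z))"
      unfolding ip_def by (rule Bochner_Integration.integral_cnj)
    also have "(LINT z|circ. cnj (z * (b z * s z))) = cnj (LINT z|circ. z * (b z * s z))"
      by (rule Bochner_Integration.integral_cnj)
    also have "(LINT z|circ. z * (b z * s z)) = 0"
      by (rule integral_H2_z_mult[OF b model_space_H2[OF s]])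
    also have "ip s (\<lambda>z. \<theta> z * a z) = 0" using s a by (simp add: model_space_def)
    finally show ?thesis by simp
  qed
  define p where "p = oproj K h"
  have p: "p \<in> K \<and> (\<forall>s\<in>K. ip (\<lambda>z. h z - p z) s = 0)"
    unfolding p_def oproj_def by (rule someI[of _ v]) (use v orth in blast)
  then show "oproj K h \<in> K" by (simp add: p_def)
  have pL2: "p \<in> L2" using p by (intro H2_imp_L2 model_space_H2) blast
  \<comment> \<open>The chosen projection and \<open>v\<close> differ by an element of the model
    space that is orthogonal to itself.\<close>
  define e where "e = (\<lambda>z. p z - v z)"
  have "e \<in> K"
    unfolding model_space_iff e_def
  proof
    show "(\<lambda>z. p z - v z) \<in> H2" using p v by (intro H2_diff model_space_H2) auto
    have "(\<lambda>z. \<theta> z * cnj z * cnj (p z) - \<theta> z * cnj z * cnj (v z)) \<in> H2"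
      using p v by (intro H2_diff) (auto simp: model_space_iff)
    then show "(\<lambda>z. \<theta> z * cnj z * cnj (p z - v z)) \<in> H2" by (simp add: algebra_simps)
  qed
  then have eL2: "e \<in> L2" by (intro H2_imp_L2 model_space_H2)
  have "ip e e = ip (\<lambda>z. (h z - v z) - (h z - p z)) e" by (simp add: e_def)
  also have "\<dots> = ip (\<lambda>z. h z - v z) e - ip (\<lambda>z. h z - p z) e"
    by (intro ip_diff_left L2_diff hL2 vL2 pL2 eL2)
  also have "\<dots> = 0" using orth p \<open>e \<in> K\<close> by simp
  finally have "AE z in circ. e z = 0" by (rule ip_zero_imp_AE[OF eL2])
  then show "AE z in circ. oproj K h z = v z" by eventually_elim (simp add: e_def p_def)
qed

text \<open>Existence of the projection: split \<open>h\<close>, then split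
  \<open>cnj \<theta>\<close> times its analytic part \<open>p\<close>.\<close>

lemma oproj_in_model_space:
  assumes h: "h \<in> L2"
  shows "oproj K h \<in> K"
proof -
  obtain p q where pq: "p \<in> H2" "q \<in> H2" "AE z in circ. h z = p z + cnj (z * q z)"
    using L2_split[OF h] .
  obtain a b where ab: "a \<in> H2" "b \<in> H2" "AE z in circ. cnj (\<theta> z) * p z = a z + cnj (z * b z)"
    using L2_split[OF cnj_theta_mult_L2[OF H2_imp_L2[OF pq(1)]]] .
  \<comment> \<open>On the circle \<open>v\<close> equals \<open>\<theta> * cnj (z * b)\<close>, so
    its flip is \<open>b\<close>.\<close>
  define v where "v = (\<lambda>z. p z - \<theta> z * a z)"
  have "v \<in> K"
    unfolding model_space_iff
  proof
    show "v \<in> H2" unfolding v_def by (intro H2_diff pq theta_mult_H2 ab)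
    show "(\<lambda>z. \<theta> z * cnj z * cnj (v z)) \<in> H2"
    proof (rule H2_cong_AE[OF ab(2)])
      show "AE z in circ. b z = \<theta> z * cnj z * cnj (v z)"
        using ab(3) AE_unit
      proof eventually_elim
        case (elim z)
        have "p z = (\<theta> z * cnj (\<theta> z)) * p z" using elim by simp
        also have "\<dots> = \<theta> z * (a z + cnj (z * b z))" unfolding elim(1)[symmetric] by simp
        finally have "v z = \<theta> z * cnj (z * b z)" by (simp add: v_def algebra_simps)
        then have "\<theta> z * cnj z * cnj (v z) = (\<theta> z * cnj (\<theta> z)) * (z * cnj z) * b z" by simp
        then show ?case using elim(2) by simp
      qed
    qed
  qed
  moreover have "AE z in circ. h z = v z + \<theta> z * a z + cnj (z * q z)"
    using pq(3) by eventually_elim (simp add: v_def)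
  ultimately show ?thesis using oproj_model_space(2) ab(1) pq(2) by blast
qed

lemma trunc_hankel_zero_iff:
  assumes "(\<lambda>z. f z * v z) \<in> L2"
  shows "(AE z in circ. trunc_hankel \<Theta> f v z = 0) \<longleftrightarrow> (\<lambda>z. f z * v z) \<in> K"
proof
  assume "AE z in circ. trunc_hankel \<Theta> f v z = 0"
  then have "AE z in circ. oproj K (\<lambda>z. f z * v z) z = f z * v z"
    by eventually_elim (simp add: trunc_hankel_def)
  then show "(\<lambda>z. f z * v z) \<in> K" by (rule model_space_cong_AE[OF oproj_in_model_space[OF assms]])
next
  assume "(\<lambda>z. f z * v z) \<in> K"
  then have "AE z in circ. oproj K (\<lambda>z. f z * v z) z = f z * v z"
    by (rule oproj_model_space(1)[where a = "\<lambda>_. 0" and b = "\<lambda>_. 0"]) (simp_all add: H2_const)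
  then show "AE z in circ. trunc_hankel \<Theta> f v z = 0"
    by eventually_elim (simp add: trunc_hankel_def)
qed

section \<open>The product on reproducing kernels\<close>

lemma model_space_flip_H2: "h \<in> K \<Longrightarrow> (\<lambda>z. \<theta> z * cnj (h z)) \<in> H2"
  using model_space_imp_plus by (simp add: model_space_plus_iff)

text \<open>\<open>(1 - cnj w * z) * A\<^sub>g k\<^sub>w\<close> for \<open>g = g1 + cnj g2\<close>, see \<open>toeplitz_kernel\<close>.\<close>

definition kernel_numerator :: "(complex \<Rightarrow> complex) \<Rightarrow> (complex \<Rightarrow> complex) \<Rightarrow> complex \<Rightarrow> complex \<Rightarrow> complex" where
  "kernel_numerator g1 g2 w z = g1 z + cnj (disk_value g2 w)
     - cnj (disk_value (\<lambda>z. \<theta> z * cnj (g1 z)) w) * \<theta> z - cnj (\<Theta> w) * (\<theta> z * cnj (g2 z))"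

text \<open>The product \<open>(g1 + cnj g2) * (1 - cnj (\<Theta> w) * \<theta>)\<close> is sorted
  into the three kinds of terms of \<open>oproj_model_space\<close> before division by
  \<open>1 - cnj w * z\<close>. The values \<open>x\<close> and \<open>y\<close> at \<open>w\<close>
  are the corrections that turn both \<open>?b\<close> and the flip of \<open>?v\<close> into
  difference quotients at \<open>w\<close>.\<close>

lemma toeplitz_kernel:
  assumes g1: "g1 \<in> K" and g2: "g2 \<in> K" and g: "AE z in circ. g z = g1 z + cnj (g2 z)" and w: "norm w < 1"
  shows "AE z in circ. trunc_toeplitz \<Theta> g (model_kernel \<Theta> w) z = kernel_numerator g1 g2 w z / (1 - cnj w * z)"
proof -
  define G1 where "G1 = (\<lambda>z. \<theta> z * cnj (g1 z))"
  define N where "N = kernel_numerator g1 g2 w"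
  define x y where "x = disk_value G1 w" and "y = disk_value g2 w"
  have N: "N z = g1 z + cnj y - cnj x * \<theta> z - cnj (\<Theta> w) * (\<theta> z * cnj (g2 z))" for z
    by (simp add: N_def kernel_numerator_def G1_def x_def y_def)
  have G1: "G1 \<in> H2" unfolding G1_def by (rule model_space_flip_H2[OF g1])
  have NH: "N \<in> H2"
    unfolding N by (intro H2_add H2_diff H2_cmult H2_const theta_H2 model_space_flip_H2 g2 model_space_H2[OF g1])
  let ?v = "\<lambda>z. N z / (1 - cnj w * z)"
  let ?a = "\<lambda>z. (cnj x - cnj (\<Theta> w) * g1 z) / (1 - cnj w * z)"
  let ?b = "\<lambda>z. (g2 z - y) / (z - w)"
  have "AE z in circ. oproj K (\<lambda>z. g z * model_kernel \<Theta> w z) z = ?v z"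
  proof (rule oproj_model_space(1)[where a = ?a and b = ?b])
    show "?v \<in> K"
      unfolding model_space_iff
    proof
      show "?v \<in> H2" by (rule H2_divide_kernel[OF NH w])
      show "(\<lambda>z. \<theta> z * cnj z * cnj (?v z)) \<in> H2"
      proof (rule H2_cong_AE)
        \<comment> \<open>The two contributions \<open>y * \<Theta> w\<close> cancel, so the sum has
          numerator \<open>G1 - x + y * \<theta> - \<Theta> w * g2\<close>.\<close>
        show "(\<lambda>z. (G1 z - x) / (z - w) + y * ((\<theta> z - \<Theta> w) / (z - w)) - \<Theta> w * ((g2 z - y) / (z - w))) \<in> H2"
          using H2_difference_quotient[OF G1 w] H2_difference_quotient[OF theta_H2 w]
            H2_difference_quotient[OF model_space_H2[OF g2] w]
          by (intro H2_add H2_diff H2_cmult) (simp_all add: x_def y_def disk_value_theta[OF w])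
        show "AE z in circ. (G1 z - x) / (z - w) + y * ((\<theta> z - \<Theta> w) / (z - w)) - \<Theta> w * ((g2 z - y) / (z - w))
            = \<theta> z * cnj z * cnj (?v z)"
          using AE_unit AE_circ_neq[OF w]
        proof eventually_elim
          case (elim z)
          have "\<theta> z * cnj z * cnj (?v z) = \<theta> z * cnj (N z) * (cnj z / cnj (1 - cnj w * z))"
            by (simp only: complex_cnj_divide) (simp only: times_divide_eq_right times_divide_eq_left mult_ac)
          also have "\<dots> = \<theta> z * cnj (N z) * (1 / (z - w))"
            using unit_circle_divide elim by metis
          also have "\<theta> z * cnj (N z) = G1 z + \<theta> z * y - x * (\<theta> z * cnj (\<theta> z)) - \<Theta> w * (\<theta> z * cnj (\<theta> z)) * g2 z"
            by (simp add: N G1_def algebra_simps)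
          finally have "\<theta> z * cnj z * cnj (?v z) = (G1 z + \<theta> z * y - x - \<Theta> w * g2 z) / (z - w)"
            using elim by simp
          then show ?case by (simp add: diff_divide_distrib add_divide_distrib algebra_simps)
        qed
      qed
    qed
    show "?a \<in> H2"
      by (intro H2_divide_kernel[OF _ w] H2_diff H2_const H2_cmult model_space_H2[OF g1])
    show "?b \<in> H2"
      unfolding y_def by (rule H2_difference_quotient[OF model_space_H2[OF g2] w])
    show "AE z in circ. g z * model_kernel \<Theta> w z = ?v z + \<theta> z * ?a z + cnj (z * ?b z)"
      using g AE_unit AE_circ_neq[OF w] AE_circ_norm
    proof eventually_elim
      case (elim z)
      have nz: "1 - cnj w * z \<noteq> 0" using norm_circle_diff_ge(2)[OF elim(4), of w] w by auto
      have "cnj z / cnj (1 - cnj w * z) = 1 / (z - w)" using unit_circle_divide elim by metis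
      then have "z / (1 - cnj w * z) = 1 / cnj (z - w)"
        by (metis complex_cnj_cnj complex_cnj_divide complex_cnj_one)
      then have "cnj (z * ?b z) = cnj z * (z / (1 - cnj w * z)) * (cnj (g2 z) - cnj y)"
        by simp
      also have "\<dots> = (z * cnj z) * ((cnj (g2 z) - cnj y) / (1 - cnj w * z))" by simp
      finally have b: "cnj (z * ?b z) = (cnj (g2 z) - cnj y) / (1 - cnj w * z)" using elim by simp
      have "(1 - cnj w * z) * (g z * model_kernel \<Theta> w z)
          = (g1 z + cnj (g2 z)) * (1 - cnj (\<Theta> w) * \<theta> z)"
        unfolding model_kernel_def elim(1) using nz by simp
      also have "\<dots> = N z + \<theta> z * (cnj x - cnj (\<Theta> w) * g1 z) + (cnj (g2 z) - cnj y)"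
        by (simp add: N algebra_simps)
      also have "\<dots> = (1 - cnj w * z) * (?v z + \<theta> z * ?a z + (cnj (g2 z) - cnj y) / (1 - cnj w * z))"
        using nz by (simp add: distrib_left)
      finally show ?case unfolding b using nz by simp
    qed
  qed
  then show ?thesis by (simp add: trunc_toeplitz_def N_def)
qed

text \<open>The flip of the reproducing kernel is the difference quotient of \<theta> at
  \<open>w\<close>.\<close>

lemma model_kernel_model_space:
  assumes w: "norm w < 1"
  shows "model_kernel \<Theta> w \<in> K"
  unfolding model_space_iff
proof
  show "model_kernel \<Theta> w \<in> H2"
    unfolding model_kernel_def by (intro H2_divide_kernel[OF _ w] H2_diff H2_const H2_cmult theta_H2)
  show "(\<lambda>z. \<theta> z * cnj z * cnj (model_kernel \<Theta> w z)) \<in> H2"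
  proof (rule H2_cong_AE)
    show "(\<lambda>z. (\<theta> z - \<Theta> w) / (z - w)) \<in> H2"
      using H2_difference_quotient[OF theta_H2 w] by (simp add: disk_value_theta[OF w])
    show "AE z in circ. (\<theta> z - \<Theta> w) / (z - w) = \<theta> z * cnj z * cnj (model_kernel \<Theta> w z)"
      using AE_unit AE_circ_neq[OF w]
    proof eventually_elim
      case (elim z)
      have "\<theta> z * cnj z * cnj (model_kernel \<Theta> w z)
          = \<theta> z * cnj (1 - cnj (\<Theta> w) * \<theta> z) * (cnj z / cnj (1 - cnj w * z))"
        by (simp only: model_kernel_def complex_cnj_divide) (simp only: times_divide_eq_right times_divide_eq_left mult_ac)
      also have "\<dots> = (\<theta> z - \<Theta> w * (\<theta> z * cnj (\<theta> z))) * (1 / (z - w))"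
        using unit_circle_divide elim by (metis (no_types, lifting) complex_cnj_cnj complex_cnj_diff complex_cnj_mult
            complex_cnj_one mult.left_commute mult.right_neutral right_diff_distrib)
      finally show ?case using elim by simp
    qed
  qed
qed

lemma model_kernel_Hinf:
  assumes w: "norm w < 1"
  shows "model_kernel \<Theta> w \<in> Hinf"
proof -
  have hol: "\<Theta> holomorphic_on ball 0 1" and bv: "has_boundary_values \<Theta> \<theta>"
    using inner by (auto simp: inner_function_def)
  obtain B where B: "\<And>z. norm z < 1 \<Longrightarrow> norm (\<Theta> z) \<le> B"
    using inner unfolding inner_function_def bounded_iff by (metis image_eqI mem_ball_0)
  define F where "F = (\<lambda>z. (1 - cnj (\<Theta> w) * \<Theta> z) / (1 - cnj w * z))"
  have ge: "1 - norm w \<le> norm (1 - cnj w * z)" if "norm z < 1" for z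
  proof -
    have "norm (cnj w * z) \<le> norm w * 1" unfolding norm_mult using that by (intro mult_mono) auto
    then show ?thesis using norm_triangle_ineq2[of 1 "cnj w * z"] by simp
  qed
  then have nz: "1 - cnj w * z \<noteq> 0" if "norm z < 1" for z
    using that w by fastforce
  have "F holomorphic_on ball 0 1"
    unfolding F_def using nz by (intro holomorphic_intros hol) auto
  moreover have "bounded (F ` ball 0 1)"
    unfolding bounded_iff
  proof (intro exI ballI)
    fix u assume "u \<in> F ` ball 0 1"
    then obtain z where z: "norm z < 1" "u = F z" by auto
    have "norm (1 - cnj (\<Theta> w) * \<Theta> z) \<le> 1 + norm (\<Theta> w) * B"
      using norm_triangle_ineq4[of 1 "cnj (\<Theta> w) * \<Theta> z"] mult_left_mono[OF B[OF z(1)], of "norm (\<Theta> w)"]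
      by (simp add: norm_mult)
    then show "norm u \<le> (1 + norm (\<Theta> w) * B) / (1 - norm w)"
      unfolding z(2) F_def norm_divide using ge[OF z(1)] w norm_ge_zero
      by (intro frac_le) (auto intro: order_trans[OF norm_ge_zero])
  qed
  moreover have "has_boundary_values F (model_kernel \<Theta> w)"
    using bv AE_circ_norm unfolding has_boundary_values_def
  proof eventually_elim
    case (elim z)
    have "1 - cnj w * (of_real 1 * z) \<noteq> 0" using norm_circle_diff_ge(2)[OF elim(2), of w] w by auto
    then have "((\<lambda>r. (1 - cnj (\<Theta> w) * \<Theta> (of_real r * z)) / (1 - cnj w * (of_real r * z)))
        \<longlongrightarrow> (1 - cnj (\<Theta> w) * \<theta> z) / (1 - cnj w * (of_real 1 * z))) (at_left 1)"
      by (intro tendsto_intros elim(1)) auto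
    then show ?case by (simp add: F_def model_kernel_def)
  qed
  moreover have "model_kernel \<Theta> w \<in> borel_measurable circ"
    using model_space_H2[OF model_kernel_model_space[OF w]] by (rule H2_measurable)
  ultimately show ?thesis unfolding Hinf_def by blast
qed

text \<open>If \<open>c\<close> is the flip of \<open>v\<close>, then
  \<open>n = v - cnj w * z * v\<close> and \<open>\<theta> * cnj n = z * c - w * c\<close>, both
  analytic.\<close>

lemma model_space_kernel_numerator:
  assumes v: "v \<in> K" "AE z in circ. v z = n z / (1 - cnj w * z)" and w: "norm w < 1"
  shows "n \<in> model_space_plus \<Theta>"
  unfolding model_space_plus_iff
proof
  let ?c = "\<lambda>z. \<theta> z * cnj z * cnj (v z)"
  have c: "?c \<in> H2" using v by (simp add: model_space_iff)
  have eq: "AE z in circ. (1 - cnj w * z) * v z = n z"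
    using v(2) AE_circ_norm
  proof eventually_elim
    case (elim z)
    then show ?case using norm_circle_diff_ge(2)[OF elim(2), of w] w by auto
  qed
  show "n \<in> H2"
  proof (rule H2_cong_AE)
    show "(\<lambda>z. v z - cnj w * (z * v z)) \<in> H2"
      by (intro H2_diff H2_cmult H2_z_mult model_space_H2 v)
    show "AE z in circ. v z - cnj w * (z * v z) = n z"
      using eq by eventually_elim (simp add: algebra_simps)
  qed
  show "(\<lambda>z. \<theta> z * cnj (n z)) \<in> H2"
  proof (rule H2_cong_AE)
    show "(\<lambda>z. z * ?c z - w * ?c z) \<in> H2"
      by (intro H2_diff H2_cmult H2_z_mult c)
    show "AE z in circ. z * ?c z - w * ?c z = \<theta> z * cnj (n z)"
      using eq AE_unit
    proof eventually_elim
      case (elim z)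
      have "z * ?c z = (z * cnj z) * (\<theta> z * cnj (v z))" by (simp only: mult_ac)
      also have "\<dots> = \<theta> z * cnj (v z)" using elim by simp
      finally show ?case unfolding elim(1)[symmetric] by (simp add: algebra_simps)
    qed
  qed
qed

section \<open>Membership tests and linear relations\<close>

lemma flip_L2:
  assumes h: "h \<in> L2"
  shows "(\<lambda>z. \<theta> z * cnj z * cnj (h z)) \<in> L2"
proof (rule L2_cong_AE)
  show "(\<lambda>z. \<theta> z * (z powi (-1) * cnj (h z))) \<in> L2"
    by (intro theta_mult_L2 L2_powi_mult L2_cnj h)
  show "AE z in circ. \<theta> z * (z powi (-1) * cnj (h z)) = \<theta> z * cnj z * cnj (h z)"
    using AE_circ_unit by eventually_elim (simp add: inverse_unique)
qed

text \<open>The test for \<open>f * A_g u\<close>: its analyticity comes from products of functions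
  in \<open>H2\<close>, hence only in the sense of \<open>H1\<close>, while the domain provides
  \<open>L2\<close>.\<close>

lemma model_spaceI_H1:
  assumes "h \<in> L2" "h \<in> H1" "(\<lambda>z. \<theta> z * cnj z * cnj (h z)) \<in> H1"
  shows "h \<in> K"
  using assms flip_L2 by (simp add: model_space_iff H2_iff)

lemma model_space_plus_cong_AE:
  assumes "h \<in> model_space_plus \<Theta>" "AE z in circ. h z = k z"
  shows "k \<in> model_space_plus \<Theta>"
  unfolding model_space_plus_iff
proof
  show "k \<in> H2" by (rule H2_cong_AE[OF _ assms(2)]) (use assms(1) in \<open>simp add: model_space_plus_iff\<close>)
  have "AE z in circ. \<theta> z * cnj (h z) = \<theta> z * cnj (k z)"
    using assms(2) by eventually_elim simp
  then show "(\<lambda>z. \<theta> z * cnj (k z)) \<in> H2"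
    by (rule H2_cong_AE[rotated]) (use assms(1) in \<open>simp add: model_space_plus_iff\<close>)
qed

lemma model_space_plus_lincomb:
  assumes "h \<in> model_space_plus \<Theta>" "k \<in> model_space_plus \<Theta>"
  shows "(\<lambda>z. a * h z + b * k z) \<in> model_space_plus \<Theta>"
  unfolding model_space_plus_iff
proof
  show "(\<lambda>z. a * h z + b * k z) \<in> H2" using assms by (intro H2_add H2_cmult) (auto simp: model_space_plus_iff)
  have "(\<lambda>z. cnj a * (\<theta> z * cnj (h z)) + cnj b * (\<theta> z * cnj (k z))) \<in> H2"
    using assms by (intro H2_add H2_cmult) (auto simp: model_space_plus_iff)
  then show "(\<lambda>z. \<theta> z * cnj (a * h z + b * k z)) \<in> H2" by (simp add: algebra_simps)
qed

lemma model_space_plus_L2: "h \<in> model_space_plus \<Theta> \<Longrightarrow> h \<in> L2"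
  by (simp add: model_space_plus_iff H2_imp_L2)

text \<open>Turns a dependence between coefficient functions of \<open>w\<close> into an identity
  between functions on the circle.\<close>

lemma disk_value_relation:
  assumes h: "h \<in> H2" and k: "k \<in> H2"
    and z: "\<And>w. norm w < 1 \<Longrightarrow> a + b * disk_value h w + c * disk_value k w + d * \<Theta> w = 0"
  shows "AE z in circ. a + b * h z + c * k z + d * \<theta> z = 0"
proof -
  \<comment> \<open>The factors 1 give every sum the shape required by
    \<open>disk_value_lincomb\<close>.\<close>
  let ?F = "\<lambda>z. 1 * (1 * a + b * h z) + 1 * (c * k z + d * \<theta> z)"
  have "?F \<in> H2" by (intro H2_add H2_cmult H2_const h k theta_H2)
  moreover have "disk_value ?F w = 0" if w: "norm w < 1" for w
  proof -
    have "disk_value ?F w = 1 * disk_value (\<lambda>z. 1 * a + b * h z) w + 1 * disk_value (\<lambda>z. c * k z + d * \<theta> z) w"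
      by (rule disk_value_lincomb) (intro H2_add H2_cmult H2_const h k theta_H2 w)+
    also have "disk_value (\<lambda>z. 1 * a + b * h z) w = 1 * disk_value (\<lambda>z. a) w + b * disk_value h w"
      by (rule disk_value_lincomb[OF H2_const h w])
    also have "disk_value (\<lambda>z. c * k z + d * \<theta> z) w = c * disk_value k w + d * disk_value \<theta> w"
      by (rule disk_value_lincomb[OF k theta_H2 w])
    finally show ?thesis using z[OF w] by (simp add: disk_value_const disk_value_theta[OF w] add.assoc)
  qed
  ultimately have "AE z in circ. ?F z = 0" by (rule disk_value_zero_imp_AE)
  then show ?thesis by eventually_elim (simp add: algebra_simps)
qed

lemma disk_value_affine:
  assumes h: "h \<in> H2" and k: "k \<in> H2" and ae: "AE z in circ. h z = a + b * k z + d * \<theta> z" and w: "norm w < 1"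
  shows "disk_value h w = a + b * disk_value k w + d * \<Theta> w"
proof -
  have "disk_value h w = disk_value (\<lambda>z. 1 * (1 * a + b * k z) + d * \<theta> z) w"
    by (rule disk_value_cong_AE[OF h]) (use ae in simp)
  also have "\<dots> = 1 * disk_value (\<lambda>z. 1 * a + b * k z) w + d * disk_value \<theta> w"
    by (rule disk_value_lincomb) (intro H2_add H2_cmult H2_const k theta_H2 w)+
  also have "disk_value (\<lambda>z. 1 * a + b * k z) w = 1 * disk_value (\<lambda>z. a) w + b * disk_value k w"
    by (rule disk_value_lincomb[OF H2_const k w])
  finally show ?thesis by (simp add: disk_value_const disk_value_theta[OF w])
qed

lemma disk_value_zero: "AE z in circ. h z = 0 \<Longrightarrow> disk_value h w = 0"
proof -
  assume "AE z in circ. h z = 0"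
  then have "AE z in circ. 0 = h z" by eventually_elim simp
  from disk_value_cong_AE[OF H2_const this, of w] show ?thesis by (simp add: disk_value_const)
qed

text \<open>Non-constancy of \<Theta> enters here: passing to values in the disk, a nonzero
  \<open>d\<close> would give \<open>\<Theta> w = - a / d\<close> throughout.\<close>

lemma affine_theta_zero_imp:
  assumes "\<not> \<Theta> constant_on ball 0 1" and ae: "AE z in circ. a + d * \<theta> z = 0"
  shows "a = 0 \<and> d = 0"
proof -
  have "AE z in circ. 0 = a + 0 * 0 + d * \<theta> z" using ae by eventually_elim simp
  then have 0: "a + d * \<Theta> w = 0" if "norm w < 1" for w
    using disk_value_affine[where h = "\<lambda>_. 0" and k = "\<lambda>_. 0" and a = a and b = 0 and d = d, OF H2_const H2_const _ that]
    by (simp add: disk_value_const)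
  have "d = 0"
  proof (rule ccontr)
    assume "d \<noteq> 0"
    then have "\<Theta> w = - a / d" if "norm w < 1" for w
      using 0[OF that] by (simp add: field_simps add_eq_0_iff)
    then show False using assms(1) unfolding constant_on_def by auto
  qed
  then show ?thesis using 0[of 0] by simp
qed

lemma toeplitz_model_space:
  assumes "g \<in> L2" "u \<in> borel_measurable circ" "AE z in circ. norm (u z) \<le> B"
  shows "trunc_toeplitz \<Theta> g u \<in> K"
  unfolding trunc_toeplitz_def
  using oproj_in_model_space L2_bounded_mult[OF assms] by (simp add: mult.commute)

text \<open>Inserting the relation eliminates the coefficient \<open>disk_value g2 w\<close>. The
  terms \<open>\<beta> * \<Theta> 0 * cnj (\<Theta> w)\<close>, one from the value of g2 at
  \<open>w\<close> and one from \<open>\<theta> * cnj g2\<close>, cancel.\<close>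

lemma kernel_numerator_eq:
  assumes g1: "g1 \<in> K" and g2: "g2 \<in> K" and w: "norm w < 1"
    and ae: "AE z in circ. g2 z = cnj \<beta> + cnj \<alpha> * (\<theta> z * cnj (g1 z)) - cnj \<beta> * cnj (\<Theta> 0) * \<theta> z"
  shows "AE z in circ. kernel_numerator g1 g2 w z = (g1 z + \<beta>)
     + cnj (disk_value (\<lambda>z. \<theta> z * cnj (g1 z)) w) * (\<alpha> - \<theta> z) - cnj (\<Theta> w) * (\<beta> * \<theta> z + \<alpha> * g1 z)"
proof -
  have d: "disk_value g2 w = cnj \<beta> + cnj \<alpha> * disk_value (\<lambda>z. \<theta> z * cnj (g1 z)) w + (- cnj \<beta> * cnj (\<Theta> 0)) * \<Theta> w"
    by (rule disk_value_affine[OF model_space_H2[OF g2] model_space_flip_H2[OF g1] _ w]) (use ae in simp)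
  show ?thesis
    using ae AE_unit
  proof eventually_elim
    case (elim z)
    have "\<theta> z * cnj (g2 z) = \<beta> * \<theta> z + \<alpha> * (\<theta> z * cnj (\<theta> z)) * g1 z - \<beta> * \<Theta> 0 * (\<theta> z * cnj (\<theta> z))"
      unfolding elim(1) by (simp add: algebra_simps)
    then have e: "\<theta> z * cnj (g2 z) = \<beta> * \<theta> z + \<alpha> * g1 z - \<beta> * \<Theta> 0" using elim by simp
    show ?case unfolding kernel_numerator_def d e by (simp add: algebra_simps)
  qed
qed

text \<open>On kernels the domain condition concerns only the numerator, because
  \<open>1 / (1 - cnj w * z)\<close> is bounded. For general \<open>u\<close>, square integrability
  of \<open>f * A_g u\<close> is available as a premise since only elements of the domain are
  tested.\<close>

lemma hankel_toeplitz_zeroI: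
  assumes f: "f \<in> L2" and g1: "g1 \<in> K" and g2: "g2 \<in> K" and g: "AE z in circ. g z = g1 z + cnj (g2 z)"
    and L2: "\<And>w. norm w < 1 \<Longrightarrow> (\<lambda>z. f z * kernel_numerator g1 g2 w z) \<in> L2"
    and mem: "\<And>u B. u \<in> K \<Longrightarrow> AE z in circ. norm (u z) \<le> B \<Longrightarrow> (\<lambda>z. f z * trunc_toeplitz \<Theta> g u z) \<in> L2
       \<Longrightarrow> (\<lambda>z. f z * trunc_toeplitz \<Theta> g u z) \<in> K"
  shows "hankel_toeplitz_zero \<Theta> f g"
  unfolding hankel_toeplitz_zero_def
proof (intro conjI ballI)
  fix w :: complex assume "w \<in> ball 0 1"
  then have w: "norm w < 1" by simp
  have "(\<lambda>z. f z * trunc_toeplitz \<Theta> g (model_kernel \<Theta> w) z) \<in> L2"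
  proof (rule L2_cong_AE)
    show "(\<lambda>z. 1 / (1 - cnj w * z) * (f z * kernel_numerator g1 g2 w z)) \<in> L2"
      by (rule L2_bounded_mult[OF L2[OF w] _ AE_norm_inverse_le(2)[OF w]]) measurable
    show "AE z in circ. 1 / (1 - cnj w * z) * (f z * kernel_numerator g1 g2 w z) = f z * trunc_toeplitz \<Theta> g (model_kernel \<Theta> w) z"
      using toeplitz_kernel[OF g1 g2 g w] by eventually_elim simp
  qed
  then show "model_kernel \<Theta> w \<in> hankel_toeplitz_dom \<Theta> f g"
    using model_kernel_model_space[OF w] model_kernel_Hinf[OF w] by (simp add: hankel_toeplitz_dom_def)
next
  fix u assume u: "u \<in> hankel_toeplitz_dom \<Theta> f g"
  then have u1: "u \<in> K" "u \<in> Hinf" "(\<lambda>z. f z * trunc_toeplitz \<Theta> g u z) \<in> L2"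
    by (auto simp: hankel_toeplitz_dom_def)
  obtain F where "F holomorphic_on ball 0 1" "bounded (F ` ball 0 1)" "has_boundary_values F u"
    using u1(2) by (auto simp: Hinf_def)
  then obtain B where "AE z in circ. norm (u z) \<le> B"
    by (rule bounded_holomorphic_boundary_H2)
  then have "(\<lambda>z. f z * trunc_toeplitz \<Theta> g u z) \<in> K" using mem u1 by blast
  then show "AE z in circ. trunc_hankel \<Theta> f (trunc_toeplitz \<Theta> g u) z = 0"
    using trunc_hankel_zero_iff[OF u1(3)] by blast
qed

lemma hankel_toeplitz_zeroD:
  assumes zero: "hankel_toeplitz_zero \<Theta> f g"
    and g1: "g1 \<in> K" and g2: "g2 \<in> K" and g: "AE z in circ. g z = g1 z + cnj (g2 z)" and w: "norm w < 1"
  shows "(\<lambda>z. f z * kernel_numerator g1 g2 w z) \<in> model_space_plus \<Theta>"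
proof (rule model_space_kernel_numerator[OF _ _ w])
  have k: "model_kernel \<Theta> w \<in> hankel_toeplitz_dom \<Theta> f g"
    using zero w by (simp add: hankel_toeplitz_zero_def)
  then have "(\<lambda>z. f z * trunc_toeplitz \<Theta> g (model_kernel \<Theta> w) z) \<in> L2"
    by (simp add: hankel_toeplitz_dom_def)
  moreover have "AE z in circ. trunc_hankel \<Theta> f (trunc_toeplitz \<Theta> g (model_kernel \<Theta> w)) z = 0"
    using zero k by (simp add: hankel_toeplitz_zero_def)
  ultimately show "(\<lambda>z. f z * trunc_toeplitz \<Theta> g (model_kernel \<Theta> w) z) \<in> K"
    by (rule trunc_hankel_zero_iff[THEN iffD1])
  show "AE z in circ. f z * trunc_toeplitz \<Theta> g (model_kernel \<Theta> w) z = f z * kernel_numerator g1 g2 w z / (1 - cnj w * z)"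
    using toeplitz_kernel[OF g1 g2 g w] by eventually_elim simp
qed

lemma flip_bounded:
  assumes "AE z in circ. norm (u z) \<le> B"
  shows "AE z in circ. norm (\<theta> z * cnj z * cnj (u z)) \<le> B"
  using assms AE_theta_norm AE_circ_norm by eventually_elim (simp add: norm_mult)

text \<open>For \<open>g = 0\<close> and for constant \<open>f\<close>, where the domain consists of
  all bounded functions of the model space.\<close>

lemma hankel_toeplitz_zeroI_total:
  assumes mem: "\<And>u B. u \<in> K \<Longrightarrow> AE z in circ. norm (u z) \<le> B \<Longrightarrow> (\<lambda>z. f z * trunc_toeplitz \<Theta> g u z) \<in> K"
  shows "hankel_toeplitz_zero \<Theta> f g"
proof -
  have *: "(\<lambda>z. f z * trunc_toeplitz \<Theta> g u z) \<in> K" if u: "u \<in> K" "u \<in> Hinf" for u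
  proof -
    obtain F where "F holomorphic_on ball 0 1" "bounded (F ` ball 0 1)" "has_boundary_values F u"
      using u(2) by (auto simp: Hinf_def)
    then obtain B where "AE z in circ. norm (u z) \<le> B"
      by (rule bounded_holomorphic_boundary_H2)
    then show ?thesis using mem u(1) by blast
  qed
  then have **: "(\<lambda>z. f z * trunc_toeplitz \<Theta> g u z) \<in> L2" if u: "u \<in> K" "u \<in> Hinf" for u
    using that by (intro H2_imp_L2 model_space_H2)
  show ?thesis
    unfolding hankel_toeplitz_zero_def
  proof (intro conjI ballI)
    fix w :: complex assume "w \<in> ball 0 1"
    then have "model_kernel \<Theta> w \<in> K" "model_kernel \<Theta> w \<in> Hinf"
      using model_kernel_model_space model_kernel_Hinf by simp_all
    with ** show "model_kernel \<Theta> w \<in> hankel_toeplitz_dom \<Theta> f g" by (simp add: hankel_toeplitz_dom_def)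
  next
    fix u assume "u \<in> hankel_toeplitz_dom \<Theta> f g"
    then have u: "u \<in> K" "u \<in> Hinf" by (auto simp: hankel_toeplitz_dom_def)
    show "AE z in circ. trunc_hankel \<Theta> f (trunc_toeplitz \<Theta> g u) z = 0"
      using trunc_hankel_zero_iff[OF **[OF u]] *[OF u] by blast
  qed
qed

section \<open>Sufficiency of the four conditions\<close>

lemma hankel_toeplitz_zero_if_symbol_zero:
  assumes z: "AE z in circ. g z = 0"
  shows "hankel_toeplitz_zero \<Theta> f g"
proof (rule hankel_toeplitz_zeroI_total)
  fix u
  have K0: "(\<lambda>z. 0) \<in> K" by (simp add: model_space_iff H2_const)
  have "AE z in circ. oproj K (\<lambda>z. g z * u z) z = 0"
    by (rule oproj_model_space(1)[OF K0 H2_const[of 0] H2_const[of 0]]) (use z in eventually_elim, simp)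
  then have "AE z in circ. 0 = f z * trunc_toeplitz \<Theta> g u z"
    by eventually_elim (simp add: trunc_toeplitz_def)
  then show "(\<lambda>z. f z * trunc_toeplitz \<Theta> g u z) \<in> K" by (rule model_space_cong_AE[OF K0])
qed

lemma hankel_toeplitz_zero_if_const:
  assumes g: "g \<in> L2" and f: "AE z in circ. f z = c"
  shows "hankel_toeplitz_zero \<Theta> f g"
proof (rule hankel_toeplitz_zeroI_total)
  fix u B assume u: "u \<in> K" "AE z in circ. norm (u z) \<le> B"
  define t where "t = trunc_toeplitz \<Theta> g u"
  have t: "t \<in> K"
    unfolding t_def by (rule toeplitz_model_space[OF g H2_measurable[OF model_space_H2[OF u(1)]] u(2)])
  have "(\<lambda>z. c * t z) \<in> K"
    unfolding model_space_iff
  proof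
    show "(\<lambda>z. c * t z) \<in> H2" by (intro H2_cmult model_space_H2 t)
    have "(\<lambda>z. cnj c * (\<theta> z * cnj z * cnj (t z))) \<in> H2"
      using t by (intro H2_cmult) (simp add: model_space_iff)
    then show "(\<lambda>z. \<theta> z * cnj z * cnj (c * t z)) \<in> H2" by (simp add: mult_ac)
  qed
  moreover have "AE z in circ. c * t z = f z * t z" using f by eventually_elim simp
  ultimately show "(\<lambda>z. f z * trunc_toeplitz \<Theta> g u z) \<in> K"
    unfolding t_def by (rule model_space_cong_AE)
qed

text \<open>Since \<open>cnj g\<close> and \<open>g2\<close> are in \<open>H2\<close>, so is
  \<open>cnj g1\<close>; hence \<open>g1\<close> is constant and, by its value at 0, zero. Then
  \<open>A_g u\<close> is the analytic part \<open>v\<close> of \<open>u * cnj g2\<close>, with flip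
  \<open>g2 * u' - \<theta> * q\<close>. Multiplied by \<open>cnj f\<close>, the two terms become
  \<open>u'\<close> times \<open>cnj (f * g)\<close> and \<open>q\<close> times
  \<open>\<theta> * cnj f\<close>, whose analyticity is assumed.\<close>

lemma hankel_toeplitz_zero_if_coanalytic:
  assumes f: "f \<in> model_space_plus \<Theta>" and g1: "g1 \<in> K" "fcoeff g1 0 = 0" and g2: "g2 \<in> K"
    and g: "AE z in circ. g z = g1 z + cnj (g2 z)"
    and cg: "(\<lambda>z. cnj (g z)) \<in> H2" and cfg: "(\<lambda>z. cnj (f z * g z)) \<in> H2"
  shows "hankel_toeplitz_zero \<Theta> f g"
proof -
  note fH = f[unfolded model_space_plus_iff]
  have fL2: "f \<in> L2" using f by (rule model_space_plus_L2)
  have "(\<lambda>z. cnj (g1 z)) \<in> H2"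
  proof (rule H2_cong_AE)
    show "(\<lambda>z. cnj (g z) - g2 z) \<in> H2" by (intro H2_diff cg model_space_H2 g2)
    show "AE z in circ. cnj (g z) - g2 z = cnj (g1 z)" using g by eventually_elim simp
  qed
  then have g10: "AE z in circ. g1 z = 0"
    using H2_AE_eq_const[OF model_space_H2[OF g1(1)]] g1(2) by simp
  then have gg: "AE z in circ. g z = cnj (g2 z)" using g by eventually_elim simp
  have fg: "(\<lambda>z. f z * g z) \<in> L2" using L2_cnj[OF H2_imp_L2[OF cfg]] by simp
  have fg2: "(\<lambda>z. cnj (f z) * g2 z) \<in> H2"
    by (rule H2_cong_AE[OF cfg]) (use gg in \<open>eventually_elim, simp\<close>)
  show ?thesis
  proof (rule hankel_toeplitz_zeroI[OF fL2 g1(1) g2 g])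
    fix w :: complex assume w: "norm w < 1"
    show "(\<lambda>z. f z * kernel_numerator g1 g2 w z) \<in> L2"
    proof (rule L2_cong_AE)
      show "(\<lambda>z. cnj (disk_value g2 w) * f z - cnj (\<Theta> w) * (\<theta> z * (f z * g z))) \<in> L2"
        by (intro L2_diff L2_cmult theta_mult_L2 fL2 fg)
      have d: "disk_value (\<lambda>z. \<theta> z * cnj (g1 z)) w = 0"
        by (rule disk_value_zero) (use g10 in \<open>eventually_elim, simp\<close>)
      show "AE z in circ. cnj (disk_value g2 w) * f z - cnj (\<Theta> w) * (\<theta> z * (f z * g z)) = f z * kernel_numerator g1 g2 w z"
        using gg g10
      proof eventually_elim
        case (elim z)
        show ?case unfolding kernel_numerator_def d elim by (simp add: algebra_simps)
      qed
    qed
  next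
    fix u B assume u: "u \<in> K" "AE z in circ. norm (u z) \<le> B"
      and ft: "(\<lambda>z. f z * trunc_toeplitz \<Theta> g u z) \<in> L2"
    define u' where "u' = (\<lambda>z. \<theta> z * cnj z * cnj (u z))"
    have u': "u' \<in> H2" "AE z in circ. norm (u' z) \<le> B"
      using u flip_bounded by (auto simp: u'_def model_space_iff)
    have "(\<lambda>z. u z * cnj (g2 z)) \<in> L2"
      by (rule L2_bounded_mult[OF _ _ u(2)]) (intro L2_cnj H2_imp_L2 model_space_H2 g2, intro H2_measurable model_space_H2 u)
    then obtain v q where vq: "v \<in> H2" "q \<in> H2" "AE z in circ. u z * cnj (g2 z) = v z + cnj (z * q z)"
      by (rule L2_split)
    have cv: "AE z in circ. g2 z * u' z - \<theta> z * q z = \<theta> z * cnj z * cnj (v z)"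
      using vq(3) AE_unit
    proof eventually_elim
      case (elim z)
      have v: "cnj (v z) = cnj (u z) * g2 z - z * q z"
        using arg_cong[OF elim(1), of cnj] by simp
      have "\<theta> z * cnj z * cnj (v z) = g2 z * u' z - \<theta> z * (z * cnj z) * q z"
        unfolding v u'_def by (simp add: algebra_simps)
      then show ?case using elim by simp
    qed
    have "v \<in> K"
      unfolding model_space_iff
    proof
      have "(\<lambda>z. g2 z * u' z - \<theta> z * q z) \<in> H2"
        using H2_bounded_mult[OF u' model_space_H2[OF g2]] by (intro H2_diff theta_mult_H2 vq) (simp add: mult.commute)
      then show "(\<lambda>z. \<theta> z * cnj z * cnj (v z)) \<in> H2" by (rule H2_cong_AE[OF _ cv])
    qed (rule vq)
    then have "AE z in circ. oproj K (\<lambda>z. g z * u z) z = v z"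
      by (rule oproj_model_space(1)[OF _ H2_const[of 0] vq(2)]) (use vq(3) gg in \<open>eventually_elim, simp add: mult.commute\<close>)
    then have tv: "AE z in circ. trunc_toeplitz \<Theta> g u z = v z" by (simp add: trunc_toeplitz_def)
    have "(\<lambda>z. f z * v z) \<in> K"
    proof (rule model_spaceI_H1)
      show "(\<lambda>z. f z * v z) \<in> L2"
        by (rule L2_cong_AE[OF ft]) (use tv in \<open>eventually_elim, simp\<close>)
      show "(\<lambda>z. f z * v z) \<in> H1" using fH vq by (intro H2_mult_H1) auto
      show "(\<lambda>z. \<theta> z * cnj z * cnj (f z * v z)) \<in> H1"
      proof (rule H1_cong_AE)
        show "(\<lambda>z. u' z * (cnj (f z) * g2 z) - (\<theta> z * cnj (f z)) * q z) \<in> H1"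
          using fH by (intro H1_diff H2_mult_H1 fg2 u' vq) auto
        show "AE z in circ. u' z * (cnj (f z) * g2 z) - (\<theta> z * cnj (f z)) * q z = \<theta> z * cnj z * cnj (f z * v z)"
          using cv
        proof eventually_elim
          case (elim z)
          have "\<theta> z * cnj z * cnj (f z * v z) = cnj (f z) * (\<theta> z * cnj z * cnj (v z))" by simp
          also have "\<dots> = cnj (f z) * (g2 z * u' z - \<theta> z * q z)" unfolding elim ..
          finally show ?case by (simp add: algebra_simps)
        qed
      qed
    qed
    then show "(\<lambda>z. f z * trunc_toeplitz \<Theta> g u z) \<in> K"
      by (rule model_space_cong_AE) (use tv in \<open>eventually_elim, simp\<close>)
  qed
qed

text \<open>The relation allows \<open>A_g u\<close> to be written as
  \<open>(g1 + \<beta>) * u + (\<alpha> - \<theta>) * p\<close> with a single auxiliary analytic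
  function \<open>p\<close>. Multiplication by \<open>f\<close> then meets exactly the two products
  in (b), and the flip meets (c).\<close>

lemma hankel_toeplitz_zero_if_relation:
  assumes f: "f \<in> L2" and g1: "g1 \<in> K" and g2: "g2 \<in> K"
    and g: "AE z in circ. g z = g1 z + cnj (g2 z)"
    and a: "AE z in circ. g z = g1 z + \<alpha> * cnj (\<theta> z) * g1 z + \<beta> * (1 - \<Theta> 0 * cnj (\<theta> z))"
    and b1: "(\<lambda>z. f z * (g1 z + \<beta>)) \<in> model_space_plus \<Theta>"
    and b2: "(\<lambda>z. f z * (\<alpha> - \<theta> z)) \<in> model_space_plus \<Theta>"
    and c: "(\<lambda>z. cnj \<beta> * cnj (f z) + cnj \<alpha> * \<theta> z * cnj (f z * g1 z)) \<in> H2"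
  shows "hankel_toeplitz_zero \<Theta> f g"
proof (rule hankel_toeplitz_zeroI[OF f g1 g2 g])
  fix w :: complex assume w: "norm w < 1"
  define x where "x = cnj (disk_value (\<lambda>z. \<theta> z * cnj (g1 z)) w)"
  have "AE z in circ. g2 z = cnj \<beta> + cnj \<alpha> * (\<theta> z * cnj (g1 z)) - cnj \<beta> * cnj (\<Theta> 0) * \<theta> z"
    using g a
  proof eventually_elim
    case (elim z)
    then have "cnj (g2 z) = \<alpha> * cnj (\<theta> z) * g1 z + \<beta> * (1 - \<Theta> 0 * cnj (\<theta> z))" by simp
    from arg_cong[OF this, of cnj] show ?case by (simp add: algebra_simps)
  qed
  note N = kernel_numerator_eq[OF g1 g2 w this, folded x_def]
  show "(\<lambda>z. f z * kernel_numerator g1 g2 w z) \<in> L2"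
  proof (rule L2_cong_AE)
    \<comment> \<open>Uses \<open>\<beta> * \<theta> + \<alpha> * g1 = \<alpha> * (g1 + \<beta>) -
      \<beta> * (\<alpha> - \<theta>)\<close>.\<close>
    show "(\<lambda>z. (1 - cnj (\<Theta> w) * \<alpha>) * (f z * (g1 z + \<beta>)) + (x + cnj (\<Theta> w) * \<beta>) * (f z * (\<alpha> - \<theta> z))) \<in> L2"
      by (intro L2_add L2_cmult model_space_plus_L2 b1 b2)
    show "AE z in circ. (1 - cnj (\<Theta> w) * \<alpha>) * (f z * (g1 z + \<beta>)) + (x + cnj (\<Theta> w) * \<beta>) * (f z * (\<alpha> - \<theta> z))
        = f z * kernel_numerator g1 g2 w z"
      using N
    proof eventually_elim
      case (elim z)
      show ?case unfolding elim by (simp add: algebra_simps)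
    qed
  qed
next
  fix u B assume u: "u \<in> K" "AE z in circ. norm (u z) \<le> B"
    and ft: "(\<lambda>z. f z * trunc_toeplitz \<Theta> g u z) \<in> L2"
  define u' where "u' = (\<lambda>z. \<theta> z * cnj z * cnj (u z))"
  define G1 where "G1 = (\<lambda>z. \<theta> z * cnj (g1 z))"
  have G1: "G1 \<in> H2" unfolding G1_def by (rule model_space_flip_H2[OF g1])
  have u': "u' \<in> H2" "AE z in circ. norm (u' z) \<le> B"
    using u flip_bounded by (auto simp: u'_def model_space_iff)
  have uH: "u \<in> H2" using u by (intro model_space_H2)
  have "(\<lambda>z. cnj (\<theta> z) * (u z * g1 z)) \<in> L2"
    by (intro cnj_theta_mult_L2 L2_bounded_mult[OF _ _ u(2)] H2_imp_L2 model_space_H2 g1 H2_measurable uH)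
  then obtain p q where pq: "p \<in> H2" "q \<in> H2" "AE z in circ. cnj (\<theta> z) * (u z * g1 z) = p z + cnj (z * q z)"
    by (rule L2_split)
  \<comment> \<open>\<open>\<theta> * p\<close> is the part of \<open>g1 * u\<close> in
    \<open>\<theta> * H2\<close>, and \<open>p\<close> is the projection of
    \<open>cnj \<theta> * g1 * u\<close>. The term with \<open>\<Theta> 0\<close> contributes
    nothing, since \<open>cnj \<theta> * u = cnj (z * u')\<close> is orthogonal to
    \<open>H2\<close>.\<close>
  define v where "v = (\<lambda>z. (g1 z + \<beta>) * u z + (\<alpha> - \<theta> z) * p z)"
  have cv: "AE z in circ. \<theta> z * cnj z * cnj (v z) = cnj \<beta> * u' z + cnj \<alpha> * (u' z * G1 z) - cnj \<alpha> * (\<theta> z * q z) + q z"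
    using pq(3) AE_unit
  proof eventually_elim
    case (elim z)
    define t T Z where "t = \<theta> z" "T = cnj (\<theta> z)" "Z = cnj z"
    have p: "cnj (p z) = t * (cnj (u z) * cnj (g1 z)) - z * q z"
      using arg_cong[OF elim(1), of cnj] by (simp add: t_T_Z_def)
    have "z * Z = 1" "t * T = 1" using elim by (simp_all add: t_T_Z_def)
    moreover have "\<theta> z * cnj z * cnj (v z) = t * Z * ((cnj (g1 z) + cnj \<beta>) * cnj (u z)
        + (cnj \<alpha> - T) * (t * (cnj (u z) * cnj (g1 z)) - z * q z))"
      by (simp add: v_def p t_T_Z_def)
    moreover have "u' z = t * Z * cnj (u z)" "G1 z = t * cnj (g1 z)" "\<theta> z = t"
      by (simp_all add: u'_def G1_def t_T_Z_def)
    ultimately show ?case by algebra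
  qed
  have vK: "v \<in> K"
    unfolding model_space_iff
  proof
    have "(\<lambda>z. u z * g1 z + \<beta> * u z + \<alpha> * p z - \<theta> z * p z) \<in> H2"
      by (intro H2_add H2_diff H2_cmult theta_mult_H2 pq uH H2_bounded_mult[OF uH u(2)] model_space_H2 g1)
    then show "v \<in> H2" by (simp add: v_def algebra_simps)
    show "(\<lambda>z. \<theta> z * cnj z * cnj (v z)) \<in> H2"
    proof (rule H2_cong_AE)
      show "(\<lambda>z. cnj \<beta> * u' z + cnj \<alpha> * (u' z * G1 z) - cnj \<alpha> * (\<theta> z * q z) + q z) \<in> H2"
        by (intro H2_add H2_diff H2_cmult theta_mult_H2 pq u' H2_bounded_mult[OF u'] G1)
    qed (use cv in \<open>eventually_elim, simp\<close>)
  qed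
  have "AE z in circ. oproj K (\<lambda>z. g z * u z) z = v z"
  proof (rule oproj_model_space(1)[OF vK pq(1)])
    show "(\<lambda>z. cnj \<alpha> * q z - cnj (\<beta> * \<Theta> 0) * u' z) \<in> H2"
      by (intro H2_diff H2_cmult pq u')
    show "AE z in circ. g z * u z = v z + \<theta> z * p z + cnj (z * (cnj \<alpha> * q z - cnj (\<beta> * \<Theta> 0) * u' z))"
      using a pq(3) AE_unit
    proof eventually_elim
      case (elim z)
      have "cnj (z * (cnj \<alpha> * q z - cnj (\<beta> * \<Theta> 0) * u' z))
          = \<alpha> * cnj (z * q z) - \<beta> * \<Theta> 0 * ((z * cnj z) * (cnj (\<theta> z) * u z))"
        by (simp add: u'_def algebra_simps)
      also have "cnj (z * q z) = cnj (\<theta> z) * (u z * g1 z) - p z" using elim(2) by simp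
      finally show ?case using elim(3) unfolding elim(1) by (simp add: v_def algebra_simps)
    qed
  qed
  then have tv: "AE z in circ. trunc_toeplitz \<Theta> g u z = v z" by (simp add: trunc_toeplitz_def)
  note b1' = b1[unfolded model_space_plus_iff] and b2' = b2[unfolded model_space_plus_iff]
  have "(\<lambda>z. f z * v z) \<in> K"
  proof (rule model_spaceI_H1)
    show "(\<lambda>z. f z * v z) \<in> L2"
      by (rule L2_cong_AE[OF ft]) (use tv in \<open>eventually_elim, simp\<close>)
    have "(\<lambda>z. (f z * (g1 z + \<beta>)) * u z + (f z * (\<alpha> - \<theta> z)) * p z) \<in> H1"
      using b1' b2' by (intro H1_add H2_mult_H1 uH pq) auto
    then show "(\<lambda>z. f z * v z) \<in> H1" by (simp add: v_def algebra_simps)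
    show "(\<lambda>z. \<theta> z * cnj z * cnj (f z * v z)) \<in> H1"
    proof (rule H1_cong_AE)
      \<comment> \<open>Grouped by \<open>u'\<close> and \<open>q\<close>: the first factor is (c),
        the second comes from the membership of \<open>f * (\<alpha> - \<theta>)\<close>.\<close>
      show "(\<lambda>z. u' z * (cnj \<beta> * cnj (f z) + cnj \<alpha> * \<theta> z * cnj (f z * g1 z))
          - q z * (\<theta> z * cnj (f z * (\<alpha> - \<theta> z)))) \<in> H1"
        using b2' by (intro H1_diff H2_mult_H1 u' c pq) auto
      show "AE z in circ. u' z * (cnj \<beta> * cnj (f z) + cnj \<alpha> * \<theta> z * cnj (f z * g1 z))
          - q z * (\<theta> z * cnj (f z * (\<alpha> - \<theta> z))) = \<theta> z * cnj z * cnj (f z * v z)"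
        using cv AE_unit
      proof eventually_elim
        case (elim z)
        have "\<theta> z * cnj z * cnj (f z * v z) = cnj (f z) * (\<theta> z * cnj z * cnj (v z))" by simp
        also have "\<dots> = cnj (f z) * (cnj \<beta> * u' z + cnj \<alpha> * (u' z * G1 z) - cnj \<alpha> * (\<theta> z * q z) + (\<theta> z * cnj (\<theta> z)) * q z)"
          unfolding elim(1) using elim(2) by simp
        finally show ?case by (simp add: G1_def algebra_simps)
      qed
    qed
  qed
  then show "(\<lambda>z. f z * trunc_toeplitz \<Theta> g u z) \<in> K"
    by (rule model_space_cong_AE) (use tv in \<open>eventually_elim, simp\<close>)
qed

section \<open>Necessity of the four conditions\<close>

lemma ip_theta:
  assumes h: "h \<in> K"
  shows "ip h \<theta> = 0"
proof -
  have "\<forall>k\<in>H2. ip h (\<lambda>z. \<theta> z * k z) = 0" using h by (simp add: model_space_def)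
  from bspec[OF this H2_const[of 1]] show ?thesis by simp
qed

text \<open>Elimination in the space of all functions that \<open>f\<close> multiplies into
  \<open>model_space_plus \<Theta>\<close>.\<close>

lemma multiplier_combination:
  fixes e :: "nat \<Rightarrow> complex \<Rightarrow> complex" and \<phi> :: "nat \<Rightarrow> complex \<Rightarrow> complex"
  assumes mem: "\<And>w. norm w < 1 \<Longrightarrow> (\<lambda>z. f z * (\<Sum>i<n. \<phi> i w * e i z)) \<in> model_space_plus \<Theta>"
    and indep: "\<And>c. (\<And>w. norm w < 1 \<Longrightarrow> (\<Sum>i<n. c i * \<phi> i w) = 0) \<Longrightarrow> \<forall>i<n. c i = 0"
    and i: "i < n"
  shows "(\<lambda>z. f z * e i z) \<in> model_space_plus \<Theta>"
proof -
  have "e i \<in> {h. (\<lambda>z. f z * h z) \<in> model_space_plus \<Theta>}"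
  proof (rule independent_combination[where I = "{..<n}" and W = "ball 0 1" and \<phi> = \<phi> and e = e])
    fix h k c
    assume "h \<in> {h. (\<lambda>z. f z * h z) \<in> model_space_plus \<Theta>}" "k \<in> {h. (\<lambda>z. f z * h z) \<in> model_space_plus \<Theta>}"
    then show "(\<lambda>z. h z + c * k z) \<in> {h. (\<lambda>z. f z * h z) \<in> model_space_plus \<Theta>}"
      using model_space_plus_lincomb[of "\<lambda>z. f z * h z" "\<lambda>z. f z * k z" 1 c] by (simp add: algebra_simps)
  next
    show "(\<lambda>z. 0) \<in> {h. (\<lambda>z. f z * h z) \<in> model_space_plus \<Theta>}"
      by (simp add: model_space_plus_iff H2_const)
  qed (use mem indep i in auto)
  then show ?thesis by simp
qed

text \<open>The relation says \<open>cnj g1 = a * cnj \<theta> + d\<close>. Multiplied by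
  \<open>g1\<close> and integrated, the first term vanishes because \<open>g1\<close> is orthogonal
  to \<theta>, the second because \<open>g1\<close> has mean 0.\<close>

lemma flip_affine_imp_zero:
  assumes g1: "g1 \<in> K" "fcoeff g1 0 = 0" and ae: "AE z in circ. \<theta> z * cnj (g1 z) = a + d * \<theta> z"
  shows "AE z in circ. g1 z = 0"
proof (rule ip_zero_imp_AE)
  show L: "g1 \<in> L2" by (intro H2_imp_L2 model_space_H2 g1)
  have [measurable]: "g1 \<in> borel_measurable circ" using L by (rule L2_measurable)
  have i: "integrable circ (\<lambda>z. g1 z * cnj (\<theta> z))"
    by (intro L2_mult_integrable L2_cnj L H2_imp_L2 theta_H2)
  have "ip g1 g1 = (LINT z|circ. a * (g1 z * cnj (\<theta> z)) + d * g1 z)"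
    unfolding ip_def
  proof (rule integral_cong_AE)
    show "AE z in circ. g1 z * cnj (g1 z) = a * (g1 z * cnj (\<theta> z)) + d * g1 z"
      using ae AE_unit
    proof eventually_elim
      case (elim z)
      have "cnj (g1 z) = (\<theta> z * cnj (\<theta> z)) * cnj (g1 z)" using elim by simp
      also have "\<dots> = cnj (\<theta> z) * (a + d * \<theta> z)" unfolding elim(1)[symmetric] by simp
      also have "\<dots> = a * cnj (\<theta> z) + d * (\<theta> z * cnj (\<theta> z))" by (simp add: algebra_simps)
      finally show ?case using elim by (simp add: algebra_simps)
    qed
  qed measurable
  also have "\<dots> = a * ip g1 \<theta> + d * (LINT z|circ. g1 z)"
    unfolding ip_def using i L2_integrable[OF L] by simp
  also have "(LINT z|circ. g1 z) = fcoeff g1 0" by (simp add: fcoeff_def ip_def)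
  finally show "ip g1 g1 = 0" using ip_theta[OF g1(1)] g1(2) by simp
qed

text \<open>Pairing the relation with \<theta> gives \<open>0 = a * cnj (\<Theta> 0) + d\<close>;
  the middle term is \<open>b\<close> times the conjugate mean of \<open>g1\<close>, which is
  0.\<close>

lemma ip_affine_theta:
  assumes g1: "g1 \<in> K" "fcoeff g1 0 = 0" and g2: "g2 \<in> K"
    and ae: "AE z in circ. g2 z = a + b * (\<theta> z * cnj (g1 z)) + d * \<theta> z"
  shows "d = - a * cnj (\<Theta> 0)"
proof -
  have L: "g1 \<in> L2" "g2 \<in> L2" by (intro H2_imp_L2 model_space_H2 g1 g2)+
  have [measurable]: "g1 \<in> borel_measurable circ" "g2 \<in> borel_measurable circ" using L by (auto intro: L2_measurable)
  have "ip g2 \<theta> = (LINT z|circ. a * cnj (\<theta> z) + b * cnj (g1 z) + d)"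
    unfolding ip_def
  proof (rule integral_cong_AE)
    show "AE z in circ. g2 z * cnj (\<theta> z) = a * cnj (\<theta> z) + b * cnj (g1 z) + d"
      using ae AE_unit
    proof eventually_elim
      case (elim z)
      have "g2 z * cnj (\<theta> z) = a * cnj (\<theta> z) + b * (\<theta> z * cnj (\<theta> z)) * cnj (g1 z) + d * (\<theta> z * cnj (\<theta> z))"
        unfolding elim(1) by (simp add: algebra_simps)
      then show ?case using elim by simp
    qed
  qed measurable
  also have "\<dots> = a * cnj (LINT z|circ. \<theta> z) + b * cnj (LINT z|circ. g1 z) + d"
    using L2_integrable[OF L(1)] H2_integrable[OF theta_H2]
    by (simp add: Bochner_Integration.integral_cnj)
  also have "(LINT z|circ. g1 z) = fcoeff g1 0" by (simp add: fcoeff_def ip_def)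
  also have "(LINT z|circ. \<theta> z) = disk_value \<theta> 0" by (simp add: disk_value_0) (simp add: fcoeff_def ip_def)
  also have "disk_value \<theta> 0 = \<Theta> 0" by (simp add: disk_value_theta)
  finally have "a * cnj (\<Theta> 0) + d = 0" using ip_theta[OF g2] g1(2) by simp
  then show ?thesis by algebra
qed

text \<open>With \<open>g1 = 0\<close> only the coefficients \<open>g2 w\<close> and
  \<open>\<Theta> w\<close> remain. If they are independent, \<open>f\<close> and
  \<open>f * \<theta> * cnj g2\<close> are in the enlarged model space, and the second function
  flips to \<open>cnj (f * g)\<close>. Otherwise \<open>g2\<close> is a multiple of \<theta>, and
  being orthogonal to \<theta> it is zero.\<close>

lemma hankel_toeplitz_zero_imp_coanalytic:
  assumes nc: "\<not> \<Theta> constant_on ball 0 1" and zero: "hankel_toeplitz_zero \<Theta> f g"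
    and g1: "g1 \<in> K" and g2: "g2 \<in> K" and g: "AE z in circ. g z = g1 z + cnj (g2 z)"
    and g10: "AE z in circ. g1 z = 0"
  shows "(AE z in circ. g z = 0) \<or>
    (f \<in> model_space_plus \<Theta> \<and> (\<lambda>z. cnj (g z)) \<in> H2 \<and> (\<lambda>z. cnj (f z * g z)) \<in> H2)"
proof -
  define \<phi> where "\<phi> = (\<lambda>i. [\<lambda>w. cnj (disk_value g2 w), \<lambda>w. cnj (\<Theta> w)] ! i)"
  define e where "e = (\<lambda>i. [\<lambda>z. 1, \<lambda>z. - (\<theta> z * cnj (g2 z))] ! i)"
  have gg: "AE z in circ. g z = cnj (g2 z)" using g g10 by eventually_elim simp
  have mem: "(\<lambda>z. f z * (\<Sum>i<2. \<phi> i w * e i z)) \<in> model_space_plus \<Theta>" if w: "norm w < 1" for w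
  proof (rule model_space_plus_cong_AE[OF hankel_toeplitz_zeroD[OF zero g1 g2 g w]])
    have d: "disk_value (\<lambda>z. \<theta> z * cnj (g1 z)) w = 0"
      by (rule disk_value_zero) (use g10 in \<open>eventually_elim, simp\<close>)
    show "AE z in circ. f z * kernel_numerator g1 g2 w z = f z * (\<Sum>i<2. \<phi> i w * e i z)"
      using g10
    proof eventually_elim
      case (elim z)
      show ?case unfolding kernel_numerator_def d elim by (simp add: \<phi>_def e_def numeral_2_eq_2)
    qed
  qed
  show ?thesis
  proof (cases "\<forall>c. (\<forall>w. norm w < 1 \<longrightarrow> (\<Sum>i<2. c i * \<phi> i w) = 0) \<longrightarrow> (\<forall>i<2. c i = 0)")
    case True
    have fe: "(\<lambda>z. f z * e i z) \<in> model_space_plus \<Theta>" if "i < 2" for i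
      by (rule multiplier_combination[OF mem _ that]) (use True in auto)
    have f: "f \<in> model_space_plus \<Theta>" using fe[of 0] by (simp add: e_def)
    have "(\<lambda>z. - (\<theta> z * cnj (f z * e 1 z))) \<in> H2"
      using H2_cmult[of _ "-1"] fe[of 1] by (simp add: model_space_plus_iff)
    moreover have "AE z in circ. - (\<theta> z * cnj (f z * e 1 z)) = cnj (f z * g z)"
      using gg AE_unit
    proof eventually_elim
      case (elim z)
      have "- (\<theta> z * cnj (f z * e 1 z)) = (\<theta> z * cnj (\<theta> z)) * (cnj (f z) * g2 z)" by (simp add: e_def)
      then show ?case using elim by simp
    qed
    ultimately have "(\<lambda>z. cnj (f z * g z)) \<in> H2" by (rule H2_cong_AE)
    moreover have "(\<lambda>z. cnj (g z)) \<in> H2"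
      by (rule H2_cong_AE[OF model_space_H2[OF g2]]) (use gg in \<open>eventually_elim, simp\<close>)
    ultimately show ?thesis using f by blast
  next
    case False
    then obtain c where c: "\<And>w. norm w < 1 \<Longrightarrow> c 0 * cnj (disk_value g2 w) + c 1 * cnj (\<Theta> w) = 0" "c 0 \<noteq> 0 \<or> c (1::nat) \<noteq> 0"
      by (auto simp: \<phi>_def numeral_2_eq_2 less_Suc_eq)
    have "0 + cnj (c 0) * disk_value g2 w + 0 * disk_value g2 w + cnj (c 1) * \<Theta> w = 0" if "norm w < 1" for w
      using arg_cong[OF c(1)[OF that], of cnj] by simp
    then have ae: "AE z in circ. 0 + cnj (c 0) * g2 z + 0 * g2 z + cnj (c 1) * \<theta> z = 0"
      by (intro disk_value_relation model_space_H2 g2)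
    have c0: "c 0 \<noteq> 0"
    proof
      assume "c 0 = 0"
      then show False using affine_theta_zero_imp[OF nc, of 0 "cnj (c 1)"] ae c(2) by simp
    qed
    define d where "d = - cnj (c 1) / cnj (c 0)"
    \<comment> \<open>Padded with zero terms to fit \<open>ip_affine_theta\<close>, with the zero
      function in the role of \<open>g1\<close>.\<close>
    have ae': "AE z in circ. g2 z = 0 + 0 * (\<theta> z * cnj ((\<lambda>z. 0) z)) + d * \<theta> z"
      using ae
    proof eventually_elim
      case (elim z)
      have "cnj (c 0) * g2 z = - cnj (c 1) * \<theta> z" using elim by algebra
      then have "g2 z = - cnj (c 1) * \<theta> z / cnj (c 0)"
        using c0 by (metis complex_cnj_zero_iff nonzero_mult_div_cancel_left)
      then show ?case by (simp add: d_def)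
    qed
    have "(\<lambda>z. 0) \<in> K" by (simp add: model_space_iff H2_const)
    from ip_affine_theta[OF this _ g2 ae'] have d: "d = 0" by (simp add: fcoeff_const)
    have "AE z in circ. g z = 0" using ae' gg by eventually_elim (simp add: d)
    then show ?thesis ..
  qed
qed

text \<open>For nonzero \<open>g1\<close> the functions 1, \<open>G1\<close> and \<theta> are
  independent, so a dependence among the four coefficients can be solved for \<open>g2\<close>. A
  second elimination with the three remaining coefficients then yields the memberships.\<close>

lemma hankel_toeplitz_zero_imp_relation:
  assumes nc: "\<not> \<Theta> constant_on ball 0 1" and zero: "hankel_toeplitz_zero \<Theta> f g"
    and g1: "g1 \<in> K" "fcoeff g1 0 = 0" and g2: "g2 \<in> K" and g: "AE z in circ. g z = g1 z + cnj (g2 z)"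
    and g10: "\<not> (AE z in circ. g1 z = 0)"
  shows "(\<exists>c. AE z in circ. f z = c) \<or>
    (\<exists>\<alpha> \<beta>.
       (AE z in circ. g z = g1 z + \<alpha> * cnj (\<theta> z) * g1 z + \<beta> * (1 - \<Theta> 0 * cnj (\<theta> z))) \<and>
       (\<lambda>z. f z * (g1 z + \<beta>)) \<in> model_space_plus \<Theta> \<and>
       (\<lambda>z. f z * (\<alpha> - \<theta> z)) \<in> model_space_plus \<Theta> \<and>
       (\<lambda>z. cnj \<beta> * cnj (f z) + cnj \<alpha> * \<theta> z * cnj (f z * g1 z)) \<in> H2)"
proof -
  define G1 where "G1 = (\<lambda>z. \<theta> z * cnj (g1 z))"
  have G1: "G1 \<in> H2" unfolding G1_def by (rule model_space_flip_H2[OF g1(1)])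
  \<comment> \<open>A dependence involving \<open>G1\<close> would force \<open>g1 = 0\<close>; one
    without it would make \<Theta> constant.\<close>
  have rel0: "a = 0 \<and> c = 0 \<and> d = 0" if ae: "AE z in circ. a + c * G1 z + d * \<theta> z = 0" for a c d
  proof -
    have "c = 0"
    proof (rule ccontr)
      assume c: "c \<noteq> 0"
      have "AE z in circ. \<theta> z * cnj (g1 z) = (- a / c) + (- d / c) * \<theta> z"
        using ae
      proof eventually_elim
        case (elim z)
        have "c * G1 z = - a - d * \<theta> z" using elim by algebra
        then have "G1 z = (- a - d * \<theta> z) / c" using c by (metis nonzero_mult_div_cancel_left)
        then show ?case by (simp add: G1_def diff_divide_distrib)
      qed
      then show False using flip_affine_imp_zero[OF g1] g10 by blast
    qed
    then show ?thesis using affine_theta_zero_imp[OF nc, of a d] ae by simp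
  qed
  define \<phi> where "\<phi> = (\<lambda>i. [\<lambda>w. 1, \<lambda>w. cnj (disk_value g2 w), \<lambda>w. cnj (disk_value G1 w), \<lambda>w. cnj (\<Theta> w)] ! i)"
  define e where "e = (\<lambda>i. [g1, \<lambda>z. 1, \<lambda>z. - \<theta> z, \<lambda>z. - (\<theta> z * cnj (g2 z))] ! i)"
  have mem: "(\<lambda>z. f z * (\<Sum>i<4. \<phi> i w * e i z)) \<in> model_space_plus \<Theta>" if w: "norm w < 1" for w
    using hankel_toeplitz_zeroD[OF zero g1(1) g2 g w]
    by (simp add: \<phi>_def e_def eval_nat_numeral kernel_numerator_def G1_def)
  show ?thesis
  proof (cases "\<forall>c. (\<forall>w. norm w < 1 \<longrightarrow> (\<Sum>i<4. c i * \<phi> i w) = 0) \<longrightarrow> (\<forall>i<4. c i = 0)")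
    case True
    have fe: "(\<lambda>z. f z * e i z) \<in> model_space_plus \<Theta>" if "i < 4" for i
      by (rule multiplier_combination[OF mem _ that]) (use True in auto)
    \<comment> \<open>Of the four memberships, those of \<open>f\<close> and
      \<open>f * \<theta>\<close> suffice: the second one makes \<open>cnj f\<close>
      analytic.\<close>
    have "f \<in> H2" using fe[of 1] by (simp add: e_def model_space_plus_iff)
    moreover have "(\<lambda>z. cnj (f z)) \<in> H2"
    proof (rule H2_cong_AE)
      show "(\<lambda>z. (-1) * (\<theta> z * cnj (f z * e 2 z))) \<in> H2"
        using fe[of 2] by (intro H2_cmult) (simp add: model_space_plus_iff)
      show "AE z in circ. (-1) * (\<theta> z * cnj (f z * e 2 z)) = cnj (f z)"
        using AE_unit
      proof eventually_elim
        case (elim z)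
        have "(-1) * (\<theta> z * cnj (f z * e 2 z)) = (\<theta> z * cnj (\<theta> z)) * cnj (f z)"
          by (simp add: e_def eval_nat_numeral)
        then show ?case using elim by simp
      qed
    qed
    ultimately have "AE z in circ. f z = fcoeff f 0" by (rule H2_AE_eq_const)
    then show ?thesis by blast
  next
    case False
    then obtain c where c: "\<And>w. norm w < 1 \<Longrightarrow> (\<Sum>i<4. c i * \<phi> i w) = 0" and cn: "\<exists>i<4. c i \<noteq> 0" by blast
    have "cnj (c 0) + cnj (c 1) * disk_value g2 w + cnj (c 2) * disk_value G1 w + cnj (c 3) * \<Theta> w = 0" if "norm w < 1" for w
      using arg_cong[OF c[OF that], of cnj] by (simp add: \<phi>_def eval_nat_numeral)
    then have ae: "AE z in circ. cnj (c 0) + cnj (c 1) * g2 z + cnj (c 2) * G1 z + cnj (c 3) * \<theta> z = 0"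
      by (intro disk_value_relation model_space_H2 g2 G1)
    have c1: "c 1 \<noteq> 0"
    proof
      assume c1: "c 1 = 0"
      then have "c 0 = 0 \<and> c 2 = 0 \<and> c 3 = 0"
        using rel0[of "cnj (c 0)" "cnj (c 2)" "cnj (c 3)"] ae by simp
      with c1 cn show False by (auto simp: eval_nat_numeral less_Suc_eq)
    qed
    \<comment> \<open>The relation divided by the coefficient of \<open>g2\<close>. The
      \<open>c i\<close> multiply conjugated values, so conjugates of \<alpha> and \<beta> appear in
      the formula for \<open>g2\<close>.\<close>
    define \<beta> \<alpha> d where "\<beta> = - c 0 / c 1" and "\<alpha> = - c 2 / c 1" and "d = - cnj (c 3) / cnj (c 1)"
    have g2eq: "AE z in circ. g2 z = cnj \<beta> + cnj \<alpha> * (\<theta> z * cnj (g1 z)) + d * \<theta> z"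
      using ae
    proof eventually_elim
      case (elim z)
      have "cnj (c 1) * g2 z = - cnj (c 0) - cnj (c 2) * G1 z - cnj (c 3) * \<theta> z" using elim by algebra
      then have "g2 z = (- cnj (c 0) - cnj (c 2) * G1 z - cnj (c 3) * \<theta> z) / cnj (c 1)"
        using c1 by (metis complex_cnj_zero_iff nonzero_mult_div_cancel_left)
      then show ?case by (simp add: \<beta>_def \<alpha>_def d_def G1_def diff_divide_distrib)
    qed
    have d: "d = - cnj \<beta> * cnj (\<Theta> 0)" by (rule ip_affine_theta[OF g1 g2 g2eq])
    have g2eq': "AE z in circ. g2 z = cnj \<beta> + cnj \<alpha> * (\<theta> z * cnj (g1 z)) - cnj \<beta> * cnj (\<Theta> 0) * \<theta> z"
      using g2eq by (simp add: d)
    define \<psi> where "\<psi> = (\<lambda>i. [\<lambda>w. 1, \<lambda>w. cnj (disk_value G1 w), \<lambda>w. cnj (\<Theta> w)] ! i)"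
    \<comment> \<open>The three functions of \<open>kernel_numerator_eq\<close>; their coefficients
      \<psi> are independent by \<open>rel0\<close>.\<close>
    define k where "k = (\<lambda>i. [\<lambda>z. g1 z + \<beta>, \<lambda>z. \<alpha> - \<theta> z, \<lambda>z. - (\<beta> * \<theta> z + \<alpha> * g1 z)] ! i)"
    have fk: "(\<lambda>z. f z * k i z) \<in> model_space_plus \<Theta>" if "i < 3" for i
    proof (rule multiplier_combination[OF _ _ that])
      fix w :: complex assume w: "norm w < 1"
      show "(\<lambda>z. f z * (\<Sum>i<3. \<psi> i w * k i z)) \<in> model_space_plus \<Theta>"
      proof (rule model_space_plus_cong_AE[OF hankel_toeplitz_zeroD[OF zero g1(1) g2 g w]])
        show "AE z in circ. f z * kernel_numerator g1 g2 w z = f z * (\<Sum>i<3. \<psi> i w * k i z)"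
          using kernel_numerator_eq[OF g1(1) g2 w g2eq']
        proof eventually_elim
          case (elim z)
          show ?case unfolding elim by (simp add: \<psi>_def k_def eval_nat_numeral G1_def algebra_simps)
        qed
      qed
    next
      fix b assume b: "\<And>w. norm w < 1 \<Longrightarrow> (\<Sum>i<3. b i * \<psi> i w) = 0"
      have "cnj (b 0) + cnj (b 1) * disk_value G1 w + 0 * disk_value G1 w + cnj (b 2) * \<Theta> w = 0" if "norm w < 1" for w
        using arg_cong[OF b[OF that], of cnj] by (simp add: \<psi>_def eval_nat_numeral)
      then have "AE z in circ. cnj (b 0) + cnj (b 1) * G1 z + 0 * G1 z + cnj (b 2) * \<theta> z = 0"
        by (intro disk_value_relation G1)
      then have "b 0 = 0 \<and> b 1 = 0 \<and> b 2 = 0"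
        using rel0[of "cnj (b 0)" "cnj (b 1)" "cnj (b 2)"] by simp
      then show "\<forall>i<3. b i = 0" by (auto simp: eval_nat_numeral less_Suc_eq)
    qed
    have "AE z in circ. g z = g1 z + \<alpha> * cnj (\<theta> z) * g1 z + \<beta> * (1 - \<Theta> 0 * cnj (\<theta> z))"
      using g g2eq'
    proof eventually_elim
      case (elim z)
      show ?case unfolding elim by (simp add: algebra_simps)
    qed
    moreover have "(\<lambda>z. f z * (g1 z + \<beta>)) \<in> model_space_plus \<Theta>" using fk[of 0] by (simp add: k_def)
    moreover have "(\<lambda>z. f z * (\<alpha> - \<theta> z)) \<in> model_space_plus \<Theta>" using fk[of 1] by (simp add: k_def)
    \<comment> \<open>This is \<theta> times the conjugate of
      \<open>f * (\<beta> * \<theta> + \<alpha> * g1)\<close>. Hence \<open>g1\<close> occurs in (c)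
      with the factor \<open>f\<close>, where the English statement has \<open>g1\<close>
      alone.\<close>
    moreover have "(\<lambda>z. cnj \<beta> * cnj (f z) + cnj \<alpha> * \<theta> z * cnj (f z * g1 z)) \<in> H2"
    proof (rule H2_cong_AE)
      show "(\<lambda>z. (-1) * (\<theta> z * cnj (f z * k 2 z))) \<in> H2"
        using fk[of 2] by (intro H2_cmult) (simp add: model_space_plus_iff)
      show "AE z in circ. (-1) * (\<theta> z * cnj (f z * k 2 z)) = cnj \<beta> * cnj (f z) + cnj \<alpha> * \<theta> z * cnj (f z * g1 z)"
        using AE_unit
      proof eventually_elim
        case (elim z)
        have "(-1) * (\<theta> z * cnj (f z * k 2 z)) = cnj \<beta> * (\<theta> z * cnj (\<theta> z)) * cnj (f z) + cnj \<alpha> * \<theta> z * cnj (f z * g1 z)"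
          by (simp add: k_def eval_nat_numeral algebra_simps)
        then show ?case using elim by simp
      qed
    qed
    ultimately show ?thesis by blast
  qed
qed

end

theorem theorem3p1:
  fixes \<Theta> f g g1 g2 :: "complex \<Rightarrow> complex"
  assumes "inner_function \<Theta>"
    and "\<not> \<Theta> constant_on ball 0 1"
    and "f \<in> L2"
    and "g1 \<in> model_space \<Theta>"
    and "g2 \<in> model_space \<Theta>"
    and "disk_value g1 0 = 0"
    and "AE z in circ. g z = g1 z + cnj (g2 z)"
  shows "hankel_toeplitz_zero \<Theta> f g \<longleftrightarrow>
    (AE z in circ. g z = 0) \<or>
    (\<exists>c. AE z in circ. f z = c) \<or>
    (f \<in> model_space_plus \<Theta> \<and> (\<lambda>z. cnj (g z)) \<in> H2 \<and> (\<lambda>z. cnj (f z * g z)) \<in> H2) \<or>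
    (\<exists>\<alpha> \<beta>.
       (AE z in circ. g z = g1 z + \<alpha> * cnj (radial_lim \<Theta> z) * g1 z
                              + \<beta> * (1 - \<Theta> 0 * cnj (radial_lim \<Theta> z))) \<and>
       (\<lambda>z. f z * (g1 z + \<beta>)) \<in> model_space_plus \<Theta> \<and>
       (\<lambda>z. f z * (\<alpha> - radial_lim \<Theta> z)) \<in> model_space_plus \<Theta> \<and>
       (\<lambda>z. cnj \<beta> * cnj (f z) + cnj \<alpha> * radial_lim \<Theta> z * cnj (f z * g1 z)) \<in> H2)"
    (is "?zero \<longleftrightarrow> ?c1 \<or> ?c2 \<or> ?c3 \<or> ?c4")
proof -
  interpret inner \<Theta> by unfold_locales (rule assms(1))
  note nc = assms(2) and f = assms(3) and g1 = assms(4) and g2 = assms(5) and g = assms(7)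
  have g10: "fcoeff g1 0 = 0" using assms(6) by (simp add: disk_value_0)
  have gL2: "g \<in> L2"
  proof (rule L2_cong_AE)
    show "(\<lambda>z. g1 z + cnj (g2 z)) \<in> L2" by (intro L2_add L2_cnj H2_imp_L2 model_space_H2 g1 g2)
    show "AE z in circ. g1 z + cnj (g2 z) = g z" using g by eventually_elim simp
  qed
  show ?thesis
  proof
    assume zero: ?zero
    show "?c1 \<or> ?c2 \<or> ?c3 \<or> ?c4"
    \<comment> \<open>For \<open>g1 = 0\<close> also \<open>G1 = 0\<close>, a dependence that says
      nothing about \<open>g2\<close>; that case works with two coefficients instead of
      four.\<close>
    proof (cases "AE z in circ. g1 z = 0")
      case True
      show ?thesis using hankel_toeplitz_zero_imp_coanalytic[OF nc zero g1 g2 g True] by blast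
    next
      case False
      show ?thesis using hankel_toeplitz_zero_imp_relation[OF nc zero g1 g10 g2 g False] by blast
    qed
  next
    assume "?c1 \<or> ?c2 \<or> ?c3 \<or> ?c4"
    then consider ?c1 | ?c2 | ?c3 | ?c4 by blast
    then show ?zero
    proof cases
      case 1
      then show ?thesis by (rule hankel_toeplitz_zero_if_symbol_zero)
    next
      case 2
      then show ?thesis using hankel_toeplitz_zero_if_const[OF gL2] by blast
    next
      case 3
      then show ?thesis using hankel_toeplitz_zero_if_coanalytic[OF _ g1 g10 g2 g] by blast
    next
      case 4
      then show ?thesis using hankel_toeplitz_zero_if_relation[OF f g1 g2 g] by blast
    qed
  qed
qed

end
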